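(* Let $G$ be a finite soluble group such that $G/Z_\infty(G)$ is not a Frobenius group. Then $\operatorname{diam}\Gamma(G)\le 4$. Furthermore, there exists a finite soluble group $G$ such that $\operatorname{diam}\Gamma(G)=4$.
   Context: Commutators: $[a,b]=a^{-1}b^{-1}ab$, $[x,{}_0y]=x$, and $[x,{}_{i+1}y]=[[x,{}_iy],y]$ for $i\ge 0$. $Z_\infty(G)$ denotes the hypercenter of $G$ (the final term of the upper central series). The Engel graph $\Gamma(G)$ is the directed graph whose vertices are the elements of $G\setminus Z_\infty(G)$ and where there is an edge $x\mapsto y$ if and only if $[x,{}_ny]=1$ for some integer $n>0$. The diameter $\operatorname{diam}\Gamma(G)$ is the maximum, over all ordered pairs of vertices $(x,y)$, of the directed distance from $x$ to $y$, i.e. the length of a shortest directed path from $x$ to $y$ (infinite if there is no such path). In particular $\operatorname{diam}\Gamma(G)\le 4$ means that for all vertices $x,y$ there is a directed path from $x$ to $y$ of length at most $4$. *)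

theory Defs
  imports "HOL-Algebra.Algebra" "Graph_Theory.Graph_Theory" "HOL-Library.Extended_Nat"
begin

section \<open>Group theory\<close>

definition commutator :: "('a, 'b) monoid_scheme \<Rightarrow> 'a \<Rightarrow> 'a \<Rightarrow> 'a" where
  "commutator G a b = inv\<^bsub>G\<^esub> a \<otimes>\<^bsub>G\<^esub> inv\<^bsub>G\<^esub> b \<otimes>\<^bsub>G\<^esub> a \<otimes>\<^bsub>G\<^esub> b"

primrec engel_commutator :: "('a, 'b) monoid_scheme \<Rightarrow> 'a \<Rightarrow> nat \<Rightarrow> 'a \<Rightarrow> 'a" where
  "engel_commutator G x 0 y = x"
| "engel_commutator G x (Suc i) y = commutator G (engel_commutator G x i y) y"

definition group_center :: "('a, 'b) monoid_scheme \<Rightarrow> 'a set" where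
  "group_center G = {z \<in> carrier G. \<forall>g \<in> carrier G. z \<otimes>\<^bsub>G\<^esub> g = g \<otimes>\<^bsub>G\<^esub> z}"

text \<open>The next term of the series is the preimage in \<open>G\<close> of the center of the quotient by the
  current term.\<close>

primrec upper_central :: "('a, 'b) monoid_scheme \<Rightarrow> nat \<Rightarrow> 'a set" where
  "upper_central G 0 = {\<one>\<^bsub>G\<^esub>}"
| "upper_central G (Suc n) =
     {x \<in> carrier G. upper_central G n #>\<^bsub>G\<^esub> x \<in> group_center (G Mod upper_central G n)}"

text \<open>The series is ascending, so for a finite group its final (stable) term is the union of all
  its terms; see \<open>hypercenter_final_term\<close> below. For infinite groups the series would have to be
  continued transfinitely, which is not done here.\<close>

definition hypercenter :: "('a, 'b) monoid_scheme \<Rightarrow> 'a set" where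
  "hypercenter G = (\<Union>n. upper_central G n)"

text \<open>A Frobenius group is a group with a Frobenius complement: a nontrivial proper subgroup
  intersecting each of its conjugates by outside elements trivially.\<close>

definition frobenius_group :: "('a, 'b) monoid_scheme \<Rightarrow> bool" where
  "frobenius_group G \<longleftrightarrow> group G \<and>
     (\<exists>H. subgroup H G \<and> H \<noteq> {\<one>\<^bsub>G\<^esub>} \<and> H \<noteq> carrier G \<and>
          (\<forall>g \<in> carrier G - H. H \<inter> (g <#\<^bsub>G\<^esub> H #>\<^bsub>G\<^esub> inv\<^bsub>G\<^esub> g) = {\<one>\<^bsub>G\<^esub>}))"


section \<open>Distance and diameter in digraphs\<close>

text \<open>The infimum over the empty set in \<^typ>\<open>enat\<close> is \<open>\<infinity>\<close>, so the distance is infinite if there is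
  no directed path. The diameter of the graph without vertices is \<open>0\<close>.\<close>

definition digraph_dist :: "('a, 'b) pre_digraph \<Rightarrow> 'a \<Rightarrow> 'a \<Rightarrow> enat" where
  "digraph_dist D u v = (INF p \<in> {p. pre_digraph.apath D u p v}. enat (length p))"

definition digraph_diam :: "('a, 'b) pre_digraph \<Rightarrow> enat" where
  "digraph_diam D = (SUP (u, v) \<in> verts D \<times> verts D. digraph_dist D u v)"


section \<open>The Engel graph\<close>

text \<open>The definition produces a loop at every vertex; loops do not affect distances.\<close>

definition engel_graph :: "('a, 'b) monoid_scheme \<Rightarrow> 'a pair_pre_digraph" where
  "engel_graph G =
     \<lparr> pverts = carrier G - hypercenter G,
       parcs = {(x, y). x \<in> carrier G - hypercenter G \<and> y \<in> carrier G - hypercenter G \<and>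
                        (\<exists>n > 0. engel_commutator G x n y = \<one>\<^bsub>G\<^esub>)} \<rparr>"


section \<open>Basic facts about the definitions\<close>

lemma (in group) normal_upper_central: "upper_central G n \<lhd> G"
proof (induction n)
  case 0
  then show ?case using one_is_normal by simp
next
  case (Suc n)
  let ?N = "upper_central G n"
  interpret N: normal ?N G by (rule Suc)
  have mult: "(?N #> x) <#> (?N #> y) = ?N #> (x \<otimes> y)"
    if "x \<in> carrier G" "y \<in> carrier G" for x y
    using that by (rule N.rcos_sum)
  have iff: "x \<in> upper_central G (Suc n) \<longleftrightarrow>
      x \<in> carrier G \<and> (\<forall>g \<in> carrier G. ?N #> (x \<otimes> g) = ?N #> (g \<otimes> x))" for x
    by (auto simp: group_center_def carrier_FactGroup FactGroup_def RCOSETS_def mult)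
  show ?case
  proof (rule normal_invI)
    show "subgroup (upper_central G (Suc n)) G"
    proof (rule subgroupI)
      show "upper_central G (Suc n) \<subseteq> carrier G" by auto
      show "upper_central G (Suc n) \<noteq> {}" using iff[of \<one>] by auto
    next
      fix a assume a: "a \<in> upper_central G (Suc n)"
      then have ac: "a \<in> carrier G" and ae: "\<And>g. g \<in> carrier G \<Longrightarrow> ?N #> (a \<otimes> g) = ?N #> (g \<otimes> a)"
        using iff by auto
      show "inv a \<in> upper_central G (Suc n)"
        unfolding iff
      proof (intro conjI ballI)
        fix g assume g: "g \<in> carrier G"
        have "?N #> (a \<otimes> (inv a \<otimes> g \<otimes> inv a)) = ?N #> ((inv a \<otimes> g \<otimes> inv a) \<otimes> a)"
          using ac g by (intro ae) auto
        moreover have "a \<otimes> (inv a \<otimes> g \<otimes> inv a) = g \<otimes> inv a"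
          using ac g by (simp add: m_assoc[symmetric])
        moreover have "(inv a \<otimes> g \<otimes> inv a) \<otimes> a = inv a \<otimes> g"
          using ac g by (simp add: m_assoc)
        ultimately show "?N #> (inv a \<otimes> g) = ?N #> (g \<otimes> inv a)" by simp
      qed (use ac in auto)
    next
      fix a b assume a: "a \<in> upper_central G (Suc n)" and b: "b \<in> upper_central G (Suc n)"
      then have ac: "a \<in> carrier G" "b \<in> carrier G"
        and ae: "\<And>g. g \<in> carrier G \<Longrightarrow> ?N #> (a \<otimes> g) = ?N #> (g \<otimes> a)"
        and be: "\<And>g. g \<in> carrier G \<Longrightarrow> ?N #> (b \<otimes> g) = ?N #> (g \<otimes> b)"
        using iff by auto
      show "a \<otimes> b \<in> upper_central G (Suc n)"
        unfolding iff
      proof (intro conjI ballI)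
        fix g assume g: "g \<in> carrier G"
        have "?N #> (a \<otimes> b \<otimes> g) = ?N #> (a \<otimes> (b \<otimes> g))" using ac g by (simp add: m_assoc)
        also have "\<dots> = ?N #> (b \<otimes> g \<otimes> a)" using ac g by (intro ae) auto
        also have "\<dots> = ?N #> (b \<otimes> (g \<otimes> a))" using ac g by (simp add: m_assoc)
        also have "\<dots> = ?N #> (g \<otimes> a \<otimes> b)" using ac g by (intro be) auto
        finally show "?N #> (a \<otimes> b \<otimes> g) = ?N #> (g \<otimes> (a \<otimes> b))"
          using ac g by (simp add: m_assoc)
      qed (use ac in auto)
    qed
  next
    fix x h assume x: "x \<in> carrier G" and h: "h \<in> upper_central G (Suc n)"
    then have hc: "h \<in> carrier G"
      and he: "\<And>g. g \<in> carrier G \<Longrightarrow> ?N #> (h \<otimes> g) = ?N #> (g \<otimes> h)"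
      using iff by auto
    have eq: "?N #> (x \<otimes> h \<otimes> inv x) = ?N #> h"
    proof -
      have "?N #> (x \<otimes> h \<otimes> inv x) = (?N #> (x \<otimes> h)) <#> (?N #> inv x)"
        using x hc by (simp add: mult)
      also have "\<dots> = (?N #> (h \<otimes> x)) <#> (?N #> inv x)" using he[OF x] by simp
      also have "\<dots> = ?N #> (h \<otimes> x \<otimes> inv x)" using x hc by (simp add: mult)
      finally show ?thesis using x hc by (simp add: m_assoc)
    qed
    show "x \<otimes> h \<otimes> inv x \<in> upper_central G (Suc n)"
      using h x hc eq by simp
  qed
qed

lemma (in group) upper_central_mono: "upper_central G n \<subseteq> upper_central G (Suc n)"
proof
  fix x assume x: "x \<in> upper_central G n"
  interpret N: normal "upper_central G n" G by (rule normal_upper_central)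
  interpret Q: group "G Mod upper_central G n" by (rule N.factorgroup_is_group)
  have "upper_central G n #> x = \<one>\<^bsub>G Mod upper_central G n\<^esub>"
    using x N.rcos_const[OF is_group] by (simp add: FactGroup_def)
  moreover have "x \<in> carrier G" using x N.subset by auto
  moreover have "\<one>\<^bsub>G Mod upper_central G n\<^esub> \<in> group_center (G Mod upper_central G n)"
    unfolding group_center_def
    by (intro CollectI conjI ballI Q.one_closed) (simp only: Q.l_one Q.r_one)
  ultimately show "x \<in> upper_central G (Suc n)" by simp
qed

lemma (in group) hypercenter_final_term:
  assumes "finite (carrier G)"
  shows "\<exists>n. hypercenter G = upper_central G n \<and> (\<forall>m \<ge> n. upper_central G m = upper_central G n)"
proof -
  have mono: "upper_central G i \<subseteq> upper_central G j" if "i \<le> j" for i j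
    using lift_Suc_mono_le[of "upper_central G", OF upper_central_mono that] .
  have sub: "upper_central G i \<subseteq> carrier G" for i
    by (rule subgroup.subset[OF normal.axioms(1)[OF normal_upper_central]])
  have "finite (range (upper_central G))"
    by (rule finite_subset[of _ "Pow (carrier G)"]) (use assms sub in auto)
  then obtain N where N: "N \<in> range (upper_central G)"
      and max: "\<And>M. M \<in> range (upper_central G) \<Longrightarrow> N \<subseteq> M \<Longrightarrow> N = M"
    using finite_has_maximal[OF \<open>finite (range (upper_central G))\<close>] by (metis empty_not_UNIV image_is_empty)
  from N obtain n where n: "N = upper_central G n" by blast
  have stab: "upper_central G m = upper_central G n" if "m \<ge> n" for m
    using max[of "upper_central G m"] mono[OF that] n by simp
  have "upper_central G m \<subseteq> upper_central G n" for m
    using mono[of m "max m n"] stab[of "max m n"] by simp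
  then have "hypercenter G = upper_central G n"
    unfolding hypercenter_def by blast
  then show ?thesis
    using stab by blast
qed

lemma (in group) normal_hypercenter:
  assumes "finite (carrier G)"
  shows "hypercenter G \<lhd> G"
proof -
  obtain n where "hypercenter G = upper_central G n"
    using hypercenter_final_term[OF assms] by blast
  then show ?thesis using normal_upper_central[of n] by simp
qed

lemma wf_engel_graph: "wf_digraph (with_proj (engel_graph G))"
  by unfold_locales (auto simp: engel_graph_def)

lemma digraph_dist_le_iff:
  "digraph_dist D u v \<le> enat k \<longleftrightarrow> (\<exists>p. pre_digraph.apath D u p v \<and> length p \<le> k)"
proof
  assume le: "digraph_dist D u v \<le> enat k"
  let ?A = "(\<lambda>p. enat (length p)) ` {p. pre_digraph.apath D u p v}"
  have "?A \<noteq> {}"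
  proof
    assume "?A = {}"
    then have "digraph_dist D u v = \<infinity>"
      unfolding digraph_dist_def by (simp only: Inf_enat_def simp_thms if_True)
    then show False using le by simp
  qed
  then have "Inf ?A = (LEAST x. x \<in> ?A)" and "\<exists>x. x \<in> ?A"
    unfolding Inf_enat_def by (simp only: if_False, blast)
  then have "Inf ?A \<in> ?A" using LeastI_ex[of "\<lambda>x. x \<in> ?A"] by (simp only:)
  then show "\<exists>p. pre_digraph.apath D u p v \<and> length p \<le> k"
    using le by (auto simp: digraph_dist_def)
next
  assume "\<exists>p. pre_digraph.apath D u p v \<and> length p \<le> k"
  then obtain p where "pre_digraph.apath D u p v" "length p \<le> k" by blast
  then show "digraph_dist D u v \<le> enat k"
    unfolding digraph_dist_def by (intro INF_lower2[of p]) auto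
qed

lemma digraph_diam_le_iff:
  "digraph_diam D \<le> enat k \<longleftrightarrow>
     (\<forall>u \<in> verts D. \<forall>v \<in> verts D. \<exists>p. pre_digraph.apath D u p v \<and> length p \<le> k)"
  by (auto simp: digraph_diam_def SUP_le_iff digraph_dist_le_iff)

end

theory Submission
  imports Defs "HOL-Number_Theory.Pocklington" "HOL-Library.Numeral_Type"
begin

text \<open>Passing to the quotient by the hypercenter reduces the upper bound to a group \<open>G\<close> in which every \<open>x \<noteq> 1\<close> is a vertex.
  Let \<open>A\<close> be a minimal normal subgroup and \<open>K = C(A)\<close>. Every \<open>x\<close> has an edge to every \<open>f \<in> A\<close>, so
  there is a path \<open>x \<mapsto> f \<mapsto> a \<mapsto> b \<mapsto> y\<close> unless all \<open>a \<mapsto> b \<mapsto> y\<close> act on \<open>A\<close> without fixed points. In that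
  case the elements of \<open>G/K\<close> centralising a power \<open>b\<close> of \<open>y\<close> of prime order act on \<open>A\<close> without fixed
  points, and averaging over Frobenius groups \<open>M\<langle>b\<rangle>\<close> shows that \<open>b\<close> centralises the abelian normal
  subgroups of \<open>G/K\<close> of order prime to that of \<open>b\<close>. From this one finds \<open>d\<close> of prime order commuting with \<open>y\<close> whose
  image generates a normal subgroup of \<open>G/K\<close>. Since \<open>d\<close> acts on \<open>K\<close> without fixed points, \<open>K\<close> is an
  Engel subgroup and is complemented by \<open>N(\<langle>d\<rangle>)\<close>. Either this complement makes \<open>G\<close> a Frobenius group, or
  some \<open>h \<noteq> 1\<close> in it commutes with some \<open>k \<noteq> 1\<close> in \<open>K\<close>, and \<open>x \<mapsto> k \<mapsto> h \<mapsto> d \<mapsto> y\<close> is a path.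

  Diameter four is attained by the semidirect product of \<open>V\<^sub>1 \<oplus> V\<^sub>2\<close>, of dimensions 1 and 2 over the field with 13
  elements, with the dicyclic group of order 12, which acts on \<open>V\<^sub>1\<close> through its quotient of order 4
  and faithfully on \<open>V\<^sub>2\<close>: there is no shorter path from \<open>V\<^sub>2\<close> to an element of order 4.\<close>

text \<open>Fixed points are produced and excluded by counting: an element of prime order p has
  orbits of size 1 or p. A nontrivial k in K commuting with b would give the path x, f, k, b, y,
  because k fixes all of A. So b has no fixed points on K, p does not divide |K|, and commuting with
  b lifts from G/K to G. The averaging needs |M| prime to the exponent r of A; this is where
  minimality of A enters, since a group acting faithfully and irreducibly on A has no nontrivial
  normal abelian subgroup of exponent r. The obstacle is finding d: b itself may fail to generate a
  normal subgroup, as for b of order 3 in SL(2,3). What helps is that y acts nontrivially on any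
  normal subgroup of order t unless this yields a target; then some prime divisor of the order of y
  divides t - 1, so t is odd and the eigenvalues of an element of that prime order lie in the field
  with t elements. In the example, 13 is the least prime congruent to 1 modulo 12, so all roots of
  unity in question exist. Elements of order 3 fix the one-dimensional summand, which rules out a
  Frobenius group, while the plane has no such fixed points, which obstructs short paths starting in
  it.\<close>

hide_const (open) Divisibility.prime

section \<open>Elementary group theory\<close>

lemma funpow_fixed_mult:
  assumes "(f ^^ d) x = x"
  shows "(f ^^ (a * d)) x = x"
proof (induction a)
  case (Suc a)
  have "(f ^^ (Suc a * d)) x = (f ^^ d) ((f ^^ (a * d)) x)"
    by (simp add: funpow_add)
  then show ?case using Suc assms by simp
qed simp

lemma funpow_fixed_coprime:
  assumes "(f ^^ p) x = x" "(f ^^ d) x = x" "coprime d p" "d > 0"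
  shows "f x = x"
proof -
  obtain a b where "a * d = b * p + (1::nat)"
    using bezout_nat[of d p] assms(3,4) by (metis coprime_iff_gcd_eq_1 neq0_conv mult.commute)
  then have "(f ^^ (a * d)) x = f ((f ^^ (b * p)) x)" by simp
  then show ?thesis using funpow_fixed_mult[OF assms(1)] funpow_fixed_mult[OF assms(2)] by simp
qed

text \<open>The induction removes the orbit of one moved point. As \<open>p\<close> is prime, this
  orbit has exactly \<open>p\<close> elements, none of them fixed, so neither count changes modulo
  \<open>p\<close>.\<close>

lemma card_fixed_points_mod_prime:
  assumes "finite S" "f \<in> S \<rightarrow> S" and p: "prime (p::nat)"
    and "\<And>x. x \<in> S \<Longrightarrow> (f ^^ p) x = x"
  shows "card {x \<in> S. f x = x} mod p = card S mod p"
  using assms(1,2,4)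
proof (induction S rule: finite_psubset_induct)
  case (psubset S)
  show ?case
  proof (cases "\<forall>x \<in> S. f x = x")
    case True
    then have "{x \<in> S. f x = x} = S" by auto
    then show ?thesis by simp
  next
    case False
    then obtain x where x: "x \<in> S" "f x \<noteq> x" by auto
    define O' where "O' = (\<lambda>i. (f ^^ i) x) ` {..<p}"
    have iter: "(f ^^ i) y \<in> S" if "y \<in> S" for i y
      using that psubset.prems(1) by (induction i) auto
    have px: "(f ^^ p) x = x" using psubset.prems(2) x by simp
    have no: "(f ^^ d) x \<noteq> x" if "0 < d" "d < p" for d
    proof
      assume "(f ^^ d) x = x"
      moreover have "coprime d p"
        using p that by (metis coprime_commute nat_dvd_not_less prime_imp_coprime)
      ultimately show False using funpow_fixed_coprime[OF px _ _ that(1)] x by blast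
    qed
    have inj: "inj_on (\<lambda>i. (f ^^ i) x) {..<p}"
    proof (rule linorder_inj_onI)
      fix i j assume ij: "i < j" "i \<in> {..<p}" "j \<in> {..<p}"
      show "(f ^^ i) x \<noteq> (f ^^ j) x"
      proof
        assume "(f ^^ i) x = (f ^^ j) x"
        then have "(f ^^ (p - i)) ((f ^^ i) x) = (f ^^ (p - i)) ((f ^^ j) x)" by simp
        then have "(f ^^ (p - i + i)) x = (f ^^ (p - i + j)) x" by (simp only: funpow_add o_apply)
        moreover have "p - i + i = p" "p - i + j = (j - i) + p" using ij by auto
        ultimately have "(f ^^ (j - i + p)) x = x" using px by metis
        then have "(f ^^ (j - i)) x = x" using px by (simp add: funpow_add)
        then show False using no[of "j - i"] ij by (auto simp: less_imp_diff_less)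
      qed
    qed auto
    have cO: "card O' = p" unfolding O'_def using inj by (simp add: card_image)
    have OS: "O' \<subseteq> S" unfolding O'_def using iter x by auto
    have p0: "p > 0" using p prime_gt_0_nat by blast
    have fO: "f y \<in> O'" if yO: "y \<in> O'" for y
    proof -
      obtain i where i: "i < p" "y = (f ^^ i) x" using yO unfolding O'_def by auto
      show ?thesis
      proof (cases "Suc i = p")
        case True
        then have "f y = x" using i px by auto
        then show ?thesis unfolding O'_def using p0 by (auto intro!: image_eqI[of _ _ 0])
      next
        case False
        then show ?thesis unfolding O'_def using i by (auto intro!: image_eqI[of _ _ "Suc i"])
      qed
    qed
    have fOi: "(f ^^ i) y \<in> O'" if "y \<in> O'" for y i
      using that fO by (induction i) auto
    have fS: "f y \<in> S - O'" if "y \<in> S - O'" for y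
    proof -
      have "f y \<notin> O'"
      proof
        assume "f y \<in> O'"
        then have "(f ^^ (p - 1)) (f y) \<in> O'" using fOi by blast
        also have "(f ^^ (p - 1)) (f y) = (f ^^ p) y"
          using p0 by (metis Suc_diff_1 funpow_Suc_right o_apply)
        finally show False using psubset.prems(2) that by auto
      qed
      then show ?thesis using psubset.prems(1) that by auto
    qed
    have nofix: "f y \<noteq> y" if yO: "y \<in> O'" for y
    proof
      assume fy: "f y = y"
      obtain i where i: "i < p" "y = (f ^^ i) x" using yO unfolding O'_def by auto
      have "(f ^^ k) y = y" for k using fy by (induction k) auto
      then have "(f ^^ (p - i)) y = y" .
      moreover have "(f ^^ (p - i)) y = (f ^^ (p - i + i)) x" by (simp only: i(2) funpow_add o_apply)
      then have "(f ^^ (p - i)) y = x" using i(1) px by simp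
      ultimately show False using fy x by simp
    qed
    have "card {y \<in> S - O'. f y = y} mod p = card (S - O') mod p"
    proof (rule psubset.IH)
      have "x \<in> O'" unfolding O'_def using p0 by (auto intro!: image_eqI[of _ _ 0])
      then show "S - O' \<subset> S" using x by auto
    qed (use fS psubset.prems in auto)
    moreover have "{y \<in> S - O'. f y = y} = {y \<in> S. f y = y}" using nofix by auto
    moreover have "card S = card (S - O') + p"
      using cO card_mono[OF psubset.hyps OS] card_Diff_subset[OF finite_subset[OF OS psubset.hyps] OS] by simp
    ultimately show ?thesis by simp
  qed
qed

context group begin

lemma cancel_left [simp]:
  "x \<in> carrier G \<Longrightarrow> y \<in> carrier G \<Longrightarrow> x \<otimes> (inv x \<otimes> y) = y"
  "x \<in> carrier G \<Longrightarrow> y \<in> carrier G \<Longrightarrow> inv x \<otimes> (x \<otimes> y) = y"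
  by (simp_all flip: m_assoc)

lemma conj_pow:
  assumes "g \<in> carrier G" "x \<in> carrier G"
  shows "(g \<otimes> x \<otimes> inv g) [^] (n::nat) = g \<otimes> x [^] n \<otimes> inv g"
  using assms by (induction n) (simp_all add: m_assoc)

lemma conj_eq_iff_commute:
  assumes "g \<in> carrier G" "x \<in> carrier G"
  shows "g \<otimes> x \<otimes> inv g = x \<longleftrightarrow> g \<otimes> x = x \<otimes> g"
  using assms by (metis inv_solve_right m_closed inv_closed)

lemma funpow_conj:
  assumes "g \<in> carrier G" "x \<in> carrier G"
  shows "((\<lambda>x. g \<otimes> x \<otimes> inv g) ^^ n) x = g [^] n \<otimes> x \<otimes> inv (g [^] n)"
proof (induction n)
  case (Suc n)
  have "((\<lambda>x. g \<otimes> x \<otimes> inv g) ^^ Suc n) x = g \<otimes> (g [^] n \<otimes> x \<otimes> inv (g [^] n)) \<otimes> inv g"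
    using Suc by simp
  also have "\<dots> = (g \<otimes> g [^] n) \<otimes> x \<otimes> inv (g \<otimes> g [^] n)"
    using assms by (simp add: m_assoc inv_mult_group)
  also have "g \<otimes> g [^] n = g [^] Suc n"
    using assms nat_pow_Suc2[of g n] by simp
  finally show ?case .
qed (use assms in simp)

lemma commute_pow_left:
  assumes "x \<in> carrier G" "y \<in> carrier G" "x \<otimes> y = y \<otimes> x"
  shows "x [^] (n::nat) \<otimes> y = y \<otimes> x [^] n"
  using group_commutes_pow[OF assms(3,1,2)] .

lemma commute_inv:
  assumes "x \<in> carrier G" "y \<in> carrier G" "x \<otimes> y = y \<otimes> x"
  shows "inv x \<otimes> y = y \<otimes> inv x"
  using assms by (metis inv_solve_left inv_solve_right m_closed inv_closed m_assoc)

lemma commute_mult: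
  assumes "x \<in> carrier G" "y \<in> carrier G" "z \<in> carrier G" "x \<otimes> z = z \<otimes> x" "y \<otimes> z = z \<otimes> y"
  shows "(x \<otimes> y) \<otimes> z = z \<otimes> (x \<otimes> y)"
  using assms by (metis m_assoc)

text \<open>By Bezout, \<open>x\<close> is a product of powers of the two given powers. It is
  applied to the trivial subgroup, to centralizers, and to a subgroup that \<open>x\<close> is to
  stay outside of.\<close>

lemma pow_coprime_in_subgroup:
  assumes "subgroup H G" "x \<in> carrier G" "x [^] (m::nat) \<in> H" "x [^] (n::nat) \<in> H" "coprime m n"
  shows "x \<in> H"
proof -
  obtain u v where uv: "u * int m + v * int n = 1"
    using bezout_int[of "int m" "int n"] assms(5) by auto
  have "x = x [^] (u * int m + v * int n)" using uv assms(2) by simp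
  also have "\<dots> = (x [^] m) [^] u \<otimes> (x [^] n) [^] v"
    using assms(2) by (simp add: int_pow_mult int_pow_int[symmetric] int_pow_pow mult.commute)
  also have "\<dots> \<in> H" using assms by (meson subgroup.m_closed subgroup_int_pow_closed)
  finally show ?thesis .
qed

lemma pow_coprime_eq_one:
  assumes "x \<in> carrier G" "x [^] (m::nat) = \<one>" "x [^] (n::nat) = \<one>" "coprime m n"
  shows "x = \<one>"
  using pow_coprime_in_subgroup[OF triv_subgroup assms(1), of m n] assms by simp

lemma commute_pow_coprime:
  assumes "x \<in> carrier G" "z \<in> carrier G" "x [^] (m::nat) = \<one>" "coprime n m"
    "x [^] (n::nat) \<otimes> z = z \<otimes> x [^] n"
  shows "x \<otimes> z = z \<otimes> x"
proof -
  define C where "C = {x \<in> carrier G. x \<otimes> z = z \<otimes> x}"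
  have "subgroup C G"
    by (rule subgroupI) (use assms(2) commute_inv commute_mult in \<open>auto simp: C_def\<close>)
  from pow_coprime_in_subgroup[OF this assms(1), of n m] show ?thesis
    using assms by (auto simp: C_def)
qed

lemma prime_pow_pow_cycle:
  assumes "x \<in> carrier G" "x [^] p = \<one>" "prime (p::nat)" "\<not> p dvd j"
  shows "\<exists>k::nat. (x [^] j) [^] k = x"
proof -
  have "coprime j p" using assms(3,4) by (meson coprime_commute prime_imp_coprime)
  then obtain k where "[j * k = Suc 0] (mod p)"
    by (metis One_nat_def cong_solve_coprime_nat)
  then have "[j * k = 1] (mod p)" by simp
  moreover have "1 < p" using assms(3) prime_gt_1_nat by blast
  ultimately have "(j * k) mod p = 1" by (simp add: cong_def)
  then obtain c where "j * k = c * p + 1" by (metis add.commute div_mult_mod_eq)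
  then have "(x [^] j) [^] k = x [^] (p * c + 1)" using assms(1) by (simp add: nat_pow_pow mult.commute)
  also have "\<dots> = x" using assms by (simp flip: nat_pow_mult nat_pow_pow)
  finally show ?thesis by blast
qed

lemma card_conj_fixed_mod:
  assumes "finite S" "S \<subseteq> carrier G" "b \<in> carrier G" "b [^] p = \<one>" "prime (p::nat)"
    "\<And>x. x \<in> S \<Longrightarrow> b \<otimes> x \<otimes> inv b \<in> S"
  shows "card {x \<in> S. b \<otimes> x = x \<otimes> b} mod p = card S mod p"
proof -
  have "card {x \<in> S. b \<otimes> x \<otimes> inv b = x} mod p = card S mod p"
  proof (rule card_fixed_points_mod_prime)
    fix x assume "x \<in> S"
    then show "((\<lambda>x. b \<otimes> x \<otimes> inv b) ^^ p) x = x"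
      using funpow_conj[of b x p] assms by auto
  qed (use assms in auto)
  also have "{x \<in> S. b \<otimes> x \<otimes> inv b = x} = {x \<in> S. b \<otimes> x = x \<otimes> b}"
    using assms(2,3) conj_eq_iff_commute by auto
  finally show ?thesis .
qed

lemma nat_pow_in_subgroup: "subgroup H G \<Longrightarrow> h \<in> H \<Longrightarrow> h [^] (k::nat) \<in> H"
  using subgroup_int_pow_closed[of H h "int k"] by (simp add: int_pow_int)

lemma ex_mult_of_rcos_eq:
  assumes "subgroup H G" "x \<in> carrier G" "y \<in> carrier G" "H #> x = H #> y"
  shows "\<exists>h \<in> H. x = h \<otimes> y"
proof -
  have "x \<in> H #> y" using assms rcos_self by auto
  then show ?thesis unfolding r_coset_def by auto
qed

lemma ex_commuting_of_coprime:
  assumes "finite S" "S \<subseteq> carrier G" "b \<in> carrier G" "b [^] p = \<one>" "prime (p::nat)"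
    "\<And>x. x \<in> S \<Longrightarrow> b \<otimes> x \<otimes> inv b \<in> S" "\<not> p dvd card S"
  shows "\<exists>x \<in> S. b \<otimes> x = x \<otimes> b"
proof (rule ccontr)
  assume "\<not> ?thesis"
  then have "{x \<in> S. b \<otimes> x = x \<otimes> b} = {}" by blast
  then have "card {x \<in> S. b \<otimes> x = x \<otimes> b} = 0" by (simp only: card.empty)
  then show False using card_conj_fixed_mod[OF assms(1-6)] assms(7) by (simp only: mod_0 dvd_eq_mod_eq_0)
qed

text \<open>Conjugation by \<open>b\<close> permutes the coset, whose size is prime to
  \<open>p\<close>, so it fixes a point there. This is how commuting with \<open>b\<close> is lifted
  from a quotient to the group.\<close>

lemma ex_commuting_in_coset:
  assumes "finite (carrier G)" and H: "H \<lhd> G" "\<not> p dvd card H"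
    and b: "b \<in> carrier G" "b [^] p = \<one>" "prime (p::nat)"
    and g: "g \<in> carrier G" "H #> (b \<otimes> g \<otimes> inv b) = H #> g"
  shows "\<exists>h \<in> H. b \<otimes> (h \<otimes> g) = (h \<otimes> g) \<otimes> b"
proof -
  interpret H: normal H G by fact
  have "\<exists>x \<in> H #> g. b \<otimes> x = x \<otimes> b"
  proof (rule ex_commuting_of_coprime[OF _ _ b])
    show "finite (H #> g)" using assms(1) r_coset_subset_G[OF H.subset g(1)] finite_subset by blast
    show "H #> g \<subseteq> carrier G" using r_coset_subset_G[OF H.subset g(1)] .
    show "\<not> p dvd card (H #> g)"
      using H(2) card_rcosets_equal[OF rcosetsI[OF H.subset g(1)] H.subset] by simp
    fix x assume "x \<in> H #> g"
    then obtain h where h: "h \<in> H" "x = h \<otimes> g" unfolding r_coset_def by blast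
    have "b \<otimes> x \<otimes> inv b = (b \<otimes> h \<otimes> inv b) \<otimes> (b \<otimes> g \<otimes> inv b)"
      using h g b by (simp add: m_assoc)
    also have "\<dots> \<in> H #> (b \<otimes> g \<otimes> inv b)"
      using H.inv_op_closed2[OF b(1) h(1)] unfolding r_coset_def by blast
    finally show "b \<otimes> x \<otimes> inv b \<in> H #> g" using g(2) by simp
  qed
  then show ?thesis unfolding r_coset_def by blast
qed

lemma prime_part_of_ord:
  assumes "finite (carrier G)" "y \<in> carrier G" "prime (p::nat)" "ord y = n * p"
  shows "(y [^] n) [^] p = \<one>" "y [^] n \<noteq> \<one>" "y [^] n \<otimes> y = y \<otimes> y [^] n"
proof -
  show "(y [^] n) [^] p = \<one>" using assms pow_ord_eq_1[of y] by (simp add: nat_pow_pow)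
  show "y [^] n \<otimes> y = y \<otimes> y [^] n" using commute_pow_left assms(2) by simp
  show "y [^] n \<noteq> \<one>"
  proof
    assume "y [^] n = \<one>"
    then have "n * p dvd n" using assms(2,4) pow_eq_id[of y n] by simp
    moreover have "n > 0" using assms(4) ord_ge_1[OF assms(1,2)] by (cases n) auto
    ultimately show False using prime_gt_1_nat[OF assms(3)] by auto
  qed
qed

lemma ex_pow_prime_ord:
  assumes "x \<in> carrier G" "x \<noteq> \<one>" "finite (carrier G)"
  shows "\<exists>p n. prime (p::nat) \<and> (x [^] (n::nat)) [^] p = \<one> \<and> x [^] n \<noteq> \<one> \<and> ord x = n * p"
proof -
  have "ord x \<noteq> 1" using assms ord_eq_1 by auto
  then obtain p where p: "prime p" "p dvd ord x" using prime_factor_nat by blast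
  then obtain n where "ord x = n * p" by (metis dvd_div_mult_self)
  then show ?thesis using p(1) prime_part_of_ord[OF assms(3,1) p(1)] by blast
qed

lemma derived_proper:
  assumes "solvable G" "subgroup W G" "W \<noteq> {\<one>}"
  shows "derived G W \<noteq> W"
proof
  assume "derived G W = W"
  then have "(derived G ^^ n) W = W" for n by (induction n) auto
  then show False
    using solvable_imp_trivial_derived_seq[OF solvable_subgroup[OF assms(2,1)]] assms(3) by simp
qed

lemma commutator_in_derived:
  assumes "x \<in> W" "z \<in> W" "subgroup W G" "derived G W \<subseteq> Z"
  shows "\<exists>c \<in> Z. z \<otimes> x = x \<otimes> z \<otimes> c"
proof -
  have xz: "x \<in> carrier G" "z \<in> carrier G" using assms subgroup.mem_carrier by fast+
  have "inv z \<otimes> inv x \<otimes> inv (inv z) \<otimes> inv (inv x) \<in> derived_set G W"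
    using assms(1-3) by (blast intro: subgroup.m_inv_closed)
  then have "inv z \<otimes> inv x \<otimes> z \<otimes> x \<in> derived G W"
    using xz unfolding derived_def by (simp add: generate.incl)
  then have "inv z \<otimes> inv x \<otimes> z \<otimes> x \<in> Z" using assms(4) by blast
  moreover have "z \<otimes> x = x \<otimes> z \<otimes> (inv z \<otimes> inv x \<otimes> z \<otimes> x)" using xz by (simp add: m_assoc)
  ultimately show ?thesis by blast
qed

text \<open>\<open>N\<close> is the last term of the derived series of \<open>K\<close> outside
  \<open>Z\<close>. For trivial \<open>Z\<close> it is abelian; if \<open>Z\<close> is the center of
  \<open>K\<close> it has class at most two.\<close>

lemma ex_derived_term:
  assumes "solvable G" "K \<lhd> G" "\<one> \<in> Z" "\<not> K \<subseteq> Z"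
  shows "\<exists>N. N \<lhd> G \<and> N \<subseteq> K \<and> \<not> N \<subseteq> Z \<and> derived G N \<subseteq> Z"
proof -
  note subK = normal_imp_subgroup[OF assms(2)]
  let ?P = "\<lambda>m. (derived G ^^ m) K \<subseteq> Z"
  obtain n where "(derived G ^^ n) K = {\<one>}"
    using solvable_imp_trivial_derived_seq[OF solvable_subgroup[OF subK assms(1)]] by blast
  then have ex: "?P n" using assms(3) by simp
  define m where "m = (LEAST m. ?P m)"
  have m: "?P m" unfolding m_def using ex by (rule LeastI)
  have "m \<noteq> 0" using m assms(4) by (metis funpow_0)
  then obtain k where k: "m = Suc k" by (cases m) auto
  have nk: "\<not> ?P k" using not_less_Least[of k ?P] k unfolding m_def by auto
  have normk: "(derived G ^^ k) K \<lhd> G" for k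
    using assms(2) derived_is_normal by (induction k) auto
  have subk: "(derived G ^^ k) K \<subseteq> K" for k
  proof (induction k)
    case (Suc k)
    then show ?case using derived_incl[OF _ subK] by simp
  qed simp
  show ?thesis by (rule exI[of _ "(derived G ^^ k) K"]) (use normk subk nk m k in auto)
qed

lemma cauchy_prime:
  assumes "finite (carrier G)" "prime (p::nat)" "p dvd card (carrier G)"
  shows "\<exists>x \<in> carrier G. x \<noteq> \<one> \<and> x [^] p = \<one>"
proof -
  obtain m where m: "order G = p ^ 1 * m" using assms(3) by (auto simp: order_def)
  obtain H where H: "subgroup H G" "card H = p ^ 1"
    using sylow_thm[OF assms(2) is_group m assms(1)] by blast
  interpret H: group "G\<lparr>carrier := H\<rparr>" using subgroup_imp_group[OF H(1)] .
  have "1 < card H" using H(2) assms(2) prime_gt_1_nat by auto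
  then obtain x where x: "x \<in> H" "x \<noteq> \<one>"
    by (metis card_le_Suc0_iff_eq card_eq_0_iff One_nat_def linorder_not_less subgroup.one_closed[OF H(1)]
        not_less_zero)
  have "x [^]\<^bsub>G\<lparr>carrier := H\<rparr>\<^esub> p = \<one>"
    using H.pow_order_eq_1[of x] x H(2) by (simp add: order_def)
  then have "x [^] p = \<one>" by (simp flip: nat_pow_consistent)
  then show ?thesis using x subgroup.mem_carrier[OF H(1)] by blast
qed

lemma prime_not_dvd_card_exponent:
  assumes "finite (carrier G)" "prime (p::nat)" "\<And>x. x \<in> carrier G \<Longrightarrow> x [^] (m::nat) = \<one>" "\<not> p dvd m"
  shows "\<not> p dvd card (carrier G)"
proof
  assume "p dvd card (carrier G)"
  then obtain x where x: "x \<in> carrier G" "x \<noteq> \<one>" "x [^] p = \<one>"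
    using cauchy_prime[OF assms(1,2)] by blast
  then show False using pow_coprime_eq_one[of x p m] assms prime_imp_coprime by blast
qed

lemma exponent_dvd_card:
  assumes "finite (carrier G)" "prime (p::nat)" "\<And>x. x \<in> carrier G \<Longrightarrow> x [^] p = \<one>" "carrier G \<noteq> {\<one>}"
  shows "p dvd card (carrier G)"
proof -
  obtain x where x: "x \<in> carrier G" "x \<noteq> \<one>" using assms(4) by auto
  have "ord x dvd p" using pow_eq_id[OF x(1)] assms(3)[OF x(1)] by blast
  then have "ord x = p" using assms(2) x ord_eq_1 by (metis One_nat_def prime_nat_iff)
  then show ?thesis using ord_dvd_group_order[OF x(1)] by (simp add: order_def)
qed

lemma class2_pow_left:
  assumes xy: "x \<in> carrier G" "y \<in> carrier G" and c: "c \<in> carrier G" "y \<otimes> x = x \<otimes> y \<otimes> c"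
    "c \<otimes> x = x \<otimes> c" "c \<otimes> y = y \<otimes> c"
  shows "y [^] k \<otimes> x = x \<otimes> y [^] k \<otimes> c [^] (k::nat)"
proof (induction k)
  case (Suc k)
  have "y [^] Suc k \<otimes> x = y [^] k \<otimes> x \<otimes> y \<otimes> c" using xy c by (simp add: m_assoc)
  also have "\<dots> = x \<otimes> y [^] k \<otimes> (c [^] k \<otimes> y) \<otimes> c" using Suc xy c by (simp add: m_assoc)
  also have "\<dots> = x \<otimes> y [^] Suc k \<otimes> c [^] Suc k"
    unfolding commute_pow_left[OF c(1) xy(2) c(4)] using xy c by (simp add: m_assoc)
  finally show ?case .
qed (use xy in simp)

text \<open>When the commutator \<open>c\<close> has odd prime order \<open>t\<close>, the last
  factor disappears for exponent \<open>t\<close>, and the power map respects this product.\<close>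

lemma mult_pow_class2:
  assumes xy: "x \<in> carrier G" "y \<in> carrier G" and c: "c \<in> carrier G" "y \<otimes> x = x \<otimes> y \<otimes> c"
    "c \<otimes> x = x \<otimes> c" "c \<otimes> y = y \<otimes> c"
  shows "(x \<otimes> y) [^] (n::nat) = x [^] n \<otimes> y [^] n \<otimes> c [^] (n * (n - 1) div 2)"
proof -
  have cx: "c [^] (k::nat) \<otimes> x = x \<otimes> c [^] k" "c [^] k \<otimes> y = y \<otimes> c [^] k" for k
    using commute_pow_left[OF c(1) xy(1) c(3)] commute_pow_left[OF c(1) xy(2) c(4)] by auto
  note yx = class2_pow_left[OF assms]
  show ?thesis
  proof (induction n)
    case (Suc n)
    have "(x \<otimes> y) [^] Suc n = x [^] n \<otimes> y [^] n \<otimes> (c [^] (n * (n - 1) div 2) \<otimes> x) \<otimes> y"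
      using Suc xy c by (simp add: m_assoc)
    also have "\<dots> = x [^] n \<otimes> (y [^] n \<otimes> x) \<otimes> (c [^] (n * (n - 1) div 2) \<otimes> y)"
      unfolding cx(1) using xy c by (simp add: m_assoc)
    also have "\<dots> = x [^] n \<otimes> (x \<otimes> y [^] n \<otimes> c [^] n) \<otimes> (y \<otimes> c [^] (n * (n - 1) div 2))"
      unfolding cx(2) yx ..
    also have "\<dots> = x [^] Suc n \<otimes> y [^] n \<otimes> (c [^] n \<otimes> y) \<otimes> c [^] (n * (n - 1) div 2)"
      using xy c by (simp add: m_assoc)
    also have "\<dots> = x [^] Suc n \<otimes> y [^] Suc n \<otimes> (c [^] n \<otimes> c [^] (n * (n - 1) div 2))"
      unfolding cx(2) using xy c by (simp add: m_assoc)
    also have "c [^] n \<otimes> c [^] (n * (n - 1) div 2) = c [^] (Suc n * (Suc n - 1) div 2)"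
    proof -
      have "n + n * (n - 1) div 2 = Suc n * (Suc n - 1) div 2"
        by (cases n) auto
      then show ?thesis using c by (simp add: nat_pow_mult)
    qed
    finally show ?case .
  qed (use xy c in simp)
qed

end

section \<open>Finite products in abelian groups\<close>

lemma (in comm_monoid) finprod_swap:
  assumes "finite A" "finite B" "\<And>i j. i \<in> A \<Longrightarrow> j \<in> B \<Longrightarrow> f i j \<in> carrier G"
  shows "finprod G (\<lambda>i. finprod G (f i) B) A = finprod G (\<lambda>j. finprod G (\<lambda>i. f i j) A) B"
  using assms(1,3)
proof (induction A rule: finite_induct)
  case empty
  then show ?case by simp
next
  case (insert a A)
  have "finprod G (\<lambda>i. finprod G (f i) B) (insert a A)
      = finprod G (f a) B \<otimes> finprod G (\<lambda>i. finprod G (f i) B) A"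
    using insert by (intro finprod_insert) (auto intro!: finprod_closed)
  also have "\<dots> = finprod G (f a) B \<otimes> finprod G (\<lambda>j. finprod G (\<lambda>i. f i j) A) B"
    using insert by simp
  also have "\<dots> = finprod G (\<lambda>j. f a j \<otimes> finprod G (\<lambda>i. f i j) A) B"
    using insert by (intro finprod_multf[symmetric]) (auto intro!: finprod_closed)
  also have "\<dots> = finprod G (\<lambda>j. finprod G (\<lambda>i. f i j) (insert a A)) B"
    using insert by (intro finprod_cong') (auto intro!: finprod_closed)
  finally show ?case .
qed

lemma (in comm_monoid) finprod_lessThan_shift:
  assumes "\<And>j. f j \<in> carrier G" "f n = f 0"
  shows "finprod G (\<lambda>j. f (Suc j)) {..<n} = finprod G f {..<(n::nat)}"
proof (cases n)
  case (Suc m)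
  have "finprod G (\<lambda>j. f (Suc j)) {..<n} = f (Suc m) \<otimes> finprod G (\<lambda>j. f (Suc j)) {..<m}"
    using Suc assms by (simp add: lessThan_Suc Pi_def)
  also have "finprod G (\<lambda>j. f (Suc j)) {..<m} = finprod G f (Suc ` {..<m})"
    using assms by (subst finprod_reindex) (auto simp: Pi_def)
  also have "f (Suc m) \<otimes> finprod G f (Suc ` {..<m}) = finprod G f (insert 0 (Suc ` {..<m}))"
    using assms Suc by (subst finprod_insert) auto
  also have "insert 0 (Suc ` {..<m}) = {..<n}" using Suc lessThan_Suc_eq_insert_0 by simp
  finally show ?thesis .
qed simp

lemma (in comm_group) finprod_pow:
  assumes "finite A" "f \<in> A \<rightarrow> carrier G"
  shows "finprod G f A [^] (n::nat) = finprod G (\<lambda>x. f x [^] n) A"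
  using assms
proof (induction A rule: finite_induct)
  case (insert a A)
  then show ?case by (simp add: Pi_def nat_pow_distrib)
qed simp

lemma finprod_hom:
  assumes "comm_monoid G" "comm_monoid H" "h \<in> hom G H" "h \<one>\<^bsub>G\<^esub> = \<one>\<^bsub>H\<^esub>" "finite A" "f \<in> A \<rightarrow> carrier G"
  shows "h (finprod G f A) = finprod H (\<lambda>x. h (f x)) A"
proof -
  interpret G: comm_monoid G by fact
  interpret H: comm_monoid H by fact
  show ?thesis using assms(5,6)
  proof (induction A rule: finite_induct)
    case (insert a A)
    then have "(\<lambda>x. h (f x)) \<in> A \<rightarrow> carrier H" using hom_in_carrier[OF assms(3)] by auto
    then show ?case using insert hom_in_carrier[OF assms(3)]
      by (auto simp: Pi_def hom_mult[OF assms(3)])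
  qed (use assms in simp)
qed

section \<open>Actions on abelian groups\<close>

text \<open>Both groups are abstract because \<open>V\<close> will be a chief factor, with cosets as
  elements, and \<open>G\<close> will also be replaced by its quotient by the kernel of the
  action.\<close>

locale linear_action = group G + V: comm_group V
  for G :: "('a, 'b) monoid_scheme" (structure) and V :: "('v, 'w) monoid_scheme" +
  fixes act :: "'a \<Rightarrow> 'v \<Rightarrow> 'v"
  assumes act_closed [simp]: "g \<in> carrier G \<Longrightarrow> v \<in> carrier V \<Longrightarrow> act g v \<in> carrier V"
    and act_add: "g \<in> carrier G \<Longrightarrow> v \<in> carrier V \<Longrightarrow> w \<in> carrier V \<Longrightarrow>
      act g (v \<otimes>\<^bsub>V\<^esub> w) = act g v \<otimes>\<^bsub>V\<^esub> act g w"
    and act_mult: "g \<in> carrier G \<Longrightarrow> h \<in> carrier G \<Longrightarrow> v \<in> carrier V \<Longrightarrow>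
      act (g \<otimes> h) v = act g (act h v)"
    and act_one [simp]: "v \<in> carrier V \<Longrightarrow> act \<one> v = v"
    and finite_G: "finite (carrier G)"
    and finite_V: "finite (carrier V)"
begin

definition fpf :: "'a \<Rightarrow> bool" where
  "fpf g \<longleftrightarrow> (\<forall>v \<in> carrier V. act g v = v \<longrightarrow> v = \<one>\<^bsub>V\<^esub>)"

lemma act_hom: "g \<in> carrier G \<Longrightarrow> act g \<in> hom V V"
  by (rule homI) (simp_all add: act_add)

lemma act_zero [simp]: "g \<in> carrier G \<Longrightarrow> act g \<one>\<^bsub>V\<^esub> = \<one>\<^bsub>V\<^esub>"
  using act_hom hom_one V.is_group by blast

lemma act_finprod:
  assumes "g \<in> carrier G" "finite A" "f \<in> A \<rightarrow> carrier V"
  shows "act g (finprod V f A) = finprod V (\<lambda>x. act g (f x)) A"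
  using finprod_hom[OF V.comm_monoid_axioms V.comm_monoid_axioms act_hom[OF assms(1)]] assms by simp

lemma act_pow_fixed:
  assumes "g \<in> carrier G" "v \<in> carrier V" "act g v = v"
  shows "act (g [^] (n::nat)) v = v"
  using assms by (induction n) (simp_all add: act_mult)

lemma act_funpow:
  assumes "g \<in> carrier G" "v \<in> carrier V"
  shows "(act g ^^ n) v = act (g [^] n) v"
  using assms(2)
proof (induction n)
  case (Suc n)
  then show ?case using assms(1) nat_pow_Suc2[of g n] by (simp add: act_mult[symmetric] del: nat_pow_Suc)
qed simp

lemma fpf_of_pow: "g \<in> carrier G \<Longrightarrow> fpf (g [^] (n::nat)) \<Longrightarrow> fpf g"
  unfolding fpf_def using act_pow_fixed by blast

lemma fpf_pow:
  assumes "g \<in> carrier G" "g [^] p = \<one>" "prime (p::nat)" "\<not> p dvd j" "fpf g"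
  shows "fpf (g [^] j)"
proof -
  obtain k where "(g [^] j) [^] (k::nat) = g"
    using prime_pow_pow_cycle[OF assms(1-4)] by blast
  then show ?thesis using fpf_of_pow[of "g [^] j" k] assms(1,5) by simp
qed

lemma fpf_conj:
  assumes "g \<in> carrier G" "x \<in> carrier G" "fpf x"
  shows "fpf (g \<otimes> x \<otimes> inv g)"
  unfolding fpf_def
proof (intro ballI impI)
  fix v assume v: "v \<in> carrier V" "act (g \<otimes> x \<otimes> inv g) v = v"
  have "act x (act (inv g) v) = act (inv g \<otimes> (g \<otimes> x \<otimes> inv g)) v"
    using assms v(1) by (simp add: act_mult[symmetric] m_assoc)
  also have "\<dots> = act (inv g) v" using assms(1,2) v by (simp add: act_mult)
  finally have "act (inv g) v = \<one>\<^bsub>V\<^esub>" using assms v unfolding fpf_def by simp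
  then have "act g (act (inv g) v) = \<one>\<^bsub>V\<^esub>" using assms(1) by simp
  then show "v = \<one>\<^bsub>V\<^esub>" using assms(1) v by (simp add: act_mult[symmetric])
qed

text \<open>\<open>x\<close> permutes the factors cyclically, so it fixes their product.\<close>

lemma norm_eq_one:
  assumes "x \<in> carrier G" "x [^] n = \<one>" "fpf x" "v \<in> carrier V"
  shows "finprod V (\<lambda>j. act (x [^] j) v) {..<(n::nat)} = \<one>\<^bsub>V\<^esub>"
proof -
  let ?N = "finprod V (\<lambda>j. act (x [^] j) v) {..<n}"
  have "act x ?N = finprod V (\<lambda>j. act x (act (x [^] j) v)) {..<n}"
    using assms by (intro act_finprod) auto
  also have "\<dots> = finprod V (\<lambda>j. act (x [^] Suc j) v) {..<n}"
    using assms nat_pow_Suc2[of x]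
    by (intro V.finprod_cong') (auto simp: act_mult[symmetric] simp del: nat_pow_Suc)
  also have "\<dots> = ?N"
    using assms by (intro V.finprod_lessThan_shift) auto
  finally show ?thesis using assms(1,3,4) unfolding fpf_def by (simp add: V.finprod_closed)
qed

text \<open>For \<open>j \<noteq> 0\<close> the elements \<open>m\<inverse> b\<^sup>j m b\<^sup>-\<^sup>j\<close> run through \<open>M\<close>, so the product of the norms of \<open>v\<close>
  over all conjugates of \<open>b\<close> under \<open>M\<close> can be evaluated in two ways.\<close>

lemma pow_card_eq_trace:
  assumes b: "b \<in> carrier G" "b [^] p = \<one>" "prime (p::nat)" "fpf b"
    and M: "subgroup M G" "\<And>m. m \<in> M \<Longrightarrow> b \<otimes> m \<otimes> inv b \<in> M"
      "\<And>m. m \<in> M \<Longrightarrow> b \<otimes> m = m \<otimes> b \<Longrightarrow> m = \<one>"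
    and v: "v \<in> carrier V"
  shows "v [^]\<^bsub>V\<^esub> card M = finprod V (\<lambda>m. act m v) M"
proof -
  define Tr where "Tr w = finprod V (\<lambda>m. act m w) M" for w
  interpret M: subgroup M G by fact
  have finM: "finite M" using finite_G M.subset finite_subset by blast
  have Mc [simp]: "m \<in> M \<Longrightarrow> m \<in> carrier G" for m by simp
  have Trc [simp]: "w \<in> carrier V \<Longrightarrow> Tr w \<in> carrier V" for w
    unfolding Tr_def by (intro V.finprod_closed) auto
  have p0: "p > 0" using b(3) prime_gt_0_nat by blast
  \<comment> \<open>Chosen so that \<open>c j m\<close> times \<open>b [^] j\<close> is the
    \<open>j\<close>-th power of the conjugate of \<open>b\<close> by \<open>inv m\<close>.\<close>
  define c where "c j m = inv m \<otimes> (b [^] j \<otimes> m \<otimes> inv (b [^] j))" for j :: nat and m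
  have bM: "b [^] j \<otimes> m \<otimes> inv (b [^] j) \<in> M" if "m \<in> M" for j :: nat and m
  proof (induction j)
    case (Suc j)
    have "b [^] Suc j \<otimes> m \<otimes> inv (b [^] Suc j) = b \<otimes> (b [^] j \<otimes> m \<otimes> inv (b [^] j)) \<otimes> inv b"
      using b that nat_pow_Suc2[of b j] by (simp add: m_assoc inv_mult_group del: nat_pow_Suc)
    then show ?case using M(2)[OF Suc] by simp
  qed (use that in simp)
  have cM: "c j m \<in> M" if "m \<in> M" for j m
    unfolding c_def using bM[OF that] that by simp
  \<comment> \<open>If \<open>c j m = c j n\<close>, then \<open>n \<otimes> inv m\<close> commutes
    with \<open>b [^] j\<close>, hence with \<open>b\<close>, and is trivial. So \<open>c j\<close>
    permutes \<open>M\<close>.\<close>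
  have c_inj: "inj_on (c j) M" if j: "0 < j" "j < p" for j
  proof (rule inj_onI)
    fix m n assume mn: "m \<in> M" "n \<in> M" "c j m = c j n"
    let ?x = "n \<otimes> inv m"
    have "n \<otimes> c j m = n \<otimes> c j n" using mn by simp
    then have "?x \<otimes> (b [^] j \<otimes> m \<otimes> inv (b [^] j)) = b [^] j \<otimes> n \<otimes> inv (b [^] j)"
      unfolding c_def using mn b by (simp add: m_assoc)
    then have "?x \<otimes> (b [^] j \<otimes> m \<otimes> inv (b [^] j)) \<otimes> (b [^] j \<otimes> inv m) = b [^] j \<otimes> n \<otimes> inv (b [^] j) \<otimes> (b [^] j \<otimes> inv m)"
      by simp
    then have "?x \<otimes> b [^] j = b [^] j \<otimes> ?x"
      using mn b(1) by (simp add: m_assoc)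
    then have "b [^] j \<otimes> ?x = ?x \<otimes> b [^] j" by simp
    moreover have "coprime j p"
      using b(3) j by (metis coprime_commute nat_dvd_not_less prime_imp_coprime)
    ultimately have "b \<otimes> ?x = ?x \<otimes> b"
      using commute_pow_coprime[of b ?x p j] b mn by simp
    then have "?x = \<one>" using M(3) mn by simp
    then show "m = n" using mn by (metis Mc inv_closed inv_equality inv_inv)
  qed
  have inner: "finprod V (\<lambda>j. act (c j m) (act (b [^] j) v)) {..<p} = \<one>\<^bsub>V\<^esub>" if "m \<in> M" for m
  proof -
    let ?x = "inv m \<otimes> b \<otimes> inv (inv m)"
    have "?x [^] j = c j m \<otimes> b [^] j" for j :: nat
      using that b conj_pow[of "inv m" b j] unfolding c_def by (simp add: m_assoc)
    then have "act (?x [^] j) v = act (c j m) (act (b [^] j) v)" for j :: nat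
      using that cM v b by (simp add: act_mult)
    moreover have "finprod V (\<lambda>j. act (?x [^] j) v) {..<p} = \<one>\<^bsub>V\<^esub>"
    proof (rule norm_eq_one)
      show "?x [^] p = \<one>" using that b conj_pow[of "inv m" b p] by simp
      show "fpf ?x" using that b by (intro fpf_conj) auto
    qed (use that b v in auto)
    ultimately show ?thesis by simp
  qed
  have col: "finprod V (\<lambda>m. act (c j m) (act (b [^] j) v)) M = Tr (act (b [^] j) v)" if "0 < j" "j < p" for j
  proof -
    have im: "c j ` M = M"
      using c_inj[OF that] cM finM by (simp add: endo_inj_surj image_subsetI)
    have "Tr (act (b [^] j) v) = finprod V (\<lambda>m. act m (act (b [^] j) v)) (c j ` M)"
      unfolding Tr_def im ..
    also have "\<dots> = finprod V (\<lambda>m. act (c j m) (act (b [^] j) v)) M"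
      using c_inj[OF that] cM v b by (intro V.finprod_reindex) auto
    finally show ?thesis ..
  qed
  have col0: "finprod V (\<lambda>m. act (c 0 m) v) M = v [^]\<^bsub>V\<^esub> card M"
  proof -
    have "finprod V (\<lambda>m. act (c 0 m) v) M = finprod V (\<lambda>m. v) M"
      by (rule V.finprod_cong') (use v in \<open>auto simp: c_def\<close>)
    then show ?thesis using V.finprod_const[OF v] by simp
  qed
  \<comment> \<open>Column 0 is split off an array indexed by \<open>m\<close> and \<open>j\<close>.
    Its rows are norms of conjugates of \<open>b\<close>, hence trivial. Column 0 gives the power of
    \<open>v\<close>, and every other column gives the trace of
    \<open>act (b [^] j) v\<close>.\<close>
  have range: "{..<p} = insert 0 {1..<p}" using p0 by auto
  have "\<one>\<^bsub>V\<^esub> = finprod V (\<lambda>m. finprod V (\<lambda>j. act (c j m) (act (b [^] j) v)) {..<p}) M"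
    using inner by (intro V.finprod_one_eqI[symmetric]) auto
  also have "\<dots> = finprod V (\<lambda>j. finprod V (\<lambda>m. act (c j m) (act (b [^] j) v)) M) {..<p}"
    using finM cM v b by (intro V.finprod_swap) auto
  also have "\<dots> = v [^]\<^bsub>V\<^esub> card M \<otimes>\<^bsub>V\<^esub> finprod V (\<lambda>j. finprod V (\<lambda>m. act (c j m) (act (b [^] j) v)) M) {1..<p}"
    unfolding range using v b cM
    by (subst V.finprod_insert) (auto simp: col0 intro!: V.finprod_closed)
  also have "finprod V (\<lambda>j. finprod V (\<lambda>m. act (c j m) (act (b [^] j) v)) M) {1..<p}
      = finprod V (\<lambda>j. Tr (act (b [^] j) v)) {1..<p}"
    using col v b by (intro V.finprod_cong') auto
  finally have 1: "v [^]\<^bsub>V\<^esub> card M \<otimes>\<^bsub>V\<^esub> finprod V (\<lambda>j. Tr (act (b [^] j) v)) {1..<p} = \<one>\<^bsub>V\<^esub>" ..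
  \<comment> \<open>With \<open>Tr v\<close> in place of column 0 the product is the trace of the
    norm of \<open>v\<close>, again trivial. Comparing the two products identifies
    \<open>Tr v\<close> with the power.\<close>
  have "Tr v \<otimes>\<^bsub>V\<^esub> finprod V (\<lambda>j. Tr (act (b [^] j) v)) {1..<p} = finprod V (\<lambda>j. Tr (act (b [^] j) v)) {..<p}"
    unfolding range using v b by (subst V.finprod_insert) auto
  also have "\<dots> = finprod V (\<lambda>m. finprod V (\<lambda>j. act m (act (b [^] j) v)) {..<p}) M"
    unfolding Tr_def using finM v b by (intro V.finprod_swap) auto
  also have "\<dots> = finprod V (\<lambda>m. act m (finprod V (\<lambda>j. act (b [^] j) v) {..<p})) M"
    using v b by (intro V.finprod_cong') (auto simp: act_finprod intro!: V.finprod_closed)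
  also have "\<dots> = \<one>\<^bsub>V\<^esub>"
    using norm_eq_one[OF b(1,2,4) v] by (intro V.finprod_one_eqI) simp
  finally have 2: "Tr v \<otimes>\<^bsub>V\<^esub> finprod V (\<lambda>j. Tr (act (b [^] j) v)) {1..<p} = \<one>\<^bsub>V\<^esub>" .
  have "finprod V (\<lambda>j. Tr (act (b [^] j) v)) {1..<p} \<in> carrier V"
    using v b by (intro V.finprod_closed) auto
  then have "v [^]\<^bsub>V\<^esub> card M = Tr v"
    using 1 2 v by (metis V.right_cancel V.nat_pow_closed Trc)
  then show ?thesis unfolding Tr_def .
qed

text \<open>The trace is fixed by \<open>M\<close>, and it equals the power of \<open>v\<close> with
  exponent \<open>card M\<close>. So the quotient of \<open>act n v\<close> by \<open>v\<close> is
  killed by both \<open>card M\<close> and \<open>r\<close>, which are coprime.\<close>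

lemma trivial_of_frobenius:
  assumes b: "b \<in> carrier G" "b [^] p = \<one>" "prime (p::nat)" "fpf b"
    and M: "subgroup M G" "\<And>m. m \<in> M \<Longrightarrow> b \<otimes> m \<otimes> inv b \<in> M"
      "\<And>m. m \<in> M \<Longrightarrow> b \<otimes> m = m \<otimes> b \<Longrightarrow> m = \<one>"
    and r: "prime (r::nat)" "\<And>v. v \<in> carrier V \<Longrightarrow> v [^]\<^bsub>V\<^esub> r = \<one>\<^bsub>V\<^esub>" "\<not> r dvd card M"
    and "n \<in> M" "v \<in> carrier V"
  shows "act n v = v"
proof -
  let ?Tr = "finprod V (\<lambda>m. act m v) M"
  interpret M: subgroup M G by fact
  have Mc [simp]: "m \<in> M \<Longrightarrow> m \<in> carrier G" for m by simp
  have n: "n \<in> carrier G" using assms by simp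
  have finM: "finite M" using finite_G M.subset finite_subset by blast
  have im: "(\<lambda>m. n \<otimes> m) ` M = M"
  proof (rule endo_inj_surj)
    show "inj_on (\<lambda>m. n \<otimes> m) M" using inj_on_cmult[OF n] M.subset inj_on_subset by blast
  qed (use finM \<open>n \<in> M\<close> in auto)
  have "act n ?Tr = finprod V (\<lambda>m. act n (act m v)) M"
    using finM assms(12) n by (intro act_finprod) auto
  also have "\<dots> = finprod V (\<lambda>m. act (n \<otimes> m) v) M"
    using assms(12) n by (intro V.finprod_cong') (auto simp: act_mult)
  also have "\<dots> = finprod V (\<lambda>m. act m v) ((\<lambda>m. n \<otimes> m) ` M)"
    using inj_on_cmult[OF n] M.subset inj_on_subset assms(12) n
    by (intro V.finprod_reindex[symmetric]) (auto intro!: act_closed)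
  finally have "act n ?Tr = ?Tr" unfolding im .
  moreover have "v [^]\<^bsub>V\<^esub> card M = ?Tr" by (rule pow_card_eq_trace[OF b M assms(12)])
  ultimately have "act n (v [^]\<^bsub>V\<^esub> card M) = v [^]\<^bsub>V\<^esub> card M" by (simp only:)
  then have "act n v [^]\<^bsub>V\<^esub> card M = v [^]\<^bsub>V\<^esub> card M"
    using group_hom.hom_nat_pow[of V V "act n"] act_hom[OF n] assms(12)
    by (simp add: group_hom_def group_hom_axioms_def)
  then have "(act n v \<otimes>\<^bsub>V\<^esub> inv\<^bsub>V\<^esub> v) [^]\<^bsub>V\<^esub> card M = \<one>\<^bsub>V\<^esub>"
    using assms(12) n by (simp add: V.nat_pow_distrib V.nat_pow_inv)
  moreover have "(act n v \<otimes>\<^bsub>V\<^esub> inv\<^bsub>V\<^esub> v) [^]\<^bsub>V\<^esub> r = \<one>\<^bsub>V\<^esub>" using r assms(12) n by simp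
  moreover have "act n v \<otimes>\<^bsub>V\<^esub> inv\<^bsub>V\<^esub> v \<in> carrier V" using assms(12) n by simp
  ultimately have "act n v \<otimes>\<^bsub>V\<^esub> inv\<^bsub>V\<^esub> v = \<one>\<^bsub>V\<^esub>"
    using V.pow_coprime_eq_one prime_imp_coprime[OF r(1,3)] by blast
  then have "inv\<^bsub>V\<^esub> (inv\<^bsub>V\<^esub> v) = act n v" using assms(12) n by (intro V.inv_equality) auto
  then show ?thesis using assms(12) by simp
qed

text \<open>Arrange the images of \<open>v\<close> under \<open>z [^] j\<close> times
  \<open>u [^] (i * j)\<close> in a square. Row \<open>i\<close> is a norm for
  \<open>z \<otimes> u [^] i\<close>; a column with \<open>j\<close> nonzero is the image of a norm
  for \<open>u [^] j\<close>. All of these are trivial, so column 0, which is the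
  \<open>q\<close>-th power of \<open>v\<close>, is trivial too.\<close>

lemma pow_eq_one_of_fpf_square:
  assumes u: "u \<in> carrier G" "u [^] q = \<one>" "fpf u" and z: "z \<in> carrier G" "z [^] q = \<one>"
    and "prime (q::nat)" and comm: "z \<otimes> u = u \<otimes> z"
    and fp: "\<And>i::nat. fpf (z \<otimes> u [^] i)" and v: "v \<in> carrier V"
  shows "v [^]\<^bsub>V\<^esub> q = \<one>\<^bsub>V\<^esub>"
proof -
  have q0: "q > 0" using \<open>prime q\<close> prime_gt_0_nat by blast
  have zu: "z \<otimes> u [^] i = u [^] i \<otimes> z" for i :: nat
    using commute_pow_left[OF u(1) z(1)] comm by simp
  have pw: "(z \<otimes> u [^] i) [^] j = z [^] j \<otimes> (u [^] j) [^] i" for i j :: nat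
    using pow_mult_distrib[OF zu z(1)] u by (simp add: nat_pow_pow mult.commute)
  have row: "finprod V (\<lambda>j. act (z [^] j) (act ((u [^] j) [^] i) v)) {..<q} = \<one>\<^bsub>V\<^esub>" for i :: nat
  proof -
    have "(z \<otimes> u [^] i) [^] q = \<one>" unfolding pw using u z by simp
    then have "finprod V (\<lambda>j. act ((z \<otimes> u [^] i) [^] j) v) {..<q} = \<one>\<^bsub>V\<^esub>"
      using fp v u z by (intro norm_eq_one) auto
    then show ?thesis unfolding pw using u z v by (simp add: act_mult)
  qed
  have col: "finprod V (\<lambda>i. act (z [^] j) (act ((u [^] j) [^] i) v)) {..<q} = \<one>\<^bsub>V\<^esub>" if "0 < j" "j < q" for j
  proof -
    have "\<not> q dvd j" using that nat_dvd_not_less by blast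
    then have "fpf (u [^] j)" using fpf_pow[OF u(1,2) \<open>prime q\<close> _ u(3)] by blast
    moreover have "(u [^] j) [^] q = \<one>"
      using u by (metis mult.commute nat_pow_one nat_pow_pow)
    ultimately have "finprod V (\<lambda>i. act ((u [^] j) [^] i) v) {..<q} = \<one>\<^bsub>V\<^esub>"
      using u v by (intro norm_eq_one) auto
    moreover have "finprod V (\<lambda>i. act (z [^] j) (act ((u [^] j) [^] i) v)) {..<q}
      = act (z [^] j) (finprod V (\<lambda>i. act ((u [^] j) [^] i) v) {..<q})"
      using u v z by (intro act_finprod[symmetric]) auto
    ultimately show ?thesis using z by simp
  qed
  have "\<one>\<^bsub>V\<^esub> = finprod V (\<lambda>i. finprod V (\<lambda>j. act (z [^] j) (act ((u [^] j) [^] i) v)) {..<q}) {..<q}"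
    using row by (intro V.finprod_one_eqI[symmetric]) auto
  also have "\<dots> = finprod V (\<lambda>j. finprod V (\<lambda>i. act (z [^] j) (act ((u [^] j) [^] i) v)) {..<q}) {..<q}"
    using u v z by (intro V.finprod_swap) auto
  also have "\<dots> = finprod V (\<lambda>j. if 0 = j then v [^]\<^bsub>V\<^esub> q else \<one>\<^bsub>V\<^esub>) {..<q}"
    using v V.finprod_const[OF v, of "{..<q}"] col by (intro V.finprod_cong') auto
  also have "\<dots> = v [^]\<^bsub>V\<^esub> q"
    using V.finprod_singleton[of 0 "{..<q}" "\<lambda>_. v [^]\<^bsub>V\<^esub> q"] q0 v by auto
  finally show ?thesis ..
qed

end

section \<open>Irreducible actions on elementary abelian groups\<close>

locale irreducible_action = linear_action +
  fixes r :: nat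
  assumes prime_r: "prime r"
    and exponent_r: "\<And>v. v \<in> carrier V \<Longrightarrow> v [^]\<^bsub>V\<^esub> r = \<one>\<^bsub>V\<^esub>"
    and nontrivial: "carrier V \<noteq> {\<one>\<^bsub>V\<^esub>}"
    and irreducible: "\<And>U. subgroup U V \<Longrightarrow> (\<And>g u. g \<in> carrier G \<Longrightarrow> u \<in> U \<Longrightarrow> act g u \<in> U) \<Longrightarrow>
      U = {\<one>\<^bsub>V\<^esub>} \<or> U = carrier V"
begin

text \<open>An element of order \<open>r\<close> acting on a nontrivial group of exponent
  \<open>r\<close> fixes more than the identity, by counting orbits.\<close>

lemma fpf_prime_order_neq:
  assumes "x \<in> carrier G" "x [^] q = \<one>" "prime (q::nat)" "fpf x"
  shows "q \<noteq> r"
proof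
  assume "q = r"
  have "card {v \<in> carrier V. act x v = v} mod q = card (carrier V) mod q"
    using assms finite_V act_funpow by (intro card_fixed_points_mod_prime) auto
  moreover have "{v \<in> carrier V. act x v = v} = {\<one>\<^bsub>V\<^esub>}"
    using assms unfolding fpf_def by auto
  moreover have "q dvd card (carrier V)"
    using V.exponent_dvd_card[OF finite_V prime_r exponent_r nontrivial] \<open>q = r\<close> by simp
  ultimately show False using assms(3) prime_gt_1_nat[of q] by auto
qed

text \<open>A noncyclic group of order \<open>q\<^sup>2\<close> never acts without fixed points.\<close>

lemma ex_pow_of_fpf_square:
  assumes u: "u \<in> carrier G" "u [^] q = \<one>" "fpf u" and z: "z \<in> carrier G" "z [^] q = \<one>"
    and q: "prime (q::nat)" and comm: "z \<otimes> u = u \<otimes> z"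
    and fp: "\<And>i::nat. z \<otimes> u [^] i \<noteq> \<one> \<Longrightarrow> fpf (z \<otimes> u [^] i)"
  shows "\<exists>i::nat. z = u [^] i"
proof (rule ccontr)
  assume no: "\<nexists>i::nat. z = u [^] i"
  have "z \<otimes> u [^] i \<noteq> \<one>" for i :: nat
  proof
    assume "z \<otimes> u [^] i = \<one>"
    moreover have "u [^] (i * (q - 1)) \<otimes> u [^] i = \<one>"
    proof -
      have "i * (q - 1) + i = q * i" using prime_gt_0_nat[OF q] by (cases q) auto
      then have "u [^] (i * (q - 1)) \<otimes> u [^] i = (u [^] q) [^] i"
        using u(1) by (simp only: nat_pow_mult nat_pow_pow)
      then show ?thesis using u by simp
    qed
    ultimately have "z \<otimes> u [^] i = u [^] (i * (q - 1)) \<otimes> u [^] i" by simp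
    then have "z = u [^] (i * (q - 1))" using u z by simp
    then show False using no by blast
  qed
  then have "v [^]\<^bsub>V\<^esub> q = \<one>\<^bsub>V\<^esub>" if "v \<in> carrier V" for v
    using pow_eq_one_of_fpf_square[OF u z q comm] fp that by blast
  moreover have "q \<noteq> r" using fpf_prime_order_neq[OF u(1,2) q u(3)] .
  ultimately have "v = \<one>\<^bsub>V\<^esub>" if "v \<in> carrier V" for v
    using V.pow_coprime_eq_one[of v q r] exponent_r that primes_coprime[OF q prime_r] by blast
  then show False using nontrivial V.one_closed by blast
qed

end

locale faithful_irreducible_action = irreducible_action +
  assumes faithful: "\<And>g. g \<in> carrier G \<Longrightarrow> (\<And>v. v \<in> carrier V \<Longrightarrow> act g v = v) \<Longrightarrow> g = \<one>"
begin

text \<open>The fixed points of finitely many elements of \<open>M\<close> form a nontrivial group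
  of exponent \<open>r\<close>. It is stable under the next element because \<open>M\<close> is
  abelian, and counting modulo \<open>r\<close> keeps its fixed points nontrivial. The fixed points
  of all of \<open>M\<close> are \<open>G\<close>-invariant by normality, hence everything, and
  faithfulness applies.\<close>

lemma normal_exponent_r_trivial:
  assumes M: "M \<lhd> G" "\<And>m. m \<in> M \<Longrightarrow> m [^] r = \<one>" "\<And>m n. m \<in> M \<Longrightarrow> n \<in> M \<Longrightarrow> m \<otimes> n = n \<otimes> m"
  shows "M = {\<one>}"
proof -
  interpret M: normal M G by fact
  have Mc [simp]: "m \<in> M \<Longrightarrow> m \<in> carrier G" for m by simp
  define C where "C F = {v \<in> carrier V. \<forall>m \<in> F. act m v = v}" for F
  have subC: "subgroup (C F) V" if "F \<subseteq> M" for F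
  proof (rule V.subgroupI)
    show "C F \<noteq> {}" using that unfolding C_def by (auto intro!: exI[of _ "\<one>\<^bsub>V\<^esub>"])
    fix v assume v: "v \<in> C F"
    show "inv\<^bsub>V\<^esub> v \<in> C F" unfolding C_def
    proof (intro CollectI conjI ballI)
      show "inv\<^bsub>V\<^esub> v \<in> carrier V" using v unfolding C_def by simp
      fix m assume m: "m \<in> F"
      then have "m \<in> carrier G" using that by auto
      then have "act m (inv\<^bsub>V\<^esub> v) = inv\<^bsub>V\<^esub> (act m v)"
        using group_hom.hom_inv[of V V "act m"] act_hom v unfolding C_def
        by (simp add: group_hom_def group_hom_axioms_def)
      then show "act m (inv\<^bsub>V\<^esub> v) = inv\<^bsub>V\<^esub> v" using v m unfolding C_def by simp
    qed
  qed (use that in \<open>auto simp: C_def act_add\<close>)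
  have ntC: "C F \<noteq> {\<one>\<^bsub>V\<^esub>}" if "finite F" "F \<subseteq> M" for F
    using that
  proof (induction F rule: finite_induct)
    case empty
    then show ?case using nontrivial unfolding C_def by simp
  next
    case (insert m F)
    have m: "m \<in> M" "m \<in> carrier G" using insert by auto
    interpret CF: group "V\<lparr>carrier := C F\<rparr>" using V.subgroup_imp_group[OF subC] insert by auto
    have fin: "finite (C F)" unfolding C_def using finite_V by simp
    have "r dvd card (carrier (V\<lparr>carrier := C F\<rparr>))"
    proof (rule CF.exponent_dvd_card[OF _ prime_r])
      fix x assume "x \<in> carrier (V\<lparr>carrier := C F\<rparr>)"
      then have "x [^]\<^bsub>V\<^esub> r = \<one>\<^bsub>V\<^esub>" using exponent_r unfolding C_def by simp
      then show "x [^]\<^bsub>V\<lparr>carrier := C F\<rparr>\<^esub> r = \<one>\<^bsub>V\<lparr>carrier := C F\<rparr>\<^esub>"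
        by (simp flip: V.nat_pow_consistent)
    qed (use fin insert in auto)
    then have "r dvd card (C F)" by simp
    moreover have "card {v \<in> C F. act m v = v} mod r = card (C F) mod r"
    proof (rule card_fixed_points_mod_prime[OF fin _ prime_r])
      show "act m \<in> C F \<rightarrow> C F"
      proof
        fix v assume v: "v \<in> C F"
        have "act n (act m v) = act m v" if "n \<in> F" for n
        proof -
          have n: "n \<in> M" using that insert by auto
          then have "act n (act m v) = act m (act n v)"
            using m v M(3)[OF n m(1)] unfolding C_def by (simp add: act_mult[symmetric])
          then show ?thesis using v that unfolding C_def by simp
        qed
        then show "act m v \<in> C F" using v m unfolding C_def by auto
      qed
      show "(act m ^^ r) v = v" if "v \<in> C F" for v
        using act_funpow[OF m(2)] M(2)[OF m(1)] that unfolding C_def by simp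
    qed
    moreover have "{v \<in> C F. act m v = v} = C (insert m F)" unfolding C_def by auto
    ultimately have "r dvd card (C (insert m F))" by (simp add: dvd_eq_mod_eq_0)
    then show ?case using prime_gt_1_nat[OF prime_r] by auto
  qed
  have finM: "finite M" using finite_G M.subset finite_subset by blast
  have "C M = {\<one>\<^bsub>V\<^esub>} \<or> C M = carrier V"
  proof (rule irreducible)
    fix g u assume gu: "g \<in> carrier G" "u \<in> C M"
    have "act m (act g u) = act g u" if m: "m \<in> M" for m
    proof -
      have "inv g \<otimes> m \<otimes> g \<in> M" using M.inv_op_closed1[OF gu(1) m] .
      then have "act g (act (inv g \<otimes> m \<otimes> g) u) = act g u" using gu unfolding C_def by simp
      then show ?thesis using gu m unfolding C_def by (simp add: act_mult[symmetric] m_assoc)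
    qed
    then show "act g u \<in> C M" using gu unfolding C_def by auto
  qed (rule subC, simp)
  then have "C M = carrier V" using ntC[OF finM] by auto
  then have "m = \<one>" if "m \<in> M" for m using that by (intro faithful) (auto simp: C_def)
  then show ?thesis using M.one_closed by blast
qed

end

section \<open>Eigenvectors and elements of prime power order\<close>

text \<open>The multiplicative order of \<open>k\<close> modulo \<open>t\<close> exceeds 1 and
  divides both \<open>n\<close> and \<open>t - 1\<close>. For a prime divisor \<open>p\<close> of
  it, a suitable power of \<open>k\<close> has order \<open>p\<close>.\<close>

lemma ex_prime_root_of_unity:
  assumes "prime (t::nat)" "[k ^ n = 1] (mod t)" "[k \<noteq> 1] (mod t)" "n > 0"
  shows "\<exists>p l. prime p \<and> p dvd n \<and> p dvd t - 1 \<and> [l ^ p = 1] (mod t) \<and> [l \<noteq> 1] (mod t)"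
proof -
  define o' where "o' = ord t k"
  have on: "o' dvd n" using assms(2) ord_divides unfolding o'_def by blast
  have cop: "coprime t k"
  proof (rule ccontr)
    assume "\<not> coprime t k"
    then have "t dvd k" using assms(1) prime_imp_coprime by blast
    then have "t dvd k ^ n" using assms(4) by (simp add: dvd_power_iff_le dvd_trans[OF _ dvd_power])
    then have "t dvd 1" using assms(2) cong_dvd_iff by blast
    then show False using assms(1) by simp
  qed
  have ot: "o' dvd t - 1"
    using fermat_theorem[OF assms(1), of k] cop assms(1) ord_divides unfolding o'_def
    by (metis coprime_absorb_left not_prime_unit)
  have "o' \<noteq> 1" using assms(3) ord_works[of k t] unfolding o'_def by (metis power_one_right ord)
  then obtain p where p: "prime p" "p dvd o'" using prime_factor_nat by blast
  then obtain j where j: "o' = j * p" by (metis dvd_div_mult_self)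
  have "[(k ^ j) ^ p = 1] (mod t)" using ord[of k t] j unfolding o'_def by (simp flip: power_mult)
  moreover have "[k ^ j \<noteq> 1] (mod t)"
  proof
    assume "[k ^ j = 1] (mod t)"
    then have "j * p dvd j" using ord_divides j unfolding o'_def by metis
    moreover have "j > 0" using j on assms(4) by (metis dvd_0_left_iff gr0I mult_0 neq0_conv)
    ultimately show False using p(1) by (metis dvd_imp_le mult.right_neutral nat_mult_le_cancel1
      not_le prime_gt_1_nat)
  qed
  ultimately show ?thesis using p on ot dvd_trans by blast
qed

text \<open>As \<open>p\<close> is prime, \<open>l ^ j\<close> is still different from 1 modulo
  \<open>t\<close>, so the factor \<open>l ^ j - 1\<close> can be cancelled from
  \<open>(l ^ j) ^ p - 1\<close>.\<close>

lemma dvd_geometric_sum: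
  assumes "prime (t::nat)" "prime (p::nat)" "[l ^ p = 1] (mod t)" "[l \<noteq> 1] (mod t)" "0 < j" "j < p"
  shows "t dvd (\<Sum>i<p. l ^ (i * j))"
proof -
  have nl: "[l ^ j \<noteq> 1] (mod t)"
  proof
    assume "[l ^ j = 1] (mod t)"
    then have "ord t l dvd j" "ord t l dvd p" using assms(3) ord_divides by blast+
    moreover have "coprime j p"
      using assms(2,5,6) by (metis coprime_commute nat_dvd_not_less prime_imp_coprime)
    ultimately have "ord t l = 1" by (metis coprime_common_divisor_nat)
    then show False using assms(4) ord[of l t] by simp
  qed
  have "(int l ^ j) ^ p - 1 = (int l ^ j - 1) * (\<Sum>i<p. (int l ^ j) ^ i)"
    by (rule power_diff_1_eq)
  moreover have "int t dvd (int l ^ j) ^ p - 1"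
  proof -
    have "[(l ^ p) ^ j = 1 ^ j] (mod t)" using assms(3) cong_pow by blast
    then have "[int ((l ^ p) ^ j) = int 1] (mod int t)" by (simp only: cong_int_iff power_one)
    moreover have "int ((l ^ p) ^ j) = (int l ^ j) ^ p" by (metis mult.commute of_nat_power power_mult)
    ultimately show ?thesis by (simp add: cong_iff_dvd_diff)
  qed
  moreover have "\<not> int t dvd int l ^ j - 1"
    using nl cong_int_iff[of "l ^ j" 1 t] by (simp add: cong_iff_dvd_diff)
  ultimately have "int t dvd (\<Sum>i<p. (int l ^ j) ^ i)"
    using prime_dvd_mult_iff[of "int t"] assms(1) by (metis prime_nat_int_transfer)
  also have "(\<Sum>i<p. (int l ^ j) ^ i) = int (\<Sum>i<p. l ^ (i * j))"
  proof -
    have "(int l ^ j) ^ i = int (l ^ (i * j))" for i by (metis mult.commute of_nat_power power_mult)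
    then show ?thesis by simp
  qed
  finally show ?thesis by (simp only: int_dvd_int_iff)
qed

text \<open>The bound on \<open>e\<close> is for \<open>t = 2\<close>: at \<open>e = 1\<close> the
  quotient would be 1.\<close>

lemma prime_dvd_triangular:
  assumes "prime (t::nat)" "2 \<le> e"
  shows "t dvd t ^ e * (t ^ e - 1) div 2"
proof -
  define e' where "e' = e - 2"
  have e: "e = Suc (Suc e')" using assms(2) unfolding e'_def by simp
  have "even (t ^ Suc e' * (t ^ e - 1))" by (cases "even t") (auto simp: e)
  moreover have "t ^ e * (t ^ e - 1) = t * (t ^ Suc e' * (t ^ e - 1))" by (simp add: e)
  ultimately have "t ^ e * (t ^ e - 1) div 2 = t * (t ^ Suc e' * (t ^ e - 1) div 2)"
    by (simp only: div_mult_swap)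
  then show ?thesis by simp
qed

context group begin

lemma pow_cong_eq:
  assumes "x \<in> carrier G" "x [^] t = \<one>" "[a = b] (mod t)"
  shows "x [^] a = x [^] (b::nat)"
proof -
  have red: "x [^] a = x [^] (a mod t)" for a
  proof -
    have "x [^] a = x [^] (t * (a div t) + a mod t)" by simp
    also have "\<dots> = (x [^] t) [^] (a div t) \<otimes> x [^] (a mod t)"
      using assms(1) by (simp only: nat_pow_mult nat_pow_pow)
    finally show ?thesis using assms(1,2) by simp
  qed
  show ?thesis using red[of a] red[of b] assms(3) unfolding cong_def by simp
qed

lemma pow_eq_imp_cong:
  assumes "x \<in> carrier G" "x [^] t = \<one>" "x \<noteq> \<one>" "prime (t::nat)" "x [^] a = x [^] (b::nat)"
  shows "[a = b] (mod t)"
proof -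
  have "ord x dvd t" using assms(1,2) pow_eq_id by blast
  then have "ord x = t" using assms(1,3,4) ord_eq_1 by (metis prime_nat_iff)
  moreover have "x [^] int a = x [^] int b" using assms(5) by (simp add: int_pow_int)
  ultimately have "int t dvd int b - int a" using int_pow_eq[OF assms(1)] by blast
  then show ?thesis by (metis cong_iff_dvd_diff cong_int_iff cong_sym)
qed

lemma conj_iterate_pow:
  assumes "g \<in> carrier G" "d \<in> carrier G" "g \<otimes> d \<otimes> inv g = d [^] (k::nat)"
  shows "g [^] n \<otimes> d \<otimes> inv (g [^] n) = d [^] (k ^ n)"
proof (induction n)
  case (Suc n)
  have "g [^] Suc n \<otimes> d \<otimes> inv (g [^] Suc n) = g \<otimes> (g [^] n \<otimes> d \<otimes> inv (g [^] n)) \<otimes> inv g"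
    using assms nat_pow_Suc2[of g n] by (simp add: m_assoc inv_mult_group del: nat_pow_Suc)
  also have "\<dots> = (g \<otimes> d \<otimes> inv g) [^] (k ^ n)" using Suc assms conj_pow[of g d "k ^ n"] by simp
  finally show ?case using assms by (simp add: nat_pow_pow mult.commute)
qed (use assms in simp)

text \<open>Since \<open>b\<close> fixes \<open>w\<close>, conjugation by \<open>b [^] j\<close>
  sends \<open>x\<close> to \<open>x \<otimes> w [^] j\<close>; take \<open>j = p\<close>.\<close>

lemma commutator_pow_eq_one:
  assumes "b \<in> carrier G" "x \<in> carrier G" "w \<in> carrier G" "b \<otimes> x \<otimes> inv b = x \<otimes> w" "b \<otimes> w = w \<otimes> b"
    "b [^] (p::nat) = \<one>"
  shows "w [^] p = \<one>"
proof -
  have "b [^] j \<otimes> x \<otimes> inv (b [^] j) = x \<otimes> w [^] j" for j :: nat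
  proof (induction j)
    case (Suc j)
    have "b [^] Suc j \<otimes> x \<otimes> inv (b [^] Suc j) = b \<otimes> (b [^] j \<otimes> x \<otimes> inv (b [^] j)) \<otimes> inv b"
      using assms nat_pow_Suc2[of b j] by (simp add: m_assoc inv_mult_group del: nat_pow_Suc)
    also have "\<dots> = (b \<otimes> x \<otimes> inv b) \<otimes> (b \<otimes> w [^] j \<otimes> inv b)"
      unfolding Suc using assms(1-3) by (simp add: m_assoc)
    also have "b \<otimes> w [^] j \<otimes> inv b = w [^] j"
      using commute_pow_left[of w b j] assms by (simp add: conj_eq_iff_commute)
    also have "(b \<otimes> x \<otimes> inv b) \<otimes> w [^] j = x \<otimes> w [^] Suc j"
      using assms nat_pow_Suc2[of w j] by (simp add: m_assoc del: nat_pow_Suc)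
    finally show ?case .
  qed (use assms in simp)
  from this[of p] have "x \<otimes> w [^] p = x \<otimes> \<one>" using assms by simp
  then show ?thesis using assms by simp
qed

lemma commutator_eq_one:
  assumes "b \<in> carrier G" "x \<in> carrier G" "w \<in> carrier G" "b \<otimes> x \<otimes> inv b = x \<otimes> w" "b \<otimes> w = w \<otimes> b"
    "b [^] (p::nat) = \<one>" "w [^] (m::nat) = \<one>" "coprime p m"
  shows "b \<otimes> x = x \<otimes> b"
proof -
  have "w = \<one>"
    using pow_coprime_eq_one[OF assms(3) commutator_pow_eq_one[OF assms(1-6)] assms(7,8)] .
  then show ?thesis using assms by (simp add: conj_eq_iff_commute)
qed

lemma class2_commutator_pow:
  assumes "x \<in> carrier G" "y \<in> carrier G" and c: "c \<in> carrier G" "y \<otimes> x = x \<otimes> y \<otimes> c"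
    "c \<otimes> x = x \<otimes> c" "c \<otimes> y = y \<otimes> c" and "y [^] (t::nat) \<otimes> x = x \<otimes> y [^] t"
  shows "c [^] t = \<one>"
proof -
  have "x \<otimes> y [^] t \<otimes> c [^] t = x \<otimes> y [^] t \<otimes> \<one>"
    using class2_pow_left[OF assms(1-6), of t] assms by simp
  then show ?thesis using assms(1-3) by simp
qed

lemma ex_prime_power_element:
  assumes "finite (carrier G)" "subgroup Z G" "x \<in> carrier G" "x \<notin> Z"
  shows "\<exists>t e k. prime (t::nat) \<and> x [^] (k::nat) \<notin> Z \<and> (x [^] k) [^] t \<in> Z \<and> (x [^] k) [^] (t ^ e) = \<one>"
proof -
  define m where "m = (LEAST m. m > 0 \<and> x [^] (m::nat) \<in> Z)"
  have "ord x > 0 \<and> x [^] ord x \<in> Z"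
    using ord_ge_1[OF assms(1,3)] assms(2,3) subgroup.one_closed by fastforce
  then have m: "m > 0 \<and> x [^] m \<in> Z" unfolding m_def by (rule LeastI)
  have min: "x [^] i \<notin> Z" if "0 < i" "i < m" for i
    using not_less_Least[of i "\<lambda>m. m > 0 \<and> x [^] m \<in> Z"] that unfolding m_def by blast
  have "m \<noteq> 1" using m assms(3,4) by auto
  then obtain t where t: "prime t" "t dvd m" using prime_factor_nat by blast
  then obtain j where j: "m = j * t" by (metis dvd_div_mult_self)
  have jm: "0 < j" "j < m" using j m prime_gt_1_nat[OF t(1)] by (auto intro: gr0I)
  define x1 where "x1 = x [^] j"
  have x1: "x1 \<in> carrier G" "x1 \<notin> Z" "x1 [^] t \<in> Z"
    using min[OF jm] m j assms(3) unfolding x1_def by (auto simp: nat_pow_pow)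
  have o0: "order G \<noteq> 0" using assms(1) order_gt_0_iff_finite by simp
  \<comment> \<open>\<open>c\<close> is the part of the group order prime to \<open>t\<close>.
    Raising to this power leaves an element of \<open>t\<close>-power order, and coprimality to
    \<open>t\<close> keeps it outside \<open>Z\<close>.\<close>
  define c where "c = order G div t ^ multiplicity t (order G)"
  have oc: "order G = t ^ multiplicity t (order G) * c"
    unfolding c_def using multiplicity_dvd[of t "order G"] by simp
  have "\<not> t dvd c" unfolding c_def
    using multiplicity_decompose[of "order G" t] o0 prime_gt_1_nat[OF t(1)] by simp
  then have cop: "coprime t c" using t(1) prime_imp_coprime by blast
  have "x1 [^] c \<notin> Z" using pow_coprime_in_subgroup[OF assms(2) x1(1) x1(3) _ cop] x1(2) by blast
  moreover have "(x1 [^] c) [^] t \<in> Z"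
  proof -
    have "(x1 [^] c) [^] t = (x1 [^] t) [^] c" using x1(1) by (simp add: nat_pow_pow mult.commute)
    then show ?thesis using nat_pow_in_subgroup[OF assms(2) x1(3)] by metis
  qed
  moreover have "(x1 [^] c) [^] (t ^ multiplicity t (order G)) = \<one>"
    using pow_order_eq_1[OF x1(1)] oc x1(1) by (simp add: nat_pow_pow mult.commute)
  moreover have "x1 [^] c = x [^] (j * c)" unfolding x1_def using assms(3) by (simp add: nat_pow_pow)
  ultimately show ?thesis using t(1) by metis
qed

end

text \<open>If \<open>l\<close> is a primitive \<open>p\<close>-th root of unity modulo \<open>t\<close>, then \<open>x\<^sup>p\<close> is the product of the
  eigenvectors \<open>\<Prod>\<^sub>j (B\<^sup>j x)\<^bsup>l\<^bsup>ij\<^esup>\<^esup>\<close> of \<open>B\<close>.\<close>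

lemma (in comm_group) automorphism_trivial_of_eigenvectors:
  assumes t: "prime (t::nat)" "\<And>x. x \<in> carrier G \<Longrightarrow> x [^] t = \<one>" and p: "prime (p::nat)" "p \<noteq> t"
    and B: "B \<in> hom G G" "\<And>x. x \<in> carrier G \<Longrightarrow> (B ^^ p) x = x"
    and l: "[l ^ p = 1] (mod t)" "[l \<noteq> 1] (mod t)"
    and eig: "\<And>e k. e \<in> carrier G \<Longrightarrow> B e = e [^] (k::nat) \<Longrightarrow> B e = e"
    and x: "x \<in> carrier G"
  shows "B x = x"
proof -
  define xi where "xi j = (B ^^ j) x" for j
  have xi [simp]: "xi j \<in> carrier G" for j
    unfolding xi_def using x hom_in_carrier[OF B(1)] by (induction j) auto
  have xiS: "B (xi j) = xi (Suc j)" for j unfolding xi_def by simp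
  have xip: "xi p = xi 0" unfolding xi_def using B(2) x by simp
  have p0: "p > 0" using p(1) prime_gt_0_nat by blast
  interpret B: group_hom G G B using B(1) by unfold_locales
  define E where "E i = finprod G (\<lambda>j. xi j [^] (l ^ (i * j))) {..<p}" for i
  have Ec [simp]: "E i \<in> carrier G" for i unfolding E_def by (intro finprod_closed) auto
  have Bprod: "B (finprod G f A) = finprod G (\<lambda>x. B (f x)) A" if "finite A" "f \<in> A \<rightarrow> carrier G" for f and A :: "nat set"
    using finprod_hom[OF comm_monoid_axioms comm_monoid_axioms B(1) _ that] by simp
  \<comment> \<open>\<open>m\<close> is the inverse of \<open>l\<close> modulo \<open>t\<close>, so
    \<open>E i\<close> is an eigenvector with eigenvalue \<open>m ^ i\<close>.\<close>
  define m where "m = l ^ (p - 1)"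
  have lm: "[l ^ i * m ^ i = 1] (mod t)" for i
  proof -
    have "l ^ i * m ^ i = (l ^ p) ^ i"
      unfolding m_def using p0 by (metis power_mult_distrib power_minus_mult mult.commute)
    then show ?thesis using cong_pow[OF l(1), of i] by simp
  qed
  have BE: "B (E i) = E i" for i
  proof (rule eig)
    define F where "F j = xi j [^] (l ^ (i * j) * m ^ i)" for j
    have "B (E i) = finprod G (\<lambda>j. B (xi j [^] (l ^ (i * j)))) {..<p}"
      unfolding E_def by (rule Bprod) auto
    also have "\<dots> = finprod G (\<lambda>j. F (Suc j)) {..<p}"
    proof (rule finprod_cong')
      fix j assume "j \<in> {..<p}"
      have "[l ^ (i * Suc j) * m ^ i = l ^ (i * j)] (mod t)"
        using cong_scalar_left[OF lm, of "l ^ (i * j)" i] by (simp add: power_add mult.assoc mult.commute mult.left_commute)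
      then have "xi (Suc j) [^] (l ^ (i * j)) = F (Suc j)"
        unfolding F_def using pow_cong_eq[OF xi t(2)[OF xi]] by (metis cong_sym)
      then show "B (xi j [^] (l ^ (i * j))) = F (Suc j)" using B.hom_nat_pow[OF xi] xiS by simp
    qed (auto simp: F_def)
    also have "\<dots> = finprod G F {..<p}"
    proof (rule finprod_lessThan_shift)
      have "[l ^ (i * p) * m ^ i = l ^ (i * 0) * m ^ i] (mod t)"
        using cong_scalar_right[OF cong_pow[OF l(1), of i], of "m ^ i"] by (simp add: mult.commute flip: power_mult)
      then show "F p = F 0" unfolding F_def xip by (rule pow_cong_eq[OF xi t(2)[OF xi]])
    qed (simp add: F_def)
    also have "\<dots> = E i [^] (m ^ i)"
      unfolding E_def F_def by (subst finprod_pow) (auto simp: nat_pow_pow)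
    finally show "B (E i) = E i [^] (m ^ i)" .
  qed simp
  have "finprod G E {..<p} = finprod G (\<lambda>j. finprod G (\<lambda>i. xi j [^] (l ^ (i * j))) {..<p}) {..<p}"
    unfolding E_def by (intro finprod_swap) auto
  also have "\<dots> = finprod G (\<lambda>j. if 0 = j then x [^] p else \<one>) {..<p}"
  proof (rule finprod_cong')
    fix j assume j: "j \<in> {..<p}"
    have "finprod G (\<lambda>i. xi j [^] f i) {..<q} = xi j [^] (\<Sum>i<q. f i)" for f :: "nat \<Rightarrow> nat" and q
      by (induction q) (simp_all add: lessThan_Suc Pi_def nat_pow_mult add.commute)
    then have eq: "finprod G (\<lambda>i. xi j [^] (l ^ (i * j))) {..<p} = xi j [^] (\<Sum>i<p. l ^ (i * j))" .
    show "finprod G (\<lambda>i. xi j [^] (l ^ (i * j))) {..<p} = (if 0 = j then x [^] p else \<one>)"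
    proof (cases "j = 0")
      case True
      then show ?thesis unfolding eq by (simp add: xi_def)
    next
      case False
      then have "t dvd (\<Sum>i<p. l ^ (i * j))" using dvd_geometric_sum[OF t(1) p(1) l, of j] j by auto
      then have "[(\<Sum>i<p. l ^ (i * j)) = 0] (mod t)" by (simp add: cong_0_iff)
      then show ?thesis unfolding eq using pow_cong_eq[OF xi t(2)[OF xi]] False by fastforce
    qed
  qed (use x in auto)
  also have "\<dots> = x [^] p" using finprod_singleton[of 0 "{..<p}" "\<lambda>_. x [^] p"] p0 x by auto
  finally have prod: "finprod G E {..<p} = x [^] p" .
  \<comment> \<open>\<open>B\<close> fixes every eigenvector, hence their product. As
    \<open>p\<close> is prime to \<open>t\<close>, the exponent \<open>p\<close> can be
    cancelled.\<close>
  have "B (x [^] p) = finprod G (\<lambda>i. B (E i)) {..<p}" unfolding prod[symmetric] by (rule Bprod) auto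
  also have "\<dots> = x [^] p" unfolding BE prod ..
  finally have "B x [^] p = x [^] p" using B.hom_nat_pow[OF x] by simp
  then have "(B x \<otimes> inv x) [^] p = \<one>" using x by (simp add: nat_pow_distrib nat_pow_inv)
  moreover have "(B x \<otimes> inv x) [^] t = \<one>" using t(2) x by simp
  ultimately have "B x \<otimes> inv x = \<one>"
    using pow_coprime_eq_one[of "B x \<otimes> inv x" p t] primes_coprime[OF p(1) t(1) p(2)] x by simp
  then have "inv (inv x) = B x" using x by (intro inv_equality) auto
  then show ?thesis using x by simp
qed

text \<open>Normality is only asked inside \<open>T\<close>, so that the locale covers both chief
  factors and the sections of an arbitrary subgroup on which eigenvectors are studied.\<close>

locale abelian_section = group +
  fixes T Q
  assumes T_sub: "subgroup T G" and Q_sub: "subgroup Q G" and QT: "Q \<subseteq> T"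
    and Q_conj: "\<And>x z. x \<in> T \<Longrightarrow> z \<in> Q \<Longrightarrow> x \<otimes> z \<otimes> inv x \<in> Q"
    and Q_comm: "\<And>x z. x \<in> T \<Longrightarrow> z \<in> T \<Longrightarrow> \<exists>c \<in> Q. z \<otimes> x = x \<otimes> z \<otimes> c"
begin

definition section_group :: "'a set monoid" where
  "section_group = (G\<lparr>carrier := T\<rparr>) Mod Q"

lemma T_closed [simp]: "x \<in> T \<Longrightarrow> x \<in> carrier G"
  using subgroup.mem_carrier[OF T_sub] .

lemma Q_closed [simp]: "x \<in> Q \<Longrightarrow> x \<in> T"
  using QT by blast

lemma section_normal: "Q \<lhd> G\<lparr>carrier := T\<rparr>"
proof (rule group.normal_invI[OF subgroup_imp_group[OF T_sub]])
  show "subgroup Q (G\<lparr>carrier := T\<rparr>)" by (rule subgroup_incl[OF Q_sub T_sub QT])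
qed (use Q_conj m_inv_consistent[OF T_sub] in auto)

lemma section_carrier: "carrier section_group = (\<lambda>x. Q #> x) ` T"
  unfolding section_group_def carrier_FactGroup by (simp add: r_coset_def)

lemma section_mult: "x \<in> T \<Longrightarrow> z \<in> T \<Longrightarrow> (Q #> x) \<otimes>\<^bsub>section_group\<^esub> (Q #> z) = Q #> (x \<otimes> z)"
  using normal.rcos_sum[OF section_normal, of x z] unfolding section_group_def by simp

lemma section_pow: "x \<in> T \<Longrightarrow> (Q #> x) [^]\<^bsub>section_group\<^esub> (n::nat) = Q #> (x [^] n)"
  using normal.FactGroup_pow[OF section_normal, of x n] unfolding section_group_def
  by (simp flip: nat_pow_consistent)

lemma section_one: "\<one>\<^bsub>section_group\<^esub> = Q"
  unfolding section_group_def by simp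

lemma coset_Q: "z \<in> Q \<Longrightarrow> Q #> z = Q"
  using coset_join2[OF _ Q_sub] by simp

lemma coset_left: "z \<in> Q \<Longrightarrow> x \<in> T \<Longrightarrow> Q #> (z \<otimes> x) = Q #> x"
  using subgroup.subset[OF Q_sub] by (simp add: coset_mult_assoc[symmetric] coset_Q)

lemma coset_eq_iff: "x \<in> T \<Longrightarrow> z \<in> T \<Longrightarrow> Q #> x = Q #> z \<longleftrightarrow> (\<exists>q \<in> Q. x = q \<otimes> z)"
  using ex_mult_of_rcos_eq[OF Q_sub] coset_left T_closed by metis

lemma coset_eq_Q_iff: "x \<in> T \<Longrightarrow> Q #> x = Q \<longleftrightarrow> x \<in> Q"
  using coset_Q rcos_self[OF _ Q_sub] T_closed by metis

lemma section_comm_group: "comm_group section_group"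
proof (rule group.group_comm_groupI)
  show "group section_group"
    unfolding section_group_def by (rule normal.factorgroup_is_group[OF section_normal])
  fix A B assume "A \<in> carrier section_group" "B \<in> carrier section_group"
  then obtain x z where xz: "x \<in> T" "z \<in> T" "A = Q #> x" "B = Q #> z" unfolding section_carrier by blast
  obtain c where c: "c \<in> Q" "z \<otimes> x = x \<otimes> z \<otimes> c" using Q_comm[OF xz(1,2)] by blast
  have xzT: "x \<otimes> z \<in> T" using xz subgroup.m_closed[OF T_sub] by blast
  have "z \<otimes> x = ((x \<otimes> z) \<otimes> c \<otimes> inv (x \<otimes> z)) \<otimes> (x \<otimes> z)"
    using c xz by (simp add: m_assoc)
  then have "Q #> (z \<otimes> x) = Q #> (x \<otimes> z)" using coset_left[OF Q_conj[OF xzT c(1)] xzT] by simp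
  then show "A \<otimes>\<^bsub>section_group\<^esub> B = B \<otimes>\<^bsub>section_group\<^esub> A" using xz by (simp add: section_mult)
qed

text \<open>Taking images of sets avoids representatives. On cosets of the trivial subgroup it is
  ordinary conjugation on singletons.\<close>

definition conj_coset :: "'a \<Rightarrow> 'a set \<Rightarrow> 'a set" where
  "conj_coset g A = (\<lambda>x. g \<otimes> x \<otimes> inv g) ` A"

lemma conj_coset_rcos:
  assumes g: "g \<in> carrier G" "\<And>z. z \<in> Q \<Longrightarrow> g \<otimes> z \<otimes> inv g \<in> Q" "\<And>z. z \<in> Q \<Longrightarrow> inv g \<otimes> z \<otimes> g \<in> Q"
    and x: "x \<in> T"
  shows "conj_coset g (Q #> x) = Q #> (g \<otimes> x \<otimes> inv g)"
proof -
  have Qc [simp]: "z \<in> Q \<Longrightarrow> z \<in> carrier G" for z by simp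
  have 1: "(\<lambda>z. g \<otimes> z \<otimes> inv g) ` Q = Q"
  proof
    show "Q \<subseteq> (\<lambda>z. g \<otimes> z \<otimes> inv g) ` Q"
    proof
      fix z assume z: "z \<in> Q"
      have "z = g \<otimes> (inv g \<otimes> z \<otimes> g) \<otimes> inv g" using g(1) z by (simp add: m_assoc)
      then show "z \<in> (\<lambda>z. g \<otimes> z \<otimes> inv g) ` Q" using g(3)[OF z] by blast
    qed
  qed (use g in auto)
  have "conj_coset g (Q #> x) = (\<lambda>z. g \<otimes> (z \<otimes> x) \<otimes> inv g) ` Q"
    unfolding conj_coset_def r_coset_def by auto
  also have "\<dots> = (\<lambda>z. z \<otimes> (g \<otimes> x \<otimes> inv g)) ` ((\<lambda>z. g \<otimes> z \<otimes> inv g) ` Q)"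
    unfolding image_image by (rule image_cong) (use g(1) x in \<open>simp_all add: m_assoc\<close>)
  also have "\<dots> = Q #> (g \<otimes> x \<otimes> inv g)" unfolding 1 r_coset_def by auto
  finally show ?thesis .
qed

end

section \<open>Faithful irreducible actions\<close>

context group begin

lemma subgroup_centralizer: "z \<in> carrier G \<Longrightarrow> subgroup {x \<in> carrier G. x \<otimes> z = z \<otimes> x} G"
  by (rule subgroupI) (auto simp: commute_inv commute_mult)

lemma prime_power_torsion_trivial:
  assumes "\<And>z. z \<in> Z \<Longrightarrow> z [^] (t::nat) = \<one> \<Longrightarrow> z = \<one>" "subgroup Z G"
    "z \<in> Z" "z [^] (t ^ e) = \<one>"
  shows "z = \<one>"
  using assms(4)
proof (induction e)
  case (Suc e)
  have z: "z \<in> carrier G" using assms(2,3) subgroup.mem_carrier by fast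
  then have "(z [^] (t ^ e)) [^] t = \<one>" using Suc(2) by (simp add: nat_pow_pow mult.commute)
  then have "z [^] (t ^ e) = \<one>" using assms(1) nat_pow_in_subgroup[OF assms(2,3)] by blast
  then show ?case using Suc by simp
qed (use assms subgroup.mem_carrier[OF assms(2)] in simp)

end

text \<open>Here \<open>G\<close> stands for the quotient by the centralizer of the minimal normal
  subgroup and \<open>y\<close> for the image of the last vertex. \<open>centralizer_fpf\<close>
  records that no path through a fixed point exists, for the powers of \<open>y\<close> of prime
  order.\<close>

locale engel_target = faithful_irreducible_action +
  fixes y
  assumes y_closed [simp]: "y \<in> carrier G" and y_not_one: "y \<noteq> \<one>"
    and centralizer_fpf: "\<And>p n x. prime (p::nat) \<Longrightarrow> ord y = n * p \<Longrightarrow> x \<in> carrier G \<Longrightarrow> x \<noteq> \<one> \<Longrightarrow>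
      x \<otimes> y [^] n = y [^] n \<otimes> x \<Longrightarrow> fpf x"
    and soluble: "solvable G"
begin

definition prime_part :: "nat \<Rightarrow> 'a \<Rightarrow> bool" where
  "prime_part p b \<longleftrightarrow> prime p \<and> (\<exists>n. ord y = n * p \<and> b = y [^] n)"

lemma prime_partD:
  assumes "prime_part p b"
  shows "prime p" "b \<in> carrier G" "b [^] p = \<one>" "b \<noteq> \<one>" "b \<otimes> y = y \<otimes> b" "p dvd ord y"
proof -
  obtain n where n: "prime p" "ord y = n * p" "b = y [^] n" using assms unfolding prime_part_def by blast
  show "prime p" "b \<in> carrier G" "p dvd ord y" using n by auto
  show "b [^] p = \<one>" "b \<noteq> \<one>" "b \<otimes> y = y \<otimes> b"
    unfolding n(3) using prime_part_of_ord[OF finite_G y_closed n(1,2)] by simp_all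
qed

lemma prime_part_fpf:
  assumes "prime_part p b" "x \<in> carrier G" "x \<noteq> \<one>" "x \<otimes> b = b \<otimes> x"
  shows "fpf x"
  using assms centralizer_fpf unfolding prime_part_def by blast

lemma ex_prime_part: "\<exists>p b. prime_part p b"
proof -
  obtain p n where "prime (p::nat)" "ord y = n * p"
    using ex_pow_prime_ord[OF y_closed y_not_one finite_G] by blast
  then show ?thesis unfolding prime_part_def by blast
qed

lemma prime_partI: "prime p \<Longrightarrow> p dvd ord y \<Longrightarrow> \<exists>b. prime_part p b"
  unfolding prime_part_def by (metis dvd_div_mult_self)

text \<open>In the centralizer of \<open>b\<close> all nontrivial elements are fixed point free, so
  two commuting elements of order \<open>q\<close> cannot generate a noncyclic group.\<close>

lemma ex_pow_in_centralizer:
  assumes "prime_part p b" and u: "u \<in> carrier G" "u [^] q = \<one>" "u \<noteq> \<one>" "u \<otimes> b = b \<otimes> u"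
    and z: "z \<in> carrier G" "z [^] q = \<one>" "z \<otimes> b = b \<otimes> z"
    and q: "prime (q::nat)" and comm: "z \<otimes> u = u \<otimes> z"
  shows "\<exists>i::nat. z = u [^] i"
proof (rule ex_pow_of_fpf_square[OF u(1,2) _ z(1,2) q comm])
  show "fpf u" using prime_part_fpf[OF assms(1) u(1,3,4)] .
  fix i :: nat assume "z \<otimes> u [^] i \<noteq> \<one>"
  moreover have "(z \<otimes> u [^] i) \<otimes> b = b \<otimes> (z \<otimes> u [^] i)"
    using u z prime_partD(2)[OF assms(1)] commute_pow_left[OF u(1) _ u(4)] by (intro commute_mult) auto
  ultimately show "fpf (z \<otimes> u [^] i)" using prime_part_fpf[OF assms(1), of "z \<otimes> u [^] i"] u z by simp
qed

definition target :: "'a \<Rightarrow> bool" where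
  "target d \<longleftrightarrow> d \<in> carrier G \<and> d \<noteq> \<one> \<and> (\<exists>q. prime (q::nat) \<and> d [^] q = \<one>) \<and> d \<otimes> y = y \<otimes> d \<and>
     (\<forall>g \<in> carrier G. \<exists>i::nat. g \<otimes> d \<otimes> inv g = d [^] i)"

text \<open>Counting modulo \<open>p\<close> gives a nontrivial \<open>z\<close> in \<open>M\<close>
  that commutes with \<open>b\<close>. Both have order \<open>p\<close>, so \<open>b\<close> is a
  power of \<open>z\<close> and lies in \<open>M\<close>; then every element of \<open>M\<close> is
  a power of \<open>b\<close>.\<close>

lemma target_of_normal_subgroup:
  assumes b: "prime_part p b" and M: "M \<lhd> G" "\<And>m. m \<in> M \<Longrightarrow> m [^] p = \<one>"
    "\<And>m n. m \<in> M \<Longrightarrow> n \<in> M \<Longrightarrow> m \<otimes> n = n \<otimes> m" "M \<noteq> {\<one>}"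
  shows "target b"
proof -
  interpret M: normal M G by fact
  note bD = prime_partD[OF b]
  interpret GM: group "G\<lparr>carrier := M\<rparr>" by (rule M.subgroup_is_group[OF is_group])
  have finM: "finite M" using finite_G M.subset finite_subset by blast
  have "p dvd card M"
    using GM.exponent_dvd_card[of p] bD(1) finM M(2,4) by (simp flip: nat_pow_consistent)
  moreover have "card {x \<in> M. b \<otimes> x = x \<otimes> b} mod p = card M mod p"
    using M.inv_op_closed2[OF bD(2)] bD finM M.subset by (intro card_conj_fixed_mod) auto
  ultimately have dv: "p dvd card {x \<in> M. b \<otimes> x = x \<otimes> b}" by (simp add: dvd_eq_mod_eq_0)
  have "\<exists>z \<in> M. b \<otimes> z = z \<otimes> b \<and> z \<noteq> \<one>"
  proof (rule ccontr)
    assume "\<not> ?thesis"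
    then have "{x \<in> M. b \<otimes> x = x \<otimes> b} = {\<one>}" using bD by auto
    then show False using dv prime_gt_1_nat[OF bD(1)] by simp
  qed
  then obtain z where z: "z \<in> M" "b \<otimes> z = z \<otimes> b" "z \<noteq> \<one>" by blast
  then obtain i where "b = z [^] (i::nat)"
    using ex_pow_in_centralizer[OF b, of z p b] bD M(2) by auto
  then have bM: "b \<in> M" using z(1) nat_pow_in_subgroup[OF M.is_subgroup] by simp
  have pw: "\<exists>i::nat. m = b [^] i" if "m \<in> M" for m
    using ex_pow_in_centralizer[OF b, of b p m] bD M(2,3) that bM by auto
  have "\<exists>i::nat. g \<otimes> b \<otimes> inv g = b [^] i" if "g \<in> carrier G" for g
    using pw M.inv_op_closed2[OF that bM] by blast
  then show ?thesis unfolding target_def using bD by blast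
qed

text \<open>The commutators \<open>f m\<close> of \<open>b\<close> with elements of \<open>M\<close>
  form a subgroup \<open>W\<close>. As \<open>p\<close> is prime to \<open>t\<close>,
  \<open>b\<close> has no fixed points on \<open>W\<close>. The averaging lemma makes
  \<open>W\<close> act trivially, and faithfulness makes it trivial.\<close>

lemma commute_abelian_subgroup:
  assumes b: "prime_part p b" and M: "subgroup M G" "\<And>m n. m \<in> M \<Longrightarrow> n \<in> M \<Longrightarrow> m \<otimes> n = n \<otimes> m"
    "\<And>m. m \<in> M \<Longrightarrow> b \<otimes> m \<otimes> inv b \<in> M"
    and t: "prime (t::nat)" "t \<noteq> p" "t \<noteq> r" "\<And>m. m \<in> M \<Longrightarrow> m [^] (t ^ e) = \<one>"
    and m: "m \<in> M"
  shows "b \<otimes> m = m \<otimes> b"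
proof -
  note bD = prime_partD[OF b]
  interpret M: subgroup M G by fact
  define f where "f m = inv m \<otimes> (b \<otimes> m \<otimes> inv b)" for m
  have Mc [simp]: "m \<in> M \<Longrightarrow> m \<in> carrier G" for m by simp
  have fM [simp]: "m \<in> M \<Longrightarrow> f m \<in> M" for m unfolding f_def using M(3) by simp
  have f_mult: "f (m \<otimes> n) = f m \<otimes> f n" if "m \<in> M" "n \<in> M" for m n
  proof -
    have "f (m \<otimes> n) = inv n \<otimes> (inv m \<otimes> ((b \<otimes> m \<otimes> inv b) \<otimes> (b \<otimes> n \<otimes> inv b)))"
      unfolding f_def using that bD by (simp add: inv_mult_group m_assoc)
    also have "\<dots> = (inv n \<otimes> f m) \<otimes> (b \<otimes> n \<otimes> inv b)"
      unfolding f_def using that bD by (simp add: m_assoc)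
    also have "inv n \<otimes> f m = f m \<otimes> inv n" using M(2) that by simp
    finally show ?thesis unfolding f_def using that bD by (simp add: m_assoc)
  qed
  have b_eq: "b \<otimes> m \<otimes> inv b = m \<otimes> f m" if "m \<in> M" for m
    unfolding f_def using that bD by simp
  have coprime: "coprime p (t ^ e)" using primes_coprime[OF bD(1) t(1)] t(2) by auto
  have f_one: "f m = \<one>" if "m \<in> M" "b \<otimes> f m = f m \<otimes> b" for m
  proof -
    have fm: "f m \<in> carrier G" "f m [^] (t ^ e) = \<one>" using that t(4) by auto
    have "f m [^] p = \<one>"
      using commutator_pow_eq_one[OF bD(2) _ fm(1) b_eq[OF that(1)] that(2) bD(3)] that by simp
    then show ?thesis using pow_coprime_eq_one[OF fm(1) _ fm(2) coprime] by blast
  qed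
  define W where "W = f ` M"
  have W: "subgroup W G"
  proof (rule subgroupI)
    show "W \<subseteq> carrier G" unfolding W_def by auto
    show "W \<noteq> {}" unfolding W_def using M.one_closed by blast
    show "x \<otimes> z \<in> W" if "x \<in> W" "z \<in> W" for x z
      using that f_mult[symmetric] unfolding W_def by auto
    show "inv x \<in> W" if xW: "x \<in> W" for x
    proof -
      obtain n where n: "n \<in> M" "x = f n" using xW unfolding W_def by blast
      have "f (inv n) \<otimes> f n = f \<one>" using f_mult[of "inv n" n] n by simp
      also have "\<dots> = \<one>" unfolding f_def using bD by simp
      finally have "inv x = f (inv n)" using n inv_equality by simp
      then show ?thesis using n unfolding W_def by simp
    qed
  qed
  interpret GW: group "G\<lparr>carrier := W\<rparr>" using subgroup_imp_group[OF W] .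
  have WM: "W \<subseteq> M" unfolding W_def by auto
  have "\<not> r dvd card (carrier (G\<lparr>carrier := W\<rparr>))"
  proof (rule GW.prime_not_dvd_card_exponent[OF _ prime_r])
    show "finite (carrier (G\<lparr>carrier := W\<rparr>))"
      using finite_subset[of W "carrier G"] finite_G WM M.subset by auto
    show "x [^]\<^bsub>G\<lparr>carrier := W\<rparr>\<^esub> (t ^ e) = \<one>\<^bsub>G\<lparr>carrier := W\<rparr>\<^esub>" if "x \<in> carrier (G\<lparr>carrier := W\<rparr>)" for x
      using that WM t(4) by (auto simp flip: nat_pow_consistent)
    show "\<not> r dvd t ^ e" using t(1,3) prime_r by (metis prime_dvd_power primes_dvd_imp_eq)
  qed
  then have rW: "\<not> r dvd card W" by simp
  have "act w v = v" if "w \<in> W" "v \<in> carrier V" for w v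
  proof (rule trivial_of_frobenius[OF bD(2,3,1) _ W _ _ prime_r exponent_r rW that])
    show "fpf b" using prime_part_fpf[OF b bD(2,4)] by simp
    fix m assume "m \<in> W"
    then obtain n where n: "n \<in> M" "m = f n" unfolding W_def by blast
    have "b \<otimes> f n \<otimes> inv b = f (b \<otimes> n \<otimes> inv b)"
      unfolding f_def using n bD by (simp add: m_assoc inv_mult_group)
    then show "b \<otimes> m \<otimes> inv b \<in> W" using M(3) n unfolding W_def by auto
    show "m = \<one>" if "b \<otimes> m = m \<otimes> b" using f_one n that by simp
  qed
  then have "f m = \<one>" using m by (intro faithful) (auto simp: W_def)
  then have "b \<otimes> m \<otimes> inv b = m" using b_eq[OF m] m by simp
  then show ?thesis using conj_eq_iff_commute bD m by simp
qed

text \<open>A prime part of \<open>y\<close> of order \<open>t\<close> would be a target inside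
  \<open>M\<close>, so \<open>t\<close> does not divide \<open>ord y\<close>. This is the
  coprimality that the averaging argument needs.\<close>

lemma normal_abelian_facts:
  assumes no: "\<nexists>d. target d"
    and t: "prime (t::nat)" and M: "M \<lhd> G" "\<And>m. m \<in> M \<Longrightarrow> m [^] t = \<one>"
    "\<And>m n. m \<in> M \<Longrightarrow> n \<in> M \<Longrightarrow> m \<otimes> n = n \<otimes> m" "M \<noteq> {\<one>}"
  shows "t \<noteq> r" "\<not> t dvd ord y" "prime_part p b \<Longrightarrow> m \<in> M \<Longrightarrow> b \<otimes> m = m \<otimes> b"
proof -
  interpret M: normal M G by fact
  show tr: "t \<noteq> r" using normal_exponent_r_trivial[OF M(1)] M(2-4) by blast
  show nt: "\<not> t dvd ord y"
    using prime_partI[OF t] target_of_normal_subgroup[OF _ M] no by blast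
  assume b: "prime_part p b" and m: "m \<in> M"
  show "b \<otimes> m = m \<otimes> b"
    using prime_partD[OF b] nt M.inv_op_closed2 M m t tr
    by (intro commute_abelian_subgroup[OF b M.is_subgroup M(3) _ t _ tr, of 1]) auto
qed

text \<open>\<open>M\<close> is cyclic, generated by some \<open>d\<close>, and \<open>y\<close>
  acts on it by an exponent \<open>k\<close>. If \<open>k\<close> were 1 modulo \<open>t\<close>,
  then \<open>d\<close> would be a target; otherwise a power of \<open>k\<close> is the desired root
  of unity.\<close>

lemma ex_generator_root_of_unity:
  assumes no: "\<nexists>d. target d"
    and t: "prime (t::nat)" and M: "M \<lhd> G" "\<And>m. m \<in> M \<Longrightarrow> m [^] t = \<one>"
    "\<And>m n. m \<in> M \<Longrightarrow> n \<in> M \<Longrightarrow> m \<otimes> n = n \<otimes> m" "M \<noteq> {\<one>}"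
  shows "\<exists>d \<in> M. d \<noteq> \<one> \<and> (\<forall>m \<in> M. \<exists>i::nat. m = d [^] i) \<and>
    (\<exists>p b l. prime_part p b \<and> p dvd t - 1 \<and> [l ^ p = 1] (mod t) \<and> [l \<noteq> 1] (mod t))"
proof -
  interpret M: normal M G by fact
  have comm: "b \<otimes> m = m \<otimes> b" if "prime_part p b" "m \<in> M" for p b m
    by (rule normal_abelian_facts(3)[OF no t M(1) _ _ M(4) that]) (use M in auto)
  obtain d where d: "d \<in> M" "d \<noteq> \<one>" using M(4) M.one_closed by blast
  have dc: "d \<in> carrier G" "d [^] t = \<one>" using d M(2) by auto
  obtain p b where b: "prime_part p b" using ex_prime_part by blast
  have pw: "\<exists>i::nat. m = d [^] i" if "m \<in> M" for m
    using ex_pow_in_centralizer[OF b, of d t m] comm[OF b] d that M(2,3) t by auto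
  have ndy: "d \<otimes> y \<noteq> y \<otimes> d"
  proof
    assume "d \<otimes> y = y \<otimes> d"
    then have "target d" unfolding target_def using dc d t pw M.inv_op_closed2[OF _ d(1)] by blast
    then show False using no by blast
  qed
  obtain k where k: "y \<otimes> d \<otimes> inv y = d [^] (k::nat)" using pw M.inv_op_closed2[OF y_closed d(1)] by blast
  have "d [^] (k ^ ord y) = d [^] (1::nat)"
    using conj_iterate_pow[OF y_closed dc(1) k, of "ord y"] dc by simp
  then have 1: "[k ^ ord y = 1] (mod t)" by (rule pow_eq_imp_cong[OF dc d(2) t])
  have 2: "[k \<noteq> 1] (mod t)"
  proof
    assume "[k = 1] (mod t)"
    then have "d [^] k = d" using pow_cong_eq[OF dc, of k 1] dc by simp
    then show False using k ndy conj_eq_iff_commute[OF y_closed dc(1)] by simp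
  qed
  have "ord y > 0" using ord_ge_1[OF finite_G y_closed] by simp
  then obtain p' l where pl: "prime p'" "p' dvd ord y" "p' dvd t - 1" "[l ^ p' = 1] (mod t)" "[l \<noteq> 1] (mod t)"
    using ex_prime_root_of_unity[OF t 1 2] by blast
  then obtain b' where "prime_part p' b'" using prime_partI by blast
  then show ?thesis using d pw pl by blast
qed

end

context engel_target begin

text \<open>An eigenvector \<open>Q u\<close> of conjugation by \<open>b\<close> on \<open>T/Q\<close> generates together with \<open>Q\<close> an abelian
  subgroup, which \<open>b\<close> centralises.\<close>

lemma commute_class2_subgroup:
  assumes b: "prime_part p b" and T: "subgroup T G" "\<And>x. x \<in> T \<Longrightarrow> b \<otimes> x \<otimes> inv b \<in> T"
    and Q: "subgroup Q G" "Q \<subseteq> T" "\<And>z. z \<in> Q \<Longrightarrow> b \<otimes> z = z \<otimes> b"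
      "\<And>z x. z \<in> Q \<Longrightarrow> x \<in> T \<Longrightarrow> z \<otimes> x = x \<otimes> z"
      "\<And>x. x \<in> T \<Longrightarrow> x [^] t \<in> Q"
      "\<And>x z. x \<in> T \<Longrightarrow> z \<in> T \<Longrightarrow> \<exists>c \<in> Q. z \<otimes> x = x \<otimes> z \<otimes> c"
    and t: "prime (t::nat)" "t \<noteq> r" "t \<noteq> p" "\<And>x. x \<in> T \<Longrightarrow> x [^] (t ^ e) = \<one>"
    and l: "[l ^ p = 1] (mod t)" "[l \<noteq> 1] (mod t)"
    and x: "x \<in> T"
  shows "b \<otimes> x = x \<otimes> b"
proof -
  note bD = prime_partD[OF b]
  interpret S: abelian_section G T Q
  proof (intro abelian_section.intro abelian_section_axioms.intro is_group T(1) Q(1,2,6))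
    fix x z assume xz: "x \<in> T" "z \<in> Q"
    have "x \<otimes> z \<otimes> inv x = z"
      using Q(4)[OF xz(2,1)] xz Q(2) conj_eq_iff_commute[of x z] subgroup.mem_carrier[OF T(1)] by auto
    then show "x \<otimes> z \<otimes> inv x \<in> Q" using xz by simp
  qed
  interpret T: subgroup T G by fact
  interpret Q: subgroup Q G by fact
  define C where "C = S.section_group"
  note Ccar = S.section_carrier[folded C_def] and Cmult = S.section_mult[folded C_def]
    and Cpow = S.section_pow[folded C_def] and Cone = S.section_one[folded C_def]
  interpret C: comm_group C unfolding C_def by (rule S.section_comm_group)
  define \<phi> where "\<phi> x = b \<otimes> x \<otimes> inv b" for x
  have \<phi>T [simp]: "x \<in> T \<Longrightarrow> \<phi> x \<in> T" for x unfolding \<phi>_def using T(2) .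
  have \<phi>_mult: "\<phi> (x \<otimes> z) = \<phi> x \<otimes> \<phi> z" if "x \<in> T" "z \<in> T" for x z
    unfolding \<phi>_def using that bD by (simp add: m_assoc)
  have \<phi>Q: "\<phi> z = z" if "z \<in> Q" for z
    unfolding \<phi>_def using Q(3)[OF that] conj_eq_iff_commute[OF bD(2), of z] that by simp
  define B where "B = S.conj_coset b"
  have Bcos: "B (Q #> x) = Q #> \<phi> x" if "x \<in> T" for x
    unfolding B_def \<phi>_def
  proof (rule S.conj_coset_rcos[OF bD(2) _ _ that])
    show "b \<otimes> z \<otimes> inv b \<in> Q" if "z \<in> Q" for z using \<phi>Q[OF that] that unfolding \<phi>_def by simp
    show "inv b \<otimes> z \<otimes> b \<in> Q" if "z \<in> Q" for z
      using that bD(2) by (simp add: m_assoc flip: Q(3))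
  qed
  have Bhom: "B \<in> hom C C"
    by (rule homI) (auto simp: Ccar Bcos Cmult \<phi>_mult)
  have Bpow: "(B ^^ p) A = A" if A: "A \<in> carrier C" for A
  proof -
    obtain x where x: "x \<in> T" "A = Q #> x" using A unfolding Ccar by blast
    have \<phi>n: "(\<phi> ^^ n) x \<in> T" for n using x by (induction n) auto
    have "(B ^^ n) A = Q #> (\<phi> ^^ n) x" for n
      using Bcos[OF \<phi>n] x by (induction n) auto
    moreover have "(\<phi> ^^ p) x = x"
      using funpow_conj[OF bD(2), of x p] x bD(3) unfolding \<phi>_def by simp
    ultimately show ?thesis using x by simp
  qed
  have fixed: "B A = A" if A: "A \<in> carrier C" "B A = A [^]\<^bsub>C\<^esub> (k::nat)" for A k
  proof -
    obtain u where u: "u \<in> T" "A = Q #> u" using A unfolding Ccar by blast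
    have "Q #> \<phi> u = Q #> u [^] k" using A u by (simp add: Bcos Cpow)
    then obtain q where q: "q \<in> Q" "\<phi> u = q \<otimes> u [^] k"
      using S.coset_eq_iff[OF \<phi>T[OF u(1)] nat_pow_in_subgroup[OF T(1) u(1)]] by blast
    have uT: "u [^] (i::nat) \<in> T" for i using nat_pow_in_subgroup[OF T(1) u(1)] .
    \<comment> \<open>\<open>S\<close> is generated by \<open>Q\<close> and \<open>u\<close>. It is
      abelian because \<open>T\<close> centralises \<open>Q\<close>, and stable under
      \<open>b\<close> because \<open>u\<close> is an eigenvector modulo \<open>Q\<close>.\<close>
    define S where "S = {z \<otimes> u [^] (i::nat) | z i. z \<in> Q}"
    have SI: "z \<otimes> u [^] (i::nat) \<in> S" if "z \<in> Q" for z i using that unfolding S_def by blast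
    have comm: "(z \<otimes> u [^] i) \<otimes> (z' \<otimes> u [^] j) = (z \<otimes> z') \<otimes> u [^] (i + j)"
      if "z \<in> Q" "z' \<in> Q" for z z' and i j :: nat
    proof -
      have "(z \<otimes> u [^] i) \<otimes> (z' \<otimes> u [^] j) = z \<otimes> (u [^] i \<otimes> z') \<otimes> u [^] j"
        using that u by (simp add: m_assoc)
      also have "u [^] i \<otimes> z' = z' \<otimes> u [^] i" using Q(4)[OF that(2) uT] by simp
      finally show ?thesis using that u by (simp add: m_assoc flip: nat_pow_mult)
    qed
    have subS: "subgroup S G"
    proof (rule subgroupI)
      show "S \<subseteq> carrier G" unfolding S_def using u by auto
      show "S \<noteq> {}" using SI[OF Q.one_closed] by blast
      fix a assume "a \<in> S"
      then obtain z i where a: "z \<in> Q" "a = z \<otimes> u [^] (i::nat)" unfolding S_def by blast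
      have "ord u > 0" using ord_ge_1[OF finite_G, of u] u by simp
      then have "i + i * (ord u - 1) = ord u * i" by (cases "ord u") auto
      then have "u [^] (i + i * (ord u - 1)) = (u [^] ord u) [^] i"
        using u by (simp only: nat_pow_pow S.T_closed)
      then have one: "u [^] (i + i * (ord u - 1)) = \<one>" using u by simp
      have "(inv z \<otimes> u [^] (i * (ord u - 1))) \<otimes> a = \<one>"
        using comm[of "inv z" z "i * (ord u - 1)" i] a one by (simp add: add.commute)
      then have "inv a = inv z \<otimes> u [^] (i * (ord u - 1))"
        using a u by (intro inv_equality) auto
      then show "inv a \<in> S" using SI a by simp
      fix c assume "c \<in> S"
      then obtain z' j where c: "z' \<in> Q" "c = z' \<otimes> u [^] (j::nat)" unfolding S_def by blast
      show "a \<otimes> c \<in> S" using comm[OF a(1) c(1)] SI a c by simp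
    qed
    have "b \<otimes> u = u \<otimes> b"
    proof (rule commute_abelian_subgroup[OF b subS _ _ t(1,3,2)])
      show "m \<otimes> n = n \<otimes> m" if mn: "m \<in> S" "n \<in> S" for m n
      proof -
        obtain z i z' j where "z \<in> Q" "m = z \<otimes> u [^] (i::nat)" "z' \<in> Q" "n = z' \<otimes> u [^] (j::nat)"
          using mn unfolding S_def by blast
        then show ?thesis using Q(4)[of z z'] by (simp add: comm add.commute)
      qed
      show "m [^] (t ^ e) = \<one>" if m: "m \<in> S" for m
      proof -
        obtain z i where "z \<in> Q" "m = z \<otimes> u [^] (i::nat)" using m unfolding S_def by blast
        then have "m \<in> T" using uT by simp
        then show ?thesis using t(4) by simp
      qed
      show "b \<otimes> m \<otimes> inv b \<in> S" if m: "m \<in> S" for m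
      proof -
        obtain z i where zi: "z \<in> Q" "m = z \<otimes> u [^] (i::nat)" using m unfolding S_def by blast
        have "\<phi> (u [^] i) = \<phi> u [^] i" unfolding \<phi>_def using conj_pow[OF bD(2), of u i] u by simp
        also have "\<dots> = q [^] i \<otimes> u [^] (k * i)"
          unfolding q(2) using pow_mult_distrib[OF Q(4)[OF q(1) uT]] q(1) u by (simp add: nat_pow_pow)
        finally have "\<phi> m = (z \<otimes> q [^] i) \<otimes> u [^] (k * i)"
          using zi q u by (simp add: \<phi>_mult[OF _ uT] \<phi>Q m_assoc)
        then show ?thesis using SI zi q nat_pow_in_subgroup[OF Q(1)] unfolding \<phi>_def by simp
      qed
      show "u \<in> S" using SI[OF Q.one_closed, of 1] u by simp
    qed
    then show "B A = A" using u conj_eq_iff_commute[OF bD(2), of u] by (simp add: Bcos \<phi>_def)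
  qed
  have Cexp: "A [^]\<^bsub>C\<^esub> t = \<one>\<^bsub>C\<^esub>" if "A \<in> carrier C" for A
    using that Q(5) unfolding Ccar Cone by (auto simp: Cpow S.coset_Q)
  have "B (Q #> x) = Q #> x"
    by (rule C.automorphism_trivial_of_eigenvectors[OF t(1) Cexp bD(1) t(3)[symmetric] Bhom Bpow l fixed])
       (use x in \<open>auto simp: Ccar\<close>)
  then have "Q #> \<phi> x = Q #> x" using x by (simp add: Bcos)
  \<comment> \<open>\<open>b\<close> now fixes each coset of \<open>Q\<close>, so it multiplies
    \<open>x\<close> by some \<open>q\<close> that it centralises; coprimality of \<open>p\<close>
    and \<open>t\<close> forces \<open>q\<close> to be trivial.\<close>
  then obtain q where q: "q \<in> Q" "\<phi> x = q \<otimes> x" using S.coset_eq_iff[OF \<phi>T[OF x] x] by blast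
  have "b \<otimes> x \<otimes> inv b = x \<otimes> q" using q Q(4)[OF q(1) x] unfolding \<phi>_def by simp
  moreover have "coprime p (t ^ e)" using primes_coprime[OF bD(1) t(1)] t(3) by auto
  ultimately show ?thesis
    using commutator_eq_one[OF bD(2) _ _ _ Q(3)[OF q(1)] bD(3), of x "t ^ e"] q x t(4) by simp
qed

text \<open>Suppose there is no target, and let \<open>L\<close> be the normal closure of \<open>b\<close>, with center \<open>Z\<close>. A class two
  \<open>t\<close>-subgroup \<open>T \<subseteq> L\<close> not contained in \<open>Z\<close> is centralised by another prime part \<open>b'\<close> of \<open>y\<close>, whose order
  divides \<open>t - 1\<close>. Hence \<open>T\<close> has a single subgroup of order \<open>t\<close>, and it lies in \<open>Z\<close>. As \<open>x \<mapsto> x\<^sup>t\<close> is a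
  homomorphism from \<open>T\<close> to \<open>Z\<close>, it follows that \<open>b\<close> centralises \<open>T\<close>, a contradiction.\<close>

theorem ex_target: "\<exists>d. target d"
proof (rule ccontr)
  assume no: "\<nexists>d. target d"
  obtain p b where b: "prime_part p b" using ex_prime_part by blast
  note bD = prime_partD[OF b]
  define L where "L = generate G {g \<otimes> b \<otimes> inv g | g. g \<in> carrier G}"
  have gens: "{g \<otimes> b \<otimes> inv g | g. g \<in> carrier G} \<subseteq> carrier G" using bD by auto
  have normL: "L \<lhd> G" unfolding L_def
  proof (rule normal_generateI[OF gens])
    fix h g assume "h \<in> {g \<otimes> b \<otimes> inv g | g. g \<in> carrier G}" and g: "g \<in> carrier G"
    then obtain k where k: "k \<in> carrier G" "h = k \<otimes> b \<otimes> inv k" by blast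
    have "g \<otimes> h \<otimes> inv g = (g \<otimes> k) \<otimes> b \<otimes> inv (g \<otimes> k)"
      using k g bD by (simp add: m_assoc inv_mult_group)
    then show "g \<otimes> h \<otimes> inv g \<in> {g \<otimes> b \<otimes> inv g | g. g \<in> carrier G}" using g k by blast
  qed
  interpret L: normal L G by (rule normL)
  have Lc [simp]: "x \<in> L \<Longrightarrow> x \<in> carrier G" for x by simp
  have bL: "b \<in> L"
  proof -
    have "b = \<one> \<otimes> b \<otimes> inv \<one>" using bD by simp
    then show ?thesis unfolding L_def using one_closed by (blast intro: generate.incl)
  qed
  define Z where "Z = {z \<in> L. \<forall>x \<in> L. z \<otimes> x = x \<otimes> z}"
  have ZL [simp]: "z \<in> Z \<Longrightarrow> z \<in> L" for z unfolding Z_def by simp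
  have Zcomm: "z \<otimes> x = x \<otimes> z" if "z \<in> Z" "x \<in> L" for z x using that unfolding Z_def by blast
  have normZ: "Z \<lhd> G"
  proof (rule normal_invI)
    show "subgroup Z G"
    proof (rule subgroupI)
      show "Z \<subseteq> carrier G" by auto
      show "Z \<noteq> {}" unfolding Z_def by (auto intro!: exI[of _ \<one>])
      show "inv z \<in> Z" if z: "z \<in> Z" for z
        using z L.m_inv_closed commute_inv[OF Lc Lc] unfolding Z_def by blast
      show "z \<otimes> w \<in> Z" if "z \<in> Z" "w \<in> Z" for z w
        using that L.m_closed commute_mult[OF Lc Lc Lc] unfolding Z_def by blast
    qed
    fix g z assume gz: "g \<in> carrier G" "z \<in> Z"
    have "(g \<otimes> z \<otimes> inv g) \<otimes> x = x \<otimes> (g \<otimes> z \<otimes> inv g)" if x: "x \<in> L" for x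
    proof -
      have "inv g \<otimes> x \<otimes> g \<in> L" using L.inv_op_closed1[OF gz(1) x] .
      then have "g \<otimes> (z \<otimes> (inv g \<otimes> x \<otimes> g)) \<otimes> inv g = g \<otimes> ((inv g \<otimes> x \<otimes> g) \<otimes> z) \<otimes> inv g"
        using Zcomm[OF gz(2)] by simp
      then show ?thesis using gz x by (simp add: m_assoc)
    qed
    then show "g \<otimes> z \<otimes> inv g \<in> Z" using L.inv_op_closed2[OF gz(1)] gz(2) unfolding Z_def by simp
  qed
  interpret Z: normal Z G by (rule normZ)
  have torsion_normal: "{z \<in> Z. z [^] n = \<one>} \<lhd> G" for n :: nat
  proof (rule normal_invI)
    show "subgroup {z \<in> Z. z [^] n = \<one>} G"
    proof (rule subgroupI)
      show "{z \<in> Z. z [^] n = \<one>} \<noteq> {}" by (auto intro!: exI[of _ \<one>])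
      show "z \<otimes> w \<in> {z \<in> Z. z [^] n = \<one>}"
        if "z \<in> {z \<in> Z. z [^] n = \<one>}" "w \<in> {z \<in> Z. z [^] n = \<one>}" for z w
        using that pow_mult_distrib[OF Zcomm, of z w n] by simp
    qed (auto simp: nat_pow_inv)
  qed (auto simp: Z.inv_op_closed2 conj_pow)
  \<comment> \<open>Otherwise \<open>b\<close> lies in the \<open>p\<close>-torsion of
    \<open>Z\<close>, a nontrivial normal elementary abelian \<open>p\<close>-subgroup, and is a
    target.\<close>
  have notZ: "\<not> L \<subseteq> Z"
  proof
    assume "L \<subseteq> Z"
    then have bZ: "b \<in> {z \<in> Z. z [^] p = \<one>}" using bL bD by auto
    have "target b"
    proof (rule target_of_normal_subgroup[OF b torsion_normal[of p]])
      show "{z \<in> Z. z [^] p = \<one>} \<noteq> {\<one>}" using bZ bD(4) by blast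
    qed (use Zcomm in auto)
    then show False using no by blast
  qed
  \<comment> \<open>Commutators of \<open>N\<close> lie in the center of \<open>L\<close>, so
    \<open>N\<close> has class at most two.\<close>
  obtain N where N: "N \<lhd> G" "N \<subseteq> L" "\<not> N \<subseteq> Z" "derived G N \<subseteq> Z"
    using ex_derived_term[OF soluble normL _ notZ] Z.one_closed by blast
  interpret N: normal N G by (rule N(1))
  have NL [simp]: "x \<in> N \<Longrightarrow> x \<in> L" for x using N(2) by blast
  have class2: "\<exists>c \<in> Z. y \<otimes> x = x \<otimes> y \<otimes> c" if "x \<in> N" "y \<in> N" for x y
    using commutator_in_derived[OF that N.is_subgroup N(4)] .
  obtain x where x: "x \<in> N" "x \<notin> Z" using N(3) by blast
  obtain t e k where t: "prime (t::nat)" and x0: "x [^] (k::nat) \<notin> Z" "(x [^] k) [^] t \<in> Z" "(x [^] k) [^] (t ^ e) = \<one>"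
    using ex_prime_power_element[OF finite_G Z.is_subgroup, of x] x by auto
  \<comment> \<open>The summand 2 makes \<open>T\<close> closed under products even for
    \<open>t = 2\<close>: the commutator enters the power \<open>t ^ E\<close> with an exponent
    divisible by \<open>t\<close>.\<close>
  define E where "E = e + 2"
  define T where "T = {x \<in> N. x [^] t \<in> Z \<and> x [^] (t ^ E) = \<one>}"
  have TN [simp]: "x \<in> T \<Longrightarrow> x \<in> N" for x unfolding T_def by simp
  have x0T: "x [^] k \<in> T"
  proof -
    have "(x [^] k) [^] (t ^ E) = ((x [^] k) [^] (t ^ e)) [^] (t ^ 2)"
      unfolding E_def power_add by (rule nat_pow_pow[symmetric]) (use x in simp)
    then show ?thesis unfolding T_def using x0 nat_pow_in_subgroup[OF N.is_subgroup x(1)] by simp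
  qed
  have commutator: "\<exists>c \<in> Z. z \<otimes> x = x \<otimes> z \<otimes> c \<and> c [^] t = \<one>" if xz: "x \<in> T" "z \<in> T" for x z
  proof -
    obtain c where c: "c \<in> Z" "z \<otimes> x = x \<otimes> z \<otimes> c" using class2[of x z] xz by auto
    have zt: "z [^] t \<in> Z" using xz unfolding T_def by simp
    have "c [^] t = \<one>"
      using xz c Zcomm[OF c(1)] Zcomm[OF zt] by (intro class2_commutator_pow[of x z]) auto
    then show ?thesis using c by blast
  qed
  have tE: "t dvd t ^ E * (t ^ E - 1) div 2" by (rule prime_dvd_triangular[OF t]) (simp add: E_def)
  have pow_dvd: "c [^] n = \<one>" if "c \<in> carrier G" "c [^] t = \<one>" "t dvd n" for c and n :: nat
    using that by (metis dvd_def nat_pow_one nat_pow_pow)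
  have multT: "x \<otimes> z \<in> T \<and> (x \<otimes> z) [^] t = x [^] t \<otimes> z [^] t \<otimes> c [^] (t * (t - 1) div 2)"
    if xz: "x \<in> T" "z \<in> T" and c: "c \<in> Z" "z \<otimes> x = x \<otimes> z \<otimes> c" "c [^] t = \<one>" for x z c
  proof -
    have pw: "(x \<otimes> z) [^] n = x [^] n \<otimes> z [^] n \<otimes> c [^] (n * (n - 1) div 2)" for n :: nat
      using xz c Zcomm[OF c(1)] by (intro mult_pow_class2) auto
    have "(x \<otimes> z) [^] t \<in> Z"
      unfolding pw using xz c(1) nat_pow_in_subgroup[OF Z.is_subgroup] unfolding T_def by simp
    moreover have "(x \<otimes> z) [^] (t ^ E) = \<one>"
      unfolding pw using pow_dvd[OF _ c(3) tE] xz c(1) unfolding T_def by simp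
    ultimately show ?thesis using xz pw unfolding T_def by simp
  qed
  have normT: "T \<lhd> G"
  proof (rule normal_invI)
    show "subgroup T G"
    proof (rule subgroupI)
      show "T \<noteq> {}" using x0T by blast
      show "x \<otimes> z \<in> T" if "x \<in> T" "z \<in> T" for x z using commutator[OF that] multT[OF that] by blast
      show "T \<subseteq> carrier G" using TN NL Lc by blast
      show "inv x \<in> T" if "x \<in> T" for x using that unfolding T_def by (simp add: nat_pow_inv)
    qed
    show "g \<otimes> h \<otimes> inv g \<in> T" if "g \<in> carrier G" "h \<in> T" for g h
      using that unfolding T_def by (auto simp: conj_pow Z.inv_op_closed2 N.inv_op_closed2)
  qed
  interpret T: normal T G by (rule normT)
  \<comment> \<open>\<open>T\<close> is normal, so if \<open>b\<close> centralised it, all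
    conjugates of \<open>b\<close> would as well, and so would \<open>L\<close>. Then
    \<open>T\<close> would lie in \<open>Z\<close>, contrary to the choice of
    \<open>x [^] k\<close>.\<close>
  have notcent: "\<exists>x \<in> T. b \<otimes> x \<noteq> x \<otimes> b"
  proof (rule ccontr)
    assume "\<not> ?thesis"
    then have bT: "b \<otimes> x = x \<otimes> b" if "x \<in> T" for x using that by blast
    have "x \<in> Z" if x: "x \<in> T" for x
    proof -
      have "{g \<otimes> b \<otimes> inv g | g. g \<in> carrier G} \<subseteq> {l \<in> carrier G. l \<otimes> x = x \<otimes> l}"
      proof (intro subsetI CollectI)
        fix l assume "l \<in> {g \<otimes> b \<otimes> inv g | g. g \<in> carrier G}"
        then obtain g where g: "g \<in> carrier G" "l = g \<otimes> b \<otimes> inv g" by blast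
        have "inv g \<otimes> x \<otimes> g \<in> T" using T.inv_op_closed1[OF g(1) x] .
        then have "g \<otimes> (b \<otimes> (inv g \<otimes> x \<otimes> g)) \<otimes> inv g = g \<otimes> ((inv g \<otimes> x \<otimes> g) \<otimes> b) \<otimes> inv g"
          using bT by simp
        then show "l \<in> carrier G \<and> l \<otimes> x = x \<otimes> l" using g x bD by (simp add: m_assoc)
      qed
      then have "L \<subseteq> {l \<in> carrier G. l \<otimes> x = x \<otimes> l}"
        unfolding L_def using x by (intro generate_subgroup_incl subgroup_centralizer) auto
      then show ?thesis unfolding Z_def using x by auto
    qed
    then show False using x0T x0(1) by blast
  qed
  define M where "M = {z \<in> Z. z [^] t = \<one>}"
  have normM: "M \<lhd> G" unfolding M_def by (rule torsion_normal)
  have Mpow: "m [^] t = \<one>" if "m \<in> M" for m using that unfolding M_def by simp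
  have Mcomm: "m \<otimes> n = n \<otimes> m" if "m \<in> M" "n \<in> M" for m n
    using that Zcomm unfolding M_def by simp
  show False
  proof (cases "M = {\<one>}")
    \<comment> \<open>Without \<open>t\<close>-torsion in \<open>Z\<close>, both the
      \<open>t\<close>-th powers and the commutators of elements of \<open>T\<close> vanish. So
      \<open>T\<close> is elementary abelian and is centralised by \<open>b\<close>.\<close>
    case True
    have M1: "z = \<one>" if "z \<in> Z" "z [^] t = \<one>" for z using that True unfolding M_def by blast
    have Tt: "x [^] t = \<one>" if x: "x \<in> T" for x
    proof -
      have "(x [^] t) [^] (t ^ E) = (x [^] (t ^ E)) [^] t"
        using x by (simp add: nat_pow_pow mult.commute)
      then have "x [^] t \<in> Z" "(x [^] t) [^] (t ^ E) = \<one>" using x unfolding T_def by simp_all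
      then show ?thesis using prime_power_torsion_trivial[of Z t] M1 Z.is_subgroup by blast
    qed
    have Tcomm: "x \<otimes> z = z \<otimes> x" if xz: "x \<in> T" "z \<in> T" for x z
    proof -
      obtain c where c: "c \<in> Z" "z \<otimes> x = x \<otimes> z \<otimes> c" "c [^] t = \<one>" using commutator[OF xz] by blast
      then show ?thesis using M1[OF c(1,3)] xz by simp
    qed
    have "T \<noteq> {\<one>}" using x0T x0(1) Z.one_closed by auto
    then have "b \<otimes> x = x \<otimes> b" if "x \<in> T" for x
      by (intro normal_abelian_facts(3)[OF no t normT Tt Tcomm _ b that])
    then show False using notcent by blast
  next
    case False
    have tr: "t \<noteq> r" "\<not> t dvd ord y"
      by (rule normal_abelian_facts(1,2)[OF no t normM Mpow Mcomm False]; assumption)+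
    have Mcent: "b \<otimes> m = m \<otimes> b" if "prime_part p b" "m \<in> M" for p b m
      by (rule normal_abelian_facts(3)[OF no t normM Mpow Mcomm False that])
    obtain d p' b' l where d: "d \<in> M" "d \<noteq> \<one>" and b': "prime_part p' b'" "p' dvd t - 1"
      and l: "[l ^ p' = 1] (mod t)" "[l \<noteq> 1] (mod t)"
      using ex_generator_root_of_unity[OF no t normM _ _ False] Mpow Mcomm by blast
    note b'D = prime_partD[OF b'(1)]
    have tp: "t \<noteq> q" if "prime_part q a" for q a using prime_partD(6)[OF that] tr(2) by blast
    interpret ZT: normal "Z \<inter> T" G by (rule normal_subgroup_intersect[OF normZ normT])
    have ZTcent: "a \<otimes> z = z \<otimes> a" if a: "prime_part q a" and z: "z \<in> Z \<inter> T" for q a z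
    proof (rule commute_abelian_subgroup[OF a ZT.is_subgroup _ _ t tp[OF a] tr(1) _ z])
      show "a \<otimes> m \<otimes> inv a \<in> Z \<inter> T" if "m \<in> Z \<inter> T" for m
        using ZT.inv_op_closed2[OF prime_partD(2)[OF a] that] .
      show "m [^] (t ^ E) = \<one>" if "m \<in> Z \<inter> T" for m using that unfolding T_def by simp
    qed (use Zcomm in auto)
    \<comment> \<open>The eigenvector argument runs with \<open>b'\<close>, the prime part whose
      order is known to divide \<open>t - 1\<close>.\<close>
    have b'T: "b' \<otimes> x = x \<otimes> b'" if "x \<in> T" for x
    proof (rule commute_class2_subgroup[OF b'(1) T.is_subgroup _ ZT.is_subgroup _ ZTcent[OF b'(1)] _ _ _ t tr(1) tp[OF b'(1)] _ l that])
      show "b' \<otimes> x \<otimes> inv b' \<in> T" if "x \<in> T" for x using T.inv_op_closed2[OF b'D(2) that] .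
      show "x [^] t \<in> Z \<inter> T" if "x \<in> T" for x
        using that nat_pow_in_subgroup[OF T.is_subgroup that] unfolding T_def by simp
      show "\<exists>c \<in> Z \<inter> T. z \<otimes> x = x \<otimes> z \<otimes> c" if xz: "x \<in> T" "z \<in> T" for x z
      proof -
        obtain c where c: "c \<in> Z" "z \<otimes> x = x \<otimes> z \<otimes> c" using class2[of x z] xz by auto
        have "inv (x \<otimes> z) \<otimes> (z \<otimes> x) = c" unfolding c(2) using xz c(1) by simp
        then have "c \<in> T" using xz by (metis T.m_closed T.m_inv_closed)
        then show ?thesis using c by blast
      qed
      show "x [^] (t ^ E) = \<one>" if "x \<in> T" for x using that unfolding T_def by simp
      show "z \<otimes> x = x \<otimes> z" if "z \<in> Z \<inter> T" "x \<in> T" for z x using Zcomm[of z x] that by simp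
    qed simp
    have dZ: "d \<in> Z" "d [^] t = \<one>" using d(1) unfolding M_def by auto
    have bx: "b \<otimes> x = x \<otimes> b" if x: "x \<in> T" for x
    proof -
      define x' where "x' = b \<otimes> x \<otimes> inv b"
      have x': "x' \<in> T" "inv x \<in> T" unfolding x'_def using T.inv_op_closed2[OF bD(2) x] x by auto
      obtain c where c: "c \<in> Z" "x' \<otimes> inv x = inv x \<otimes> x' \<otimes> c" "c [^] t = \<one>"
        using commutator[OF x'(2,1)] by blast
      \<comment> \<open>\<open>w\<close> measures the failure of \<open>b\<close> to centralise
        \<open>x\<close>. Conjugation by \<open>b\<close> preserves the central element
        \<open>x [^] t\<close>, so \<open>x\<close> and \<open>x'\<close> have the same
        \<open>t\<close>-th power, and for odd \<open>t\<close> this gives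
        \<open>w [^] t = \<one>\<close>.\<close>
      define w where "w = inv x \<otimes> x'"
      have wT: "w \<in> T" unfolding w_def using x' by simp
      have xt: "x [^] t \<in> Z" using x unfolding T_def by simp
      have "x' [^] t = b \<otimes> x [^] t \<otimes> inv b" unfolding x'_def using conj_pow bD x by simp
      also have "\<dots> = x [^] t" using conj_eq_iff_commute[OF bD(2), of "x [^] t"] Zcomm[OF xt bL] x by simp
      finally have x't: "x' [^] t = x [^] t" .
      \<comment> \<open>The prime \<open>p'\<close> divides \<open>t - 1\<close>, which would be 1
        for \<open>t = 2\<close>.\<close>
      have "2 < t"
      proof -
        have "t \<noteq> 2"
        proof
          assume "t = 2"
          then show False using b'(2) b'D(1) by simp
        qed
        then show ?thesis using prime_ge_2_nat[OF t] by simp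
      qed
      then have "odd t" using t prime_odd_nat by blast
      then have "t * (t - 1) div 2 = t * ((t - 1) div 2)" by (intro div_mult_swap[symmetric]) simp
      then have "t dvd t * (t - 1) div 2" by simp
      then have "w [^] t = inv (x [^] t) \<otimes> x [^] t"
        using multT[OF x'(2,1) c] pow_dvd[OF _ c(3)] c(1) x x't unfolding w_def by (simp add: nat_pow_inv)
      then have wt: "w [^] t = \<one>" using x by simp
      \<comment> \<open>\<open>d\<close> and \<open>w\<close> commute, are killed by
        \<open>t\<close>, and lie in the centralizer of \<open>b'\<close>; so \<open>w\<close> is a
        power of \<open>d\<close>, and \<open>b\<close> centralises \<open>d\<close>.\<close>
      obtain i where i: "w = d [^] (i::nat)"
        using ex_pow_in_centralizer[OF b'(1), of d t w] dZ d(2) wT wt b'T[OF wT] Zcomm[OF dZ(1)]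
          Mcent[OF b'(1) d(1)] t by auto
      have "b \<otimes> w = w \<otimes> b" unfolding i using commute_pow_left[of d b i] Mcent[OF b d(1)] dZ bD by simp
      moreover have "b \<otimes> x \<otimes> inv b = x \<otimes> w" unfolding w_def x'_def using x bD by simp
      moreover have "coprime p t" using primes_coprime[OF bD(1) t] tp[OF b] by blast
      ultimately show ?thesis using commutator_eq_one[OF bD(2), of x w p t] bD(3) wt wT x by simp
    qed
    then show False using notcent by blast
  qed
qed

end

section \<open>Chief factors\<close>

context irreducible_action begin

definition ker :: "'a set" where
  "ker = {g \<in> carrier G. \<forall>v \<in> carrier V. act g v = v}"

lemma ker_normal: "ker \<lhd> G"
proof (rule normal_invI)
  show "subgroup ker G"
  proof (rule subgroupI)
    show "ker \<noteq> {}" unfolding ker_def by (auto intro!: exI[of _ \<one>])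
    show "inv a \<in> ker" if "a \<in> ker" for a
    proof -
      have "act (inv a) v = v" if "v \<in> carrier V" for v
      proof -
        have "a \<in> carrier G" using \<open>a \<in> ker\<close> unfolding ker_def by blast
        then have "act (inv a) (act a v) = v" using that by (simp add: act_mult[symmetric])
        moreover have "act a v = v" using \<open>a \<in> ker\<close> that unfolding ker_def by simp
        ultimately show ?thesis by (simp only:)
      qed
      then show ?thesis using that unfolding ker_def by simp
    qed
  qed (auto simp: ker_def act_mult)
  show "g \<otimes> h \<otimes> inv g \<in> ker" if "g \<in> carrier G" "h \<in> ker" for g h
  proof -
    have "act (g \<otimes> h \<otimes> inv g) v = v" if "v \<in> carrier V" for v
    proof -
      have "act (g \<otimes> h \<otimes> inv g) v = act g (act h (act (inv g) v))"
        using \<open>g \<in> carrier G\<close> \<open>h \<in> ker\<close> that unfolding ker_def by (simp add: act_mult)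
      also have "\<dots> = act g (act (inv g) v)" using \<open>g \<in> carrier G\<close> \<open>h \<in> ker\<close> that unfolding ker_def by simp
      finally show ?thesis using \<open>g \<in> carrier G\<close> that by (simp add: act_mult[symmetric])
    qed
    then show ?thesis using that unfolding ker_def by simp
  qed
qed

text \<open>Two representatives of a coset of \<open>ker\<close> differ by an element acting
  trivially, so the choice does not matter.\<close>

definition qact where
  "qact C v = act (SOME g. g \<in> C) v"

lemma qact_coset:
  assumes "g \<in> carrier G" "v \<in> carrier V"
  shows "qact (ker #> g) v = act g v"
proof -
  have "g \<in> ker #> g" using rcos_self[OF assms(1) normal_imp_subgroup[OF ker_normal]] .
  then have "(SOME h. h \<in> ker #> g) \<in> ker #> g" by (rule someI)
  then obtain k where "k \<in> ker" "(SOME h. h \<in> ker #> g) = k \<otimes> g" unfolding r_coset_def by blast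
  then show ?thesis using assms unfolding qact_def ker_def by (simp add: act_mult)
qed

lemma rcos_mult: "g \<in> carrier G \<Longrightarrow> h \<in> carrier G \<Longrightarrow> (ker #> g) \<otimes>\<^bsub>G Mod ker\<^esub> (ker #> h) = ker #> (g \<otimes> h)"
  using normal.rcos_sum[OF ker_normal] by simp

lemma rcos_pow: "g \<in> carrier G \<Longrightarrow> (ker #> g) [^]\<^bsub>G Mod ker\<^esub> (n::nat) = ker #> (g [^] n)"
  using normal.FactGroup_pow[OF ker_normal] by simp

lemma rcos_inv: "g \<in> carrier G \<Longrightarrow> inv\<^bsub>G Mod ker\<^esub> (ker #> g) = ker #> (inv g)"
  using normal.inv_FactGroup[OF ker_normal, of "ker #> g"] normal.rcos_inv[OF ker_normal, of g]
  by (simp add: carrier_FactGroup)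

lemma rcos_eq_ker_iff: "g \<in> carrier G \<Longrightarrow> ker #> g = ker \<longleftrightarrow> g \<in> ker"
  using coset_join2[OF _ normal_imp_subgroup[OF ker_normal]] rcos_self[OF _ normal_imp_subgroup[OF ker_normal]]
  by metis

lemma faithful_quotient: "faithful_irreducible_action (G Mod ker) V qact r"
proof -
  interpret K: normal ker G by (rule ker_normal)
  interpret Q: group "G Mod ker" by (rule K.factorgroup_is_group)
  show ?thesis
  proof
    show "finite (carrier (G Mod ker))" using finite_G by (simp add: carrier_FactGroup)
    fix C D assume "C \<in> carrier (G Mod ker)" "D \<in> carrier (G Mod ker)"
    then obtain g h where gh: "g \<in> carrier G" "C = ker #> g" "h \<in> carrier G" "D = ker #> h"
      unfolding carrier_FactGroup by blast
    show "qact (C \<otimes>\<^bsub>G Mod ker\<^esub> D) v = qact C (qact D v)" if "v \<in> carrier V" for v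
      unfolding gh using that gh by (simp only: rcos_mult qact_coset m_closed act_closed act_mult)
  next
    fix C assume "C \<in> carrier (G Mod ker)"
    then obtain g where g: "g \<in> carrier G" "C = ker #> g" unfolding carrier_FactGroup by blast
    show "qact C v \<in> carrier V" if "v \<in> carrier V" for v using that g by (simp add: qact_coset)
    show "qact C (v \<otimes>\<^bsub>V\<^esub> w) = qact C v \<otimes>\<^bsub>V\<^esub> qact C w" if "v \<in> carrier V" "w \<in> carrier V" for v w
      using that g by (simp add: qact_coset act_add)
    show "C = \<one>\<^bsub>G Mod ker\<^esub>" if triv: "\<And>v. v \<in> carrier V \<Longrightarrow> qact C v = v"
    proof -
      have "act g v = v" if "v \<in> carrier V" for v
        using triv[OF that] unfolding g(2) qact_coset[OF g(1) that] .
      then have "g \<in> ker" using g(1) unfolding ker_def by blast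
      then show ?thesis unfolding g(2) one_FactGroup using rcos_eq_ker_iff[OF g(1)] by blast
    qed
  next
    have "\<one>\<^bsub>G Mod ker\<^esub> = ker #> \<one>" using coset_mult_one[OF K.subset] by simp
    then show "qact \<one>\<^bsub>G Mod ker\<^esub> v = v" if "v \<in> carrier V" for v
      using qact_coset[OF one_closed that] that by simp
  next
    fix U assume U: "subgroup U V" "\<And>g u. g \<in> carrier (G Mod ker) \<Longrightarrow> u \<in> U \<Longrightarrow> qact g u \<in> U"
    show "U = {\<one>\<^bsub>V\<^esub>} \<or> U = carrier V"
    proof (rule irreducible[OF U(1)])
      fix g u assume "g \<in> carrier G" "u \<in> U"
      then show "act g u \<in> U"
        using U(2)[of "ker #> g" u] qact_coset[of g u] subgroup.mem_carrier[OF U(1)] by (simp add: carrier_FactGroup)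
    qed
  qed (use finite_V prime_r exponent_r nontrivial in auto)
qed

lemma fpf_quotient:
  assumes "g \<in> carrier G"
  shows "linear_action.fpf V qact (ker #> g) \<longleftrightarrow> fpf g"
proof -
  interpret F: faithful_irreducible_action "G Mod ker" V qact r by (rule faithful_quotient)
  show ?thesis unfolding F.fpf_def fpf_def using assms by (simp add: qact_coset)
qed

end

context group begin

text \<open>\<open>M\<close> is the \<open>s\<close>-torsion of the last nontrivial derived term of
  \<open>K\<close>, for a prime \<open>s\<close> dividing the order of one of its elements.\<close>

lemma ex_normal_abelian_exponent:
  assumes "finite (carrier G)" "solvable G" "K \<lhd> G" "K \<noteq> {\<one>}"
  shows "\<exists>M s. prime (s::nat) \<and> M \<lhd> G \<and> M \<subseteq> K \<and> M \<noteq> {\<one>} \<and> (\<forall>m \<in> M. m [^] s = \<one>) \<and>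
    (\<forall>m \<in> M. \<forall>n \<in> M. m \<otimes> n = n \<otimes> m)"
proof -
  have "\<not> K \<subseteq> {\<one>}" using assms(4) subgroup.one_closed[OF normal_imp_subgroup[OF assms(3)]] by blast
  then obtain N where N: "N \<lhd> G" "N \<subseteq> K" "\<not> N \<subseteq> {\<one>}" "derived G N \<subseteq> {\<one>}"
    using ex_derived_term[OF assms(2,3), of "{\<one>}"] by blast
  interpret N: normal N G by (rule N(1))
  have comm: "x \<otimes> z = z \<otimes> x" if "x \<in> N" "z \<in> N" for x z
  proof -
    have "z \<otimes> x = x \<otimes> z \<otimes> \<one>" using commutator_in_derived[OF that N.is_subgroup N(4)] by blast
    then show ?thesis using that by simp
  qed
  obtain x where x: "x \<in> N" "x \<noteq> \<one>" using N(3) by blast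
  obtain s n where s: "prime (s::nat)" "(x [^] (n::nat)) [^] s = \<one>" "x [^] n \<noteq> \<one>"
    using ex_pow_prime_ord[OF _ x(2) assms(1)] x(1) by auto
  define M where "M = {m \<in> N. m [^] s = \<one>}"
  have "M \<lhd> G"
  proof (rule normal_invI)
    show "subgroup M G"
    proof (rule subgroupI)
      show "M \<noteq> {}" unfolding M_def by (auto intro!: exI[of _ \<one>])
      show "z \<otimes> w \<in> M" if "z \<in> M" "w \<in> M" for z w
        using that pow_mult_distrib[OF comm, of z w s] unfolding M_def by simp
    qed (auto simp: M_def nat_pow_inv)
  qed (auto simp: M_def N.inv_op_closed2 conj_pow)
  moreover have "M \<noteq> {\<one>}"
    using s nat_pow_in_subgroup[OF N.is_subgroup x(1), of n] unfolding M_def by blast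
  ultimately show ?thesis using s(1) N(2) comm unfolding M_def by blast
qed

end

locale chief_factor = group +
  fixes W Z
  assumes fin: "finite (carrier G)" and W_normal: "W \<lhd> G" and Z_normal: "Z \<lhd> G"
    and ZW: "Z \<subset> W" and W_derived: "derived G W \<subseteq> Z"
    and chief: "\<And>U. U \<lhd> G \<Longrightarrow> Z \<subseteq> U \<Longrightarrow> U \<subseteq> W \<Longrightarrow> U = Z \<or> U = W"

sublocale chief_factor \<subseteq> abelian_section G W Z
proof (intro abelian_section.intro abelian_section_axioms.intro)
  show "group G" by (rule is_group)
  show "subgroup W G" "subgroup Z G" using W_normal Z_normal normal_imp_subgroup by blast+
  show "Z \<subseteq> W" using ZW by blast
  show "x \<otimes> z \<otimes> inv x \<in> Z" if "x \<in> W" "z \<in> Z" for x z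
    using that normal_invE[OF Z_normal] subgroup.mem_carrier[OF normal_imp_subgroup[OF W_normal]] by blast
  show "\<exists>c \<in> Z. z \<otimes> x = x \<otimes> z \<otimes> c" if "x \<in> W" "z \<in> W" for x z
    using commutator_in_derived[OF that normal_imp_subgroup[OF W_normal] W_derived] .
qed

context chief_factor begin

lemma conj_W: "g \<in> carrier G \<Longrightarrow> w \<in> W \<Longrightarrow> g \<otimes> w \<otimes> inv g \<in> W"
  using normal_invE[OF W_normal] by blast

lemma conj_coset_eq:
  assumes "g \<in> carrier G" "w \<in> W"
  shows "conj_coset g (Z #> w) = Z #> (g \<otimes> w \<otimes> inv g)"
  using assms normal_invE(2)[OF Z_normal] normal.inv_op_closed1[OF Z_normal]
  by (intro conj_coset_rcos) auto

lemma ex_irreducible_action: "\<exists>r. irreducible_action G section_group conj_coset r"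
proof -
  interpret V: comm_group section_group by (rule section_comm_group)
  obtain w where w: "w \<in> W" "w \<notin> Z" using ZW by blast
  then obtain r x where r: "prime (r::nat)" and x: "x \<in> W" "x \<notin> Z" "x [^] r \<in> Z"
    using ex_prime_power_element[OF fin Q_sub, of w] nat_pow_in_subgroup[OF T_sub w(1)] by (metis T_closed)
  \<comment> \<open>\<open>U\<close> is the preimage of the \<open>r\<close>-torsion of the section.
    It is normal and larger than \<open>Z\<close>, so it is all of \<open>W\<close>, which gives the
    section exponent \<open>r\<close>.\<close>
  define U where "U = {w \<in> W. w [^] r \<in> Z}"
  have U_iff: "w \<in> U \<longleftrightarrow> w \<in> W \<and> (Z #> w) [^]\<^bsub>section_group\<^esub> r = \<one>\<^bsub>section_group\<^esub>" for w
  proof (cases "w \<in> W")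
    case True
    then show ?thesis
      using coset_eq_Q_iff[OF nat_pow_in_subgroup[OF T_sub True]] unfolding U_def section_one by (simp add: section_pow)
  qed (simp add: U_def)
  have Uone: "\<one> \<in> U" unfolding U_def using subgroup.one_closed[OF T_sub] subgroup.one_closed[OF Q_sub] by simp
  have "U \<lhd> G"
  proof (rule normal_invI)
    show "subgroup U G"
    proof (rule subgroupI)
      show "U \<subseteq> carrier G" unfolding U_def by auto
      show "U \<noteq> {}" using Uone by blast
      show "inv a \<in> U" if "a \<in> U" for a
        using that subgroup.m_inv_closed[OF T_sub] subgroup.m_inv_closed[OF Q_sub] unfolding U_def
        by (simp add: nat_pow_inv)
      show "a \<otimes> b \<in> U" if "a \<in> U" "b \<in> U" for a b
      proof -
        have ab: "a \<in> W" "b \<in> W" using that unfolding U_def by auto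
        then have "(Z #> (a \<otimes> b)) [^]\<^bsub>section_group\<^esub> r = (Z #> a) [^]\<^bsub>section_group\<^esub> r \<otimes>\<^bsub>section_group\<^esub> (Z #> b) [^]\<^bsub>section_group\<^esub> r"
          using V.nat_pow_distrib[of "Z #> a" "Z #> b" r] by (simp add: section_mult section_carrier)
        then show ?thesis using that ab subgroup.m_closed[OF T_sub] unfolding U_iff by simp
      qed
    qed
    show "g \<otimes> h \<otimes> inv g \<in> U" if "g \<in> carrier G" "h \<in> U" for g h
      using that conj_W conj_pow normal_invE(2)[OF Z_normal] unfolding U_def by auto
  qed
  moreover have "Z \<subseteq> U" unfolding U_def using nat_pow_in_subgroup[OF Q_sub] by auto
  moreover have "U \<subseteq> W" unfolding U_def by auto
  moreover have "U \<noteq> Z" using x unfolding U_def by blast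
  ultimately have UW: "U = W" using chief by blast
  have "irreducible_action G section_group conj_coset r"
  proof
    show "finite (carrier G)" by (rule fin)
    then show "finite (carrier section_group)"
      unfolding section_carrier using T_closed by (metis finite_imageI finite_subset subsetI)
    show "prime r" by (rule r)
    show "v [^]\<^bsub>section_group\<^esub> r = \<one>\<^bsub>section_group\<^esub>" if "v \<in> carrier section_group" for v
      using that UW U_iff unfolding section_carrier by auto
    show "carrier section_group \<noteq> {\<one>\<^bsub>section_group\<^esub>}"
      using w coset_eq_Q_iff[of w] unfolding section_carrier section_one by blast
    fix g assume g: "g \<in> carrier G"
    show "conj_coset g v \<in> carrier section_group" if "v \<in> carrier section_group" for v
      using that g conj_W unfolding section_carrier by (auto simp: conj_coset_eq)
    show "conj_coset g (v \<otimes>\<^bsub>section_group\<^esub> w) = conj_coset g v \<otimes>\<^bsub>section_group\<^esub> conj_coset g w"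
      if vw: "v \<in> carrier section_group" "w \<in> carrier section_group" for v w
    proof -
      obtain a b where ab: "a \<in> W" "v = Z #> a" "b \<in> W" "w = Z #> b" using vw unfolding section_carrier by blast
      have "g \<otimes> (a \<otimes> b) \<otimes> inv g = (g \<otimes> a \<otimes> inv g) \<otimes> (g \<otimes> b \<otimes> inv g)" using ab g by (simp add: m_assoc)
      then show ?thesis using ab g subgroup.m_closed[OF T_sub] by (simp add: section_mult conj_coset_eq conj_W)
    qed
    fix h assume h: "h \<in> carrier G"
    show "conj_coset (g \<otimes> h) v = conj_coset g (conj_coset h v)" if v: "v \<in> carrier section_group" for v
    proof -
      obtain a where a: "a \<in> W" "v = Z #> a" using v unfolding section_carrier by blast
      have "(g \<otimes> h) \<otimes> a \<otimes> inv (g \<otimes> h) = g \<otimes> (h \<otimes> a \<otimes> inv h) \<otimes> inv g"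
        using a g h by (simp add: m_assoc inv_mult_group)
      then show ?thesis using a g h by (simp add: conj_coset_eq conj_W)
    qed
  next
    show "conj_coset \<one> v = v" if "v \<in> carrier section_group" for v
      using that unfolding section_carrier by (auto simp: conj_coset_eq)
  next
    fix U assume U: "subgroup U section_group"
      "\<And>g u. g \<in> carrier G \<Longrightarrow> u \<in> U \<Longrightarrow> conj_coset g u \<in> U"
    define U' where "U' = {w \<in> W. Z #> w \<in> U}"
    have UU': "U = (\<lambda>w. Z #> w) ` U'"
      using subgroup.subset[OF U(1)] unfolding U'_def section_carrier by auto
    have "U' \<lhd> G"
    proof (rule normal_invI)
      show "subgroup U' G"
      proof (rule subgroupI)
        show "U' \<subseteq> carrier G" unfolding U'_def by auto
        show "U' \<noteq> {}" using UU' subgroup.one_closed[OF U(1)] by blast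
        show ab: "a \<otimes> b \<in> U'" if "a \<in> U'" "b \<in> U'" for a b
          using that subgroup.m_closed[OF U(1), of "Z #> a" "Z #> b"] subgroup.m_closed[OF T_sub] unfolding U'_def
          by (simp add: section_mult)
        show "inv a \<in> U'" if "a \<in> U'" for a
        proof -
          have a: "a \<in> W" "Z #> a \<in> U" using that unfolding U'_def by auto
          have ia: "inv a \<in> W" using subgroup.m_inv_closed[OF T_sub a(1)] .
          have "(Z #> inv a) \<otimes>\<^bsub>section_group\<^esub> (Z #> a) = \<one>\<^bsub>section_group\<^esub>"
            using a ia coset_Q[OF subgroup.one_closed[OF Q_sub]] by (simp add: section_mult section_one)
          then have "inv\<^bsub>section_group\<^esub> (Z #> a) = Z #> inv a"
            using a ia by (intro V.inv_equality) (auto simp: section_carrier)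
          then show ?thesis using subgroup.m_inv_closed[OF U(1) a(2)] ia unfolding U'_def by simp
        qed
      qed
      show "g \<otimes> h \<otimes> inv g \<in> U'" if "g \<in> carrier G" "h \<in> U'" for g h
        using that U(2)[of g "Z #> h"] conj_W unfolding U'_def by (simp add: conj_coset_eq)
    qed
    moreover have "Z \<subseteq> U'"
      unfolding U'_def using coset_Q subgroup.one_closed[OF U(1)] section_one by auto
    moreover have "U' \<subseteq> W" unfolding U'_def by auto
    ultimately have "U' = Z \<or> U' = W" using chief by blast
    then show "U = {\<one>\<^bsub>section_group\<^esub>} \<or> U = carrier section_group"
    proof
      assume "U' = Z"
      then have "U = {Z}" unfolding UU' using coset_Q subgroup.one_closed[OF Q_sub] by auto
      then show ?thesis by (simp add: section_one)
    qed (simp add: UU' section_carrier)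
  qed
  then show ?thesis by blast
qed

end

text \<open>\<open>Z\<close> is chosen maximal among the proper normal subgroups containing the
  derived subgroup of \<open>W\<close>. Solubility makes the derived subgroup itself such a
  subgroup.\<close>

lemma (in group) ex_chief_factor:
  assumes "finite (carrier G)" "solvable G" "W \<lhd> G" "W \<noteq> {\<one>}"
  shows "\<exists>Z. chief_factor G W Z"
proof -
  note subW = normal_imp_subgroup[OF assms(3)]
  have finW: "finite W" using subgroup.subset[OF subW] assms(1) finite_subset by blast
  define S where "S = {Z. Z \<lhd> G \<and> derived G W \<subseteq> Z \<and> Z \<subset> W}"
  have "derived G W \<in> S" unfolding S_def
    using derived_is_normal[OF assms(3)] derived_proper[OF assms(2) subW assms(4)] derived_incl[OF order_refl subW]
    by blast
  moreover have finS: "finite S" unfolding S_def using finW by (auto intro: finite_subset[of _ "Pow W"])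
  ultimately obtain Z where Z: "Z \<in> S" "\<And>U. U \<in> S \<Longrightarrow> Z \<subseteq> U \<Longrightarrow> U = Z"
    using finite_has_maximal[of S] by blast
  have "chief_factor G W Z"
  proof (intro chief_factor.intro chief_factor_axioms.intro)
    fix U assume "U \<lhd> G" "Z \<subseteq> U" "U \<subseteq> W"
    then show "U = Z \<or> U = W" using Z unfolding S_def by blast
  qed (use assms Z in \<open>auto simp: S_def\<close>)
  then show ?thesis by blast
qed

section \<open>Paths in the Engel graph\<close>

context group begin

definition engel_edge :: "'a \<Rightarrow> 'a \<Rightarrow> bool" where
  "engel_edge x y \<longleftrightarrow> (\<exists>n > 0. engel_commutator G x n y = \<one>)"

lemma commutator_closed [simp]: "x \<in> carrier G \<Longrightarrow> y \<in> carrier G \<Longrightarrow> commutator G x y \<in> carrier G"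
  unfolding commutator_def by simp

lemma engel_commutator_closed [simp]:
  "x \<in> carrier G \<Longrightarrow> y \<in> carrier G \<Longrightarrow> engel_commutator G x n y \<in> carrier G"
  by (induction n) auto

lemma engel_commutator_add:
  "engel_commutator G x (m + n) y = engel_commutator G (engel_commutator G x m y) n y"
  by (induction n) auto

lemma engel_commutator_Suc_left:
  "engel_commutator G x (Suc n) y = engel_commutator G (commutator G x y) n y"
  using engel_commutator_add[of x 1 n y] by simp

lemma commutator_eq_one_iff:
  assumes "x \<in> carrier G" "y \<in> carrier G"
  shows "commutator G x y = \<one> \<longleftrightarrow> x \<otimes> y = y \<otimes> x"
proof -
  have "y \<otimes> x \<otimes> commutator G x y = x \<otimes> y"
    unfolding commutator_def using assms by (simp add: m_assoc)
  then show ?thesis using assms by (metis commutator_closed l_cancel_one m_closed)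
qed

lemma engel_commutator_one: "y \<in> carrier G \<Longrightarrow> engel_commutator G \<one> n y = \<one>"
  by (induction n) (simp_all add: commutator_eq_one_iff)

lemma engel_edge_commute:
  assumes "x \<in> carrier G" "y \<in> carrier G" "x \<otimes> y = y \<otimes> x"
  shows "engel_edge x y"
  unfolding engel_edge_def using assms by (intro exI[of _ 1]) (simp add: commutator_eq_one_iff)

lemma engel_edge_of_commutator:
  assumes "x \<in> carrier G" "y \<in> carrier G" "commutator G x y \<otimes> y = y \<otimes> commutator G x y"
  shows "engel_edge x y"
  unfolding engel_edge_def using assms by (intro exI[of _ 2]) (simp add: commutator_eq_one_iff numeral_2_eq_2)

text \<open>The commutator is a product of \<open>y\<close> and the inverse of a power of
  \<open>y\<close>, hence commutes with \<open>y\<close>. So everything normalising the group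
  generated by \<open>y\<close> has an edge to \<open>y\<close>.\<close>

lemma engel_edge_of_conj_pow:
  assumes "x \<in> carrier G" "y \<in> carrier G" "inv x \<otimes> y \<otimes> x = y [^] (i::nat)"
  shows "engel_edge x y"
proof (rule engel_edge_of_commutator[OF assms(1,2)])
  have "commutator G x y = inv (inv x \<otimes> y \<otimes> x) \<otimes> y"
    unfolding commutator_def using assms(1,2) by (simp add: m_assoc inv_mult_group)
  then have eq: "commutator G x y = inv (y [^] i) \<otimes> y" using assms by simp
  show "commutator G x y \<otimes> y = y \<otimes> commutator G x y" unfolding eq
    using assms commute_inv[of "y [^] i" y] commute_pow_left[of y y i] by (intro commute_mult) auto
qed

lemma commutator_in_normal_right: "N \<lhd> G \<Longrightarrow> x \<in> carrier G \<Longrightarrow> y \<in> N \<Longrightarrow> commutator G x y \<in> N"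
proof -
  assume N: "N \<lhd> G" and x: "x \<in> carrier G" and y: "y \<in> N"
  interpret N: normal N G by fact
  have "inv x \<otimes> inv y \<otimes> x \<in> N" using N.inv_op_closed1 x y by simp
  then show ?thesis unfolding commutator_def using y by simp
qed

end

text \<open>A subgroup \<open>K\<close> with an automorphism \<open>d\<close> of prime order without fixed points centralises every
  chief factor below it: a minimal normal subgroup of the image of \<open>K\<close> would form a
  Frobenius group with \<open>d\<close>.\<close>

lemma (in chief_factor) fpf_centralizes:
  assumes "solvable G" and K: "K \<lhd> G" "W \<subseteq> K"
    and d: "d \<in> carrier G" "d [^] q = \<one>" "prime (q::nat)" "\<not> q dvd card K"
    and fp: "\<And>k. k \<in> K \<Longrightarrow> d \<otimes> k = k \<otimes> d \<Longrightarrow> k = \<one>"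
    and k: "k \<in> K" and w: "w \<in> W"
  shows "Z #> (k \<otimes> w \<otimes> inv k) = Z #> w"
proof -
  obtain r where irr: "irreducible_action G section_group conj_coset r" using ex_irreducible_action by blast
  interpret A: irreducible_action G section_group conj_coset r by (rule irr)
  let ?X = "G Mod A.ker"
  interpret F: faithful_irreducible_action ?X section_group A.qact r by (rule A.faithful_quotient)
  interpret K: normal K G by (rule K(1))
  interpret ker: normal A.ker G by (rule A.ker_normal)
  have Kc [simp]: "k \<in> K \<Longrightarrow> k \<in> carrier G" for k by simp
  have dvd_sub: "\<not> q dvd card H" if "subgroup H G" "H \<subseteq> K" for H
  proof -
    have "subgroup H (G\<lparr>carrier := K\<rparr>)" using subgroup_incl[OF that(1) K.is_subgroup that(2)] .
    then have "card H dvd card K"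
      using group.lagrange[OF subgroup_imp_group[OF K.is_subgroup], of H] by (simp add: order_def) (metis dvd_triv_right)
    then show ?thesis using d(4) dvd_trans by blast
  qed
  have lift: "\<exists>x \<in> H. d \<otimes> (x \<otimes> a) = (x \<otimes> a) \<otimes> d"
    if H: "H \<lhd> G" "H \<subseteq> K" and a: "a \<in> carrier G" "H #> (d \<otimes> a \<otimes> inv d) = H #> a" for H a
    using ex_commuting_in_coset[OF fin H(1) dvd_sub[OF normal_imp_subgroup[OF H(1)] H(2)] d(1-3) a] .
  \<comment> \<open>A coset fixed by \<open>d\<close> would contain an element commuting with
    \<open>d\<close>, which is trivial because it lies in \<open>K\<close>.\<close>
  have d_fpf: "A.fpf d"
    unfolding A.fpf_def
  proof (intro ballI impI)
    fix v assume "v \<in> carrier section_group" and fixed: "conj_coset d v = v"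
    then obtain a where a: "a \<in> W" "v = Z #> a" unfolding section_carrier by blast
    have "Z \<subseteq> K" using ZW K(2) by blast
    moreover have "Z #> (d \<otimes> a \<otimes> inv d) = Z #> a" using fixed a d by (simp add: conj_coset_eq)
    ultimately obtain z where z: "z \<in> Z" "d \<otimes> (z \<otimes> a) = (z \<otimes> a) \<otimes> d"
      using lift[OF Z_normal, of a] a by auto
    have "z \<otimes> a \<in> K" using z a ZW K(2) by (meson K.m_closed psubsetD subsetD)
    then have "z \<otimes> a = \<one>" using fp z by blast
    then have "Z #> a = Z #> \<one>" using coset_left[OF z(1) a(1)] by simp
    then show "v = \<one>\<^bsub>section_group\<^esub>"
      using a coset_Q[OF subgroup.one_closed[OF Q_sub]] by (simp add: section_one)
  qed
  define D where "D = A.ker #> d"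
  define Kb where "Kb = (\<lambda>k. A.ker #> k) ` K"
  have Dc: "D \<in> carrier ?X" unfolding D_def using d by (simp add: carrier_FactGroup)
  have hom: "(\<lambda>g. A.ker #> g) \<in> hom G ?X" using ker.r_coset_hom_Mod .
  interpret h: group_hom G ?X "\<lambda>g. A.ker #> g" using hom by unfold_locales
  have surj: "(\<lambda>g. A.ker #> g) ` carrier G = carrier ?X" by (simp add: carrier_FactGroup)
  have solX: "solvable ?X" using h.surj_hom_imp_solvable[OF surj assms(1)] .
  have Kb_normal: "Kb \<lhd> ?X"
  proof (rule F.normal_invI)
    show "subgroup Kb ?X" unfolding Kb_def by (rule h.subgroup_img_is_subgroup[OF K.is_subgroup])
    fix B H assume "B \<in> carrier ?X" "H \<in> Kb"
    then obtain g k where gk: "g \<in> carrier G" "B = A.ker #> g" "k \<in> K" "H = A.ker #> k"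
      unfolding Kb_def carrier_FactGroup by blast
    then have "B \<otimes>\<^bsub>?X\<^esub> H \<otimes>\<^bsub>?X\<^esub> inv\<^bsub>?X\<^esub> B = A.ker #> (g \<otimes> k \<otimes> inv g)"
      by (simp only: A.rcos_inv A.rcos_mult m_closed inv_closed Kc)
    then show "B \<otimes>\<^bsub>?X\<^esub> H \<otimes>\<^bsub>?X\<^esub> inv\<^bsub>?X\<^esub> B \<in> Kb"
      unfolding Kb_def using K.inv_op_closed2[OF gk(1,3)] by blast
  qed
  have "Kb = {\<one>\<^bsub>?X\<^esub>}"
  proof (rule ccontr)
    assume "Kb \<noteq> {\<one>\<^bsub>?X\<^esub>}"
    then obtain M s where s: "prime (s::nat)" and M: "M \<lhd> ?X" "M \<subseteq> Kb" "M \<noteq> {\<one>\<^bsub>?X\<^esub>}"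
      "\<forall>m \<in> M. m [^]\<^bsub>?X\<^esub> s = \<one>\<^bsub>?X\<^esub>" "\<forall>m \<in> M. \<forall>n \<in> M. m \<otimes>\<^bsub>?X\<^esub> n = n \<otimes>\<^bsub>?X\<^esub> m"
      using F.ex_normal_abelian_exponent[OF F.finite_G solX Kb_normal] by blast
    interpret M: normal M ?X by (rule M(1))
    have sr: "s \<noteq> r" using F.normal_exponent_r_trivial[OF M(1)] M(3-5) by blast
    interpret XM: group "?X\<lparr>carrier := M\<rparr>" by (rule M.subgroup_is_group[OF F.is_group])
    have finM: "finite M" using F.finite_G M.subset finite_subset by blast
    have rM: "\<not> r dvd card M"
    proof -
      have "\<not> r dvd s" using s sr F.prime_r primes_dvd_imp_eq by blast
      then have "\<not> r dvd card (carrier (?X\<lparr>carrier := M\<rparr>))"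
        using M(4) finM by (intro XM.prime_not_dvd_card_exponent[OF _ F.prime_r]) (auto simp flip: F.nat_pow_consistent)
      then show ?thesis by simp
    qed
    have "A.qact m v = v" if "m \<in> M" "v \<in> carrier section_group" for m v
    proof (rule F.trivial_of_frobenius[OF Dc _ d(3) _ M.is_subgroup M.inv_op_closed2[OF Dc] _ F.prime_r F.exponent_r rM that])
      show "D [^]\<^bsub>?X\<^esub> q = \<one>\<^bsub>?X\<^esub>"
        unfolding D_def using d(1,2) coset_mult_one[OF ker.subset] by (simp only: A.rcos_pow one_FactGroup)
      show "F.fpf D" unfolding D_def using A.fpf_quotient[OF d(1)] d_fpf by simp
      fix m assume m: "m \<in> M" "D \<otimes>\<^bsub>?X\<^esub> m = m \<otimes>\<^bsub>?X\<^esub> D"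
      then obtain a where a: "a \<in> K" "m = A.ker #> a" using M(2) unfolding Kb_def by blast
      \<comment> \<open>Lifting a commuting coset needs a kernel of order prime to \<open>q\<close>.
        This is known below \<open>K\<close> only, so the kernel of the action is intersected with
        \<open>K\<close>.\<close>
      let ?H = "A.ker \<inter> K"
      have H: "?H \<lhd> G" by (rule normal_subgroup_intersect[OF A.ker_normal K(1)])
      have "A.ker #> (d \<otimes> a) = A.ker #> (a \<otimes> d)"
        using m(2) a d(1) unfolding D_def by (simp only: A.rcos_mult Kc)
      then have "d \<otimes> a \<in> A.ker #> (a \<otimes> d)"
        using rcos_self[of "d \<otimes> a" A.ker] ker.is_subgroup d(1) a by simp
      then obtain c where c: "c \<in> A.ker" "d \<otimes> a = c \<otimes> (a \<otimes> d)" unfolding r_coset_def by blast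
      then have ca: "d \<otimes> a \<otimes> inv d = c \<otimes> a" using a d(1) by (simp add: m_assoc)
      have "c = (d \<otimes> a \<otimes> inv d) \<otimes> inv a" unfolding ca using c(1) a by (simp add: m_assoc)
      moreover have "\<dots> \<in> K" using K.inv_op_closed2[OF d(1) a(1)] a by simp
      ultimately have cH: "c \<in> ?H" using c(1) by simp
      have "?H #> (c \<otimes> a) = ?H #> a"
        using coset_join2[OF _ normal_imp_subgroup[OF H] cH] cH a
        by (metis Int_iff Kc coset_mult_assoc K.subset ker.subset le_infI2)
      then have "?H #> (d \<otimes> a \<otimes> inv d) = ?H #> a" unfolding ca .
      then obtain x where x: "x \<in> ?H" "d \<otimes> (x \<otimes> a) = (x \<otimes> a) \<otimes> d"
        using lift[OF H Int_lower2 Kc[OF a(1)]] by blast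
      then have "x \<otimes> a = \<one>" using fp[of "x \<otimes> a"] a by simp
      then have "A.ker #> (x \<otimes> a) = A.ker" using coset_mult_one[OF ker.subset] by simp
      moreover have "A.ker #> (x \<otimes> a) = A.ker #> a"
        using x(1) a coset_mult_assoc[OF ker.subset, of x a] coset_join2[OF _ ker.is_subgroup, of x] by simp
      ultimately show "m = \<one>\<^bsub>?X\<^esub>" using a by simp
    qed
    then have "m = \<one>\<^bsub>?X\<^esub>" if "m \<in> M" for m using that F.faithful[of m] by simp
    then show False using M(3) M.one_closed by blast
  qed
  then have "A.ker #> k = A.ker" using k unfolding Kb_def by auto
  then have "k \<in> A.ker" using A.rcos_eq_ker_iff k by simp
  then have "conj_coset k (Z #> w) = Z #> w"
    using w unfolding A.ker_def section_carrier by blast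
  then show ?thesis using conj_coset_eq[of k w] k w by simp
qed

context group begin

text \<open>The first commutator lands in \<open>K\<close>. From there each further commutator with
  \<open>k\<close> drops from \<open>W\<close> into the next normal subgroup \<open>Z\<close>,
  because \<open>k\<close> centralises \<open>W\<close> modulo \<open>Z\<close>; the induction on
  \<open>card W\<close> ends at the identity.\<close>

lemma engel_of_fpf:
  assumes "finite (carrier G)" "solvable G" and K: "K \<lhd> G"
    and d: "d \<in> carrier G" "d [^] q = \<one>" "prime (q::nat)" "\<not> q dvd card K"
    and fp: "\<And>k. k \<in> K \<Longrightarrow> d \<otimes> k = k \<otimes> d \<Longrightarrow> k = \<one>"
    and x: "x \<in> carrier G" and k: "k \<in> K"
  shows "engel_edge x k"
proof -
  interpret K: normal K G by (rule K)
  have "\<exists>n. engel_commutator G w n k = \<one>" if "W \<lhd> G" "W \<subseteq> K" "w \<in> W" for W w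
    using that
  proof (induction "card W" arbitrary: W w rule: less_induct)
    case less
    show ?case
    proof (cases "W = {\<one>}")
      case True
      then show ?thesis using less.prems by (intro exI[of _ 0]) simp
    next
      case False
      obtain Z where "chief_factor G W Z" using ex_chief_factor[OF assms(1,2) less.prems(1) False] by blast
      then interpret C: chief_factor G W Z .
      interpret Z: normal Z G by (rule C.Z_normal)
      have w: "w \<in> carrier G" using less.prems K.subset by blast
      have "Z #> (inv k \<otimes> w \<otimes> inv (inv k)) = Z #> w"
        by (rule C.fpf_centralizes[OF assms(2) K less.prems(2) d _ _ less.prems(3)])
          (blast intro: fp, use k in simp)
      moreover have "inv k \<otimes> w \<otimes> inv (inv k) \<in> W" using C.conj_W[of "inv k" w] k less.prems(3) by simp
      ultimately have "\<exists>z \<in> Z. inv k \<otimes> w \<otimes> inv (inv k) = z \<otimes> w"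
        using C.coset_eq_iff less.prems(3) by blast
      then obtain z where z: "z \<in> Z" "inv k \<otimes> w \<otimes> k = z \<otimes> w" using k by auto
      have "commutator G w k = inv w \<otimes> (inv k \<otimes> w \<otimes> k)"
        unfolding commutator_def using w k by (simp add: m_assoc)
      also have "\<dots> = inv w \<otimes> z \<otimes> w" unfolding z(2) using w z(1) by (simp add: m_assoc)
      also have "\<dots> \<in> Z" using Z.inv_op_closed1[OF w z(1)] .
      finally have "commutator G w k \<in> Z" .
      moreover have "Z \<subseteq> K" using C.ZW less.prems(2) by blast
      moreover have "card Z < card W"
        using C.ZW assms(1) less.prems(2) K.subset by (meson finite_subset psubset_card_mono)
      ultimately have "\<exists>n. engel_commutator G (commutator G w k) n k = \<one>"
        by (intro less.hyps[OF _ C.Z_normal])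
      then obtain n where "engel_commutator G (commutator G w k) n k = \<one>" ..
      then show ?thesis by (metis engel_commutator_Suc_left)
    qed
  qed
  from this[OF K order_refl commutator_in_normal_right[OF K x k]]
  obtain n where "engel_commutator G (commutator G x k) n k = \<one>" by blast
  then have "engel_commutator G x (Suc n) k = \<one>" by (simp only: engel_commutator_Suc_left)
  then show ?thesis unfolding engel_edge_def by blast
qed

end

section \<open>A path of length four, or a Frobenius complement\<close>

context group begin

lemma ex_minimal_normal_chief_factor:
  assumes "finite (carrier G)" "solvable G" "carrier G \<noteq> {\<one>}"
  shows "\<exists>A. chief_factor G A {\<one>}"
proof -
  define S where "S = {A. A \<lhd> G \<and> A \<noteq> {\<one>}}"
  have "carrier G \<in> S" unfolding S_def using normal_self assms(3) by blast
  moreover have "finite S"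
  proof (rule finite_subset)
    show "S \<subseteq> Pow (carrier G)" unfolding S_def using normal_imp_subgroup subgroup.subset by blast
  qed (use assms(1) in simp)
  ultimately obtain A where A: "A \<in> S" "\<And>U. U \<in> S \<Longrightarrow> U \<subseteq> A \<Longrightarrow> U = A"
    using finite_has_minimal[of S] by blast
  have subA: "subgroup A G" using A(1) normal_imp_subgroup unfolding S_def by blast
  have nA: "A \<lhd> G" "A \<noteq> {\<one>}" using A(1) unfolding S_def by auto
  have dA: "derived G A \<subseteq> A" using derived_incl[OF order_refl subA] .
  have "derived G A = {\<one>}"
    using A(2)[of "derived G A"] dA derived_is_normal[OF nA(1)] derived_proper[OF assms(2) subA nA(2)]
    unfolding S_def by blast
  then have "chief_factor G A {\<one>}"
  proof (intro chief_factor.intro chief_factor_axioms.intro)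
    fix U assume "U \<lhd> G" "{\<one>} \<subseteq> U" "U \<subseteq> A"
    then show "U = {\<one>} \<or> U = A" using A(2) unfolding S_def by blast
  qed (use assms nA one_is_normal subgroup.one_closed[OF subA] in auto)
  then show ?thesis by blast
qed

text \<open>When the direct path through \<open>A\<close> fails, the image of \<open>y\<close> in \<open>G/C(A)\<close> satisfies the assumptions of
  \<^locale>\<open>engel_target\<close>, and the target is lifted to an element commuting with \<open>y\<close>.\<close>

theorem engel_path_or_frobenius:
  assumes fin: "finite (carrier G)" and sol: "solvable G"
    and x: "x \<in> carrier G" "x \<noteq> \<one>" and y: "y \<in> carrier G" "y \<noteq> \<one>" and nf: "\<not> frobenius_group G"
  shows "\<exists>u \<in> carrier G - {\<one>}. \<exists>v \<in> carrier G - {\<one>}. \<exists>w \<in> carrier G - {\<one>}.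
    engel_edge x u \<and> engel_edge u v \<and> engel_edge v w \<and> engel_edge w y"
proof (rule ccontr)
  assume no: "\<not> ?thesis"
  have no_path: False if "u \<in> carrier G" "u \<noteq> \<one>" "v \<in> carrier G" "v \<noteq> \<one>" "w \<in> carrier G" "w \<noteq> \<one>"
    "engel_edge x u" "engel_edge u v" "engel_edge v w" "engel_edge w y" for u v w
    using no that by blast
  have "carrier G \<noteq> {\<one>}" using x by blast
  then obtain A where "chief_factor G A {\<one>}" using ex_minimal_normal_chief_factor[OF fin sol] by blast
  then interpret A: chief_factor G A "{\<one>}" .
  interpret nA: normal A G by (rule A.W_normal)
  obtain r where "irreducible_action G A.section_group A.conj_coset r" using A.ex_irreducible_action by blast
  then interpret I: irreducible_action G A.section_group A.conj_coset r .
  define K where "K = I.ker"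
  define Q where "Q = G Mod K"
  have nK: "K \<lhd> G" unfolding K_def by (rule I.ker_normal)
  interpret K: normal K G by (rule nK)
  have faith: "faithful_irreducible_action Q A.section_group I.qact r"
    unfolding Q_def K_def by (rule I.faithful_quotient)
  interpret F: faithful_irreducible_action Q A.section_group I.qact r by (rule faith)
  have Kc [simp]: "k \<in> K \<Longrightarrow> k \<in> carrier G" for k by simp
  have Ac [simp]: "f \<in> A \<Longrightarrow> f \<in> carrier G" for f by simp
  have finK: "finite K" using K.subset fin finite_subset by blast
  have coset1: "{\<one>} #> a = {a}" if "a \<in> carrier G" for a using that unfolding r_coset_def by auto
  have secA: "carrier A.section_group = (\<lambda>a. {a}) ` A" unfolding A.section_carrier by (simp add: coset1)
  have act1: "A.conj_coset g {a} = {g \<otimes> a \<otimes> inv g}" for g a unfolding A.conj_coset_def by simp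
  have K_iff: "k \<in> K \<longleftrightarrow> k \<in> carrier G \<and> (\<forall>a \<in> A. k \<otimes> a = a \<otimes> k)" for k
    unfolding K_def I.ker_def secA using conj_eq_iff_commute by (auto simp: act1)
  have fpf_iff: "I.fpf g \<longleftrightarrow> (\<forall>a \<in> A. g \<otimes> a = a \<otimes> g \<longrightarrow> a = \<one>)" if "g \<in> carrier G" for g
    unfolding I.fpf_def secA A.section_one using conj_eq_iff_commute[OF that] by (auto simp: act1)
  have A_comm: "a \<otimes> b = b \<otimes> a" if "a \<in> A" "b \<in> A" for a b
    using A.Q_comm[OF that] that by auto
  have AK: "A \<subseteq> K" using A_comm K_iff by auto
  obtain f0 where f0: "f0 \<in> A" "f0 \<noteq> \<one>" using A.ZW by auto
  have into_A: "engel_edge g f" if "g \<in> carrier G" "f \<in> A" for g f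
    using commutator_in_normal_right[OF A.W_normal that] A_comm that by (intro engel_edge_of_commutator) auto
  have fpf_edge: "I.fpf a" if ab: "a \<in> carrier G" "a \<noteq> \<one>" "b \<in> carrier G" "b \<noteq> \<one>" "engel_edge a b" "engel_edge b y" for a b
  proof (rule ccontr)
    assume "\<not> I.fpf a"
    then obtain f where f: "f \<in> A" "f \<noteq> \<one>" "a \<otimes> f = f \<otimes> a" using fpf_iff[OF ab(1)] by blast
    then have "engel_edge f a" using that by (intro engel_edge_commute) auto
    then show False using no_path[OF _ f(2) that(1-4) into_A[OF x(1) f(1)] _ that(5,6)] f(1) by simp
  qed
  \<comment> \<open>An element of \<open>K\<close> fixes all of \<open>A\<close>, so it cannot be
    fixed point free; a nontrivial one with such edges would complete a path through
    \<open>f0\<close>.\<close>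
  have K_edge: "k = \<one>" if "k \<in> K" "b \<in> carrier G" "b \<noteq> \<one>" "engel_edge k b" "engel_edge b y" for k b
  proof (rule ccontr)
    assume "k \<noteq> \<one>"
    then have "I.fpf k" using fpf_edge that by auto
    then show False using fpf_iff[of k] K_iff that(1) f0 by blast
  qed
  have edge_y: "engel_edge b y" if "b \<in> carrier G" "b \<otimes> y = y \<otimes> b" for b
    using that y by (intro engel_edge_commute)
  have cent_K: "k = \<one>" if "k \<in> K" "b \<in> carrier G" "b \<noteq> \<one>" "engel_edge b y" "b \<otimes> k = k \<otimes> b" for k b
    using K_edge[OF that(1-3) _ that(4)] engel_edge_commute[of k b] that by simp
  \<comment> \<open>\<open>b\<close> fixes exactly one element of \<open>K\<close>, so
    \<open>card K\<close> is 1 modulo \<open>p\<close>.\<close>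
  have coprime_K: "\<not> p dvd card K" if "b \<in> carrier G" "b \<noteq> \<one>" "engel_edge b y" "b [^] p = \<one>" "prime (p::nat)" for p b
  proof
    assume "p dvd card K"
    moreover have "card {k \<in> K. b \<otimes> k = k \<otimes> b} mod p = card K mod p"
      using that K.inv_op_closed2[OF that(1)] finK K.subset by (intro card_conj_fixed_mod) auto
    moreover have "{k \<in> K. b \<otimes> k = k \<otimes> b} = {\<one>}" using cent_K[OF _ that(1-3)] that(1) by auto
    ultimately show False using prime_gt_1_nat[OF that(5)] by auto
  qed
  have coset_eq_iff: "K #> g = K #> h \<longleftrightarrow> (\<exists>k \<in> K. g = k \<otimes> h)" if "g \<in> carrier G" "h \<in> carrier G" for g h
  proof
    assume "K #> g = K #> h"
    then show "\<exists>k \<in> K. g = k \<otimes> h" using ex_mult_of_rcos_eq[OF K.is_subgroup that] by blast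
  next
    assume "\<exists>k \<in> K. g = k \<otimes> h"
    then show "K #> g = K #> h"
      using that coset_mult_assoc[OF K.subset] coset_join2[OF _ K.is_subgroup] by (metis Kc)
  qed
  have coset_one: "K #> g = \<one>\<^bsub>Q\<^esub> \<longleftrightarrow> g \<in> K" if "g \<in> carrier G" for g
    using I.rcos_eq_ker_iff[OF that] unfolding Q_def K_def by simp
  have Q_coset: "K #> g \<in> carrier Q" if "g \<in> carrier G" for g using that unfolding Q_def carrier_FactGroup by blast
  have Q_mult: "(K #> g) \<otimes>\<^bsub>Q\<^esub> (K #> h) = K #> (g \<otimes> h)" if "g \<in> carrier G" "h \<in> carrier G" for g h
    using I.rcos_mult that unfolding Q_def K_def .
  have Q_pow: "(K #> g) [^]\<^bsub>Q\<^esub> (n::nat) = K #> (g [^] n)" if "g \<in> carrier G" for g n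
    using I.rcos_pow that unfolding Q_def K_def .
  have Q_inv: "inv\<^bsub>Q\<^esub> (K #> g) = K #> (inv g)" if "g \<in> carrier G" for g
    using I.rcos_inv that unfolding Q_def K_def .
  have Q_ex: "\<exists>g \<in> carrier G. C = K #> g" if "C \<in> carrier Q" for C
    using that unfolding Q_def carrier_FactGroup by blast
  have solQ: "solvable Q"
  proof -
    interpret h: group_hom G Q "\<lambda>g. K #> g"
      using K.r_coset_hom_Mod unfolding Q_def by (simp add: group_hom_def group_hom_axioms_def K.factorgroup_is_group)
    show ?thesis by (rule h.surj_hom_imp_solvable[OF _ sol]) (simp add: Q_def carrier_FactGroup)
  qed
  have lift: "\<exists>h \<in> carrier G. K #> h = K #> g \<and> b \<otimes> h = h \<otimes> b"
    if b: "b \<in> carrier G" "b \<noteq> \<one>" "engel_edge b y" "b [^] p = \<one>" "prime (p::nat)"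
      and g: "g \<in> carrier G" "K #> (b \<otimes> g) = K #> (g \<otimes> b)" for b p g
  proof -
    have "K #> (b \<otimes> g \<otimes> inv b) = K #> g"
    proof -
      obtain c where c: "c \<in> K" "b \<otimes> g = c \<otimes> (g \<otimes> b)"
        using coset_eq_iff[of "b \<otimes> g" "g \<otimes> b"] g b by auto
      then have "b \<otimes> g \<otimes> inv b = c \<otimes> g" using g(1) b(1) by (simp add: m_assoc)
      then show ?thesis using coset_eq_iff[of "b \<otimes> g \<otimes> inv b" g] c(1) g(1) b(1) by auto
    qed
    then obtain k where k: "k \<in> K" "b \<otimes> (k \<otimes> g) = (k \<otimes> g) \<otimes> b"
      using ex_commuting_in_coset[OF fin nK coprime_K[OF b] b(1,4,5) g(1)] by blast
    then have "K #> (k \<otimes> g) = K #> g" using coset_eq_iff[of "k \<otimes> g" g] g by auto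
    then show ?thesis using k g by (intro bexI[of _ "k \<otimes> g"]) auto
  qed
  \<comment> \<open>Powers of \<open>y\<close> commute with \<open>y\<close>, so none in
    \<open>K\<close> is nontrivial. Hence \<open>y\<close> keeps its order modulo \<open>K\<close>,
    and its prime parts in the quotient come from those in \<open>G\<close>.\<close>
  have yK: "y [^] (n::nat) \<in> K \<Longrightarrow> y [^] n = \<one>" for n
    using cent_K[of "y [^] n" y] edge_y[of y] y commute_pow_left[of y y n] by simp
  define Y where "Y = K #> y"
  have ordY: "F.ord Y = ord y"
  proof -
    have "Y [^]\<^bsub>Q\<^esub> n = \<one>\<^bsub>Q\<^esub> \<longleftrightarrow> ord y dvd n" for n :: nat
    proof -
      have "Y [^]\<^bsub>Q\<^esub> n = \<one>\<^bsub>Q\<^esub> \<longleftrightarrow> y [^] n \<in> K" unfolding Y_def using Q_pow coset_one y by simp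
      also have "\<dots> \<longleftrightarrow> y [^] n = \<one>" using yK K.one_closed by auto
      also have "\<dots> \<longleftrightarrow> ord y dvd n" using pow_eq_id y(1) by blast
      finally show ?thesis .
    qed
    then show ?thesis using F.ord_unique[of Y "ord y"] Q_coset[OF y(1)] unfolding Y_def by blast
  qed
  have part: "b \<in> carrier G \<and> b \<noteq> \<one> \<and> engel_edge b y \<and> b [^] p = \<one> \<and> b \<otimes> y = y \<otimes> b"
    if p: "prime (p::nat)" "ord y = n * p" and b: "b = y [^] n" for p n b
    unfolding b using prime_part_of_ord[OF fin y(1) p] edge_y y(1) by simp
  have "engel_target Q A.section_group I.qact r Y"
  proof (intro engel_target.intro faith engel_target_axioms.intro)
    show "Y \<in> carrier Q" unfolding Y_def using Q_coset y by simp
    show "Y \<noteq> \<one>\<^bsub>Q\<^esub>" unfolding Y_def using coset_one[OF y(1)] yK[of 1] y by auto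
    show "solvable Q" by (rule solQ)
    fix p n C assume p: "prime (p::nat)" "F.ord Y = n * p" and C: "C \<in> carrier Q" "C \<noteq> \<one>\<^bsub>Q\<^esub>"
      and comm: "C \<otimes>\<^bsub>Q\<^esub> Y [^]\<^bsub>Q\<^esub> n = Y [^]\<^bsub>Q\<^esub> n \<otimes>\<^bsub>Q\<^esub> C"
    define b where "b = y [^] n"
    have b: "b \<in> carrier G" "b \<noteq> \<one>" "engel_edge b y" "b [^] p = \<one>"
      using part[OF p(1) _ b_def] p(2) ordY by simp_all
    obtain g where g: "g \<in> carrier G" "C = K #> g" using Q_ex[OF C(1)] by blast
    have "K #> (b \<otimes> g) = K #> (g \<otimes> b)"
      using comm g y b(1) unfolding Y_def b_def by (simp add: Q_pow Q_mult)
    \<comment> \<open>The coset \<open>C\<close> has a representative \<open>h\<close> commuting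
      with \<open>b\<close>, so \<open>h\<close>, \<open>b\<close>, \<open>y\<close> are joined by
      edges and \<open>h\<close> acts without fixed points.\<close>
    from lift[OF b p(1) g(1) this]
    obtain h where h: "h \<in> carrier G" "K #> h = C" "b \<otimes> h = h \<otimes> b"
      using g(2) by blast
    have "h \<noteq> \<one>" using C(2) h(2) coset_one[OF one_closed] by auto
    then have "I.fpf h" using fpf_edge[OF h(1) _ b(1,2) engel_edge_commute[OF h(1) b(1)] b(3)] h(3) by simp
    then show "F.fpf C" using I.fpf_quotient[OF h(1)] h(2) unfolding K_def by simp
  qed
  then interpret T: engel_target Q A.section_group I.qact r Y .
  obtain C where "T.target C" using T.ex_target by blast
  then obtain q where C: "C \<in> carrier Q" "C \<noteq> \<one>\<^bsub>Q\<^esub>" "C [^]\<^bsub>Q\<^esub> q = \<one>\<^bsub>Q\<^esub>" "C \<otimes>\<^bsub>Q\<^esub> Y = Y \<otimes>\<^bsub>Q\<^esub> C"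
    and q: "prime (q::nat)"
    and C_norm: "\<And>g. g \<in> carrier Q \<Longrightarrow> \<exists>i::nat. g \<otimes>\<^bsub>Q\<^esub> C \<otimes>\<^bsub>Q\<^esub> inv\<^bsub>Q\<^esub> g = C [^]\<^bsub>Q\<^esub> i"
    unfolding T.target_def by blast
  obtain p n where p: "prime (p::nat)" "ord y = n * p" using ex_pow_prime_ord[OF y fin] by blast
  define b where "b = y [^] n"
  have b: "b \<in> carrier G" "b \<noteq> \<one>" "engel_edge b y" "b [^] p = \<one>" and b_y: "b \<otimes> y = y \<otimes> b"
    using part[OF p b_def] by simp_all
  obtain g where g: "g \<in> carrier G" "C = K #> g" using Q_ex[OF C(1)] by blast
  have bg: "K #> (b \<otimes> g) = K #> (g \<otimes> b)"
  proof -
    have "C \<otimes>\<^bsub>Q\<^esub> Y [^]\<^bsub>Q\<^esub> n = Y [^]\<^bsub>Q\<^esub> n \<otimes>\<^bsub>Q\<^esub> C"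
      using F.commute_pow_left[of Y C n] C(1,4) Q_coset[OF y(1)] unfolding Y_def by simp
    then show ?thesis using g y b(1) unfolding Y_def b_def by (simp add: Q_pow Q_mult)
  qed
  \<comment> \<open>The lift is chosen to commute with \<open>b\<close>. Then \<open>d [^] q\<close>
    and the commutator of \<open>d\<close> and \<open>y\<close> lie in \<open>K\<close> and commute
    with \<open>b\<close>, so both are trivial.\<close>
  obtain d where d: "d \<in> carrier G" "K #> d = C" "b \<otimes> d = d \<otimes> b"
    using lift[OF b p(1) g(1) bg] g(2) by blast
  have d1: "d \<noteq> \<one>" using C(2) d(2) coset_one[OF one_closed] by auto
  have dq: "d [^] q = \<one>"
  proof (rule cent_K[OF _ b(1-3)])
    show "d [^] q \<in> K" using C(3) d Q_pow[OF d(1), of q] coset_one[of "d [^] q"] by simp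
    show "b \<otimes> d [^] q = d [^] q \<otimes> b" using commute_pow_left[of d b q] d b(1) by simp
  qed
  have dy: "d \<otimes> y = y \<otimes> d"
  proof -
    have "K #> (y \<otimes> d) = K #> (d \<otimes> y)"
      using C(4) unfolding Y_def d(2)[symmetric] Q_mult[OF y(1) d(1)] Q_mult[OF d(1) y(1)] by simp
    then obtain k where k: "k \<in> K" "y \<otimes> d = k \<otimes> (d \<otimes> y)"
      using coset_eq_iff[OF m_closed[OF y(1) d(1)] m_closed[OF d(1) y(1)]] by blast
    have "k = (y \<otimes> d) \<otimes> inv (d \<otimes> y)" unfolding k(2) using k(1) d y by (simp add: m_assoc)
    moreover have "\<dots> \<otimes> b = b \<otimes> \<dots>"
      using d y b b_y by (intro commute_mult commute_inv) auto
    ultimately have "k = \<one>" using cent_K[OF k(1) b(1-3)] by simp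
    then show ?thesis using k d y by simp
  qed
  note d_edge = edge_y[OF d(1) dy]
  have d_cent: "k = \<one>" if "k \<in> K" "d \<otimes> k = k \<otimes> d" for k
    using cent_K[OF that(1) d(1) d1 d_edge that(2)] .
  have qK: "\<not> q dvd card K" using coprime_K[OF d(1) d1 d_edge dq q] .
  \<comment> \<open>This is the normalizer of the group generated by \<open>d\<close>; closure under
    inverses uses that conjugation acts on it by an exponent prime to \<open>q\<close>.\<close>
  define H where "H = {h \<in> carrier G. \<exists>i::nat. h \<otimes> d \<otimes> inv h = d [^] i}"
  have subH: "subgroup H G"
  proof (rule subgroupI)
    have "\<one> \<otimes> d \<otimes> inv \<one> = d [^] (1::nat)" using d by simp
    then show "H \<noteq> {}" unfolding H_def by blast
    show "inv h \<in> H" if h: "h \<in> H" for h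
    proof -
      obtain i where i: "h \<in> carrier G" "h \<otimes> d \<otimes> inv h = d [^] (i::nat)" using h unfolding H_def by blast
      have "d = inv h \<otimes> (h \<otimes> d \<otimes> inv h) \<otimes> h" using i(1) d by (simp add: m_assoc)
      then have eq: "d = inv h \<otimes> d [^] i \<otimes> h" unfolding i(2) .
      have "\<not> q dvd i"
      proof
        assume "q dvd i"
        then have "d [^] i = \<one>" using dq d(1) by (metis dvd_def nat_pow_one nat_pow_pow)
        then show False using eq i(1) d1 by simp
      qed
      then obtain j where j: "(d [^] i) [^] (j::nat) = d" using prime_pow_pow_cycle[OF d(1) dq q] by blast
      have "inv h \<otimes> d \<otimes> inv (inv h) = inv h \<otimes> (d [^] i) [^] j \<otimes> inv (inv h)" unfolding j ..
      also have "\<dots> = (inv h \<otimes> d [^] i \<otimes> inv (inv h)) [^] j"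
        using i(1) d(1) conj_pow[of "inv h" "d [^] i" j] by simp
      also have "\<dots> = d [^] j" using eq i(1) by simp
      finally show ?thesis unfolding H_def using i(1) by blast
    qed
    show "h \<otimes> h' \<in> H" if hh: "h \<in> H" "h' \<in> H" for h h'
    proof -
      obtain i j where i: "h \<in> carrier G" "h \<otimes> d \<otimes> inv h = d [^] (i::nat)"
        and j: "h' \<in> carrier G" "h' \<otimes> d \<otimes> inv h' = d [^] (j::nat)" using hh unfolding H_def by blast
      have "(h \<otimes> h') \<otimes> d \<otimes> inv (h \<otimes> h') = h \<otimes> (h' \<otimes> d \<otimes> inv h') \<otimes> inv h"
        using i(1) j(1) d by (simp add: m_assoc inv_mult_group)
      also have "\<dots> = (h \<otimes> d \<otimes> inv h) [^] j" unfolding j(2) using i(1) d(1) by (simp add: conj_pow)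
      also have "\<dots> = d [^] (i * j)" unfolding i(2) using d(1) by (simp add: nat_pow_pow)
      finally show ?thesis unfolding H_def using i(1) j(1) by blast
    qed
  qed (auto simp: H_def)
  interpret H: subgroup H G by (rule subH)
  have Hc [simp]: "h \<in> H \<Longrightarrow> h \<in> carrier G" for h by simp
  have H_edge: "engel_edge h d" if h: "h \<in> H" for h
  proof -
    have "inv h \<in> H" using h by simp
    then obtain i where "inv h \<otimes> d \<otimes> inv (inv h) = d [^] (i::nat)" unfolding H_def by blast
    then show ?thesis using h d(1) by (intro engel_edge_of_conj_pow) auto
  qed
  have HK: "h = \<one>" if "h \<in> H" "h \<in> K" for h
    using K_edge[OF that(2) d(1) d1 H_edge[OF that(1)] d_edge] .
  \<comment> \<open>A Frattini argument by counting: \<open>d [^] i\<close> has trivial centralizer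
    in \<open>K\<close>, so its \<open>K\<close>-conjugates fill its whole coset. Thus the conjugate
    of \<open>d\<close> by \<open>g\<close> is also one of \<open>d [^] i\<close> by some
    \<open>k\<close> in \<open>K\<close>, and \<open>inv k \<otimes> g\<close> normalises the group
    generated by \<open>d\<close>.\<close>
  have GKH: "\<exists>k \<in> K. inv k \<otimes> g \<in> H" if g: "g \<in> carrier G" for g
  proof -
    obtain i where i: "(K #> g) \<otimes>\<^bsub>Q\<^esub> C \<otimes>\<^bsub>Q\<^esub> inv\<^bsub>Q\<^esub> (K #> g) = C [^]\<^bsub>Q\<^esub> (i::nat)" using C_norm[OF Q_coset[OF g]] by blast
    have ci: "K #> (g \<otimes> d \<otimes> inv g) = K #> (d [^] i)"
      using i g d(1) by (simp add: Q_mult Q_inv Q_pow flip: d(2))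
    have ndvd: "\<not> q dvd i"
    proof
      assume "q dvd i"
      then have "d [^] i = \<one>" using dq d(1) by (metis dvd_def nat_pow_one nat_pow_pow)
      then have "g \<otimes> d \<otimes> inv g \<in> K" using ci coset_eq_iff[of "g \<otimes> d \<otimes> inv g" \<one>] g d(1) by auto
      then have "inv g \<otimes> (g \<otimes> d \<otimes> inv g) \<otimes> g \<in> K" using K.inv_op_closed1[OF g] by blast
      then have "d \<in> K" using g d(1) by (simp add: m_assoc)
      then show False using d_cent[of d] d1 by simp
    qed
    then obtain j where j: "(d [^] i) [^] (j::nat) = d" using prime_pow_pow_cycle[OF d(1) dq q] by blast
    have cent_i: "k = \<one>" if "k \<in> K" "d [^] i \<otimes> k = k \<otimes> d [^] i" for k
      using d_cent[OF that(1)] commute_pow_left[of "d [^] i" k j] that d(1) j by simp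
    define \<phi> where "\<phi> k = k \<otimes> d [^] i \<otimes> inv k" for k
    have "inj_on \<phi> K"
    proof (rule inj_onI)
      fix k l assume kl: "k \<in> K" "l \<in> K" "\<phi> k = \<phi> l"
      have "inv l \<otimes> \<phi> k \<otimes> k = inv l \<otimes> \<phi> l \<otimes> k" using kl by simp
      then have "(inv l \<otimes> k) \<otimes> d [^] i = d [^] i \<otimes> (inv l \<otimes> k)"
        unfolding \<phi>_def using kl d(1) by (simp add: m_assoc)
      then have "inv l \<otimes> k = \<one>" using cent_i[of "inv l \<otimes> k"] kl by simp
      then show "k = l" using kl by (metis Kc inv_closed inv_equality inv_inv)
    qed
    then have "card (\<phi> ` K) = card K" by (rule card_image)
    moreover have "card (K #> (d [^] i)) = card K"
      using card_rcosets_equal[OF rcosetsI[OF K.subset, of "d [^] i"] K.subset] d(1) by simp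
    moreover have "\<phi> ` K \<subseteq> K #> (d [^] i)"
    proof
      fix z assume "z \<in> \<phi> ` K"
      then obtain k where k: "k \<in> K" "z = \<phi> k" by blast
      have "z = (k \<otimes> (d [^] i \<otimes> inv k \<otimes> inv (d [^] i))) \<otimes> d [^] i"
        unfolding k(2) \<phi>_def using k(1) d(1) by (simp add: m_assoc)
      moreover have "k \<otimes> (d [^] i \<otimes> inv k \<otimes> inv (d [^] i)) \<in> K"
        using K.inv_op_closed2[of "d [^] i" "inv k"] k(1) d(1) by simp
      ultimately show "z \<in> K #> (d [^] i)" unfolding r_coset_def by blast
    qed
    moreover have "finite (K #> (d [^] i))"
      using fin r_coset_subset_G[OF K.subset, of "d [^] i"] d(1) finite_subset by blast
    ultimately have "\<phi> ` K = K #> (d [^] i)" using card_subset_eq by metis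
    moreover have "g \<otimes> d \<otimes> inv g \<in> K #> (d [^] i)"
      using rcos_self[of "g \<otimes> d \<otimes> inv g" K] K.is_subgroup g d(1) ci by simp
    ultimately obtain k where k: "k \<in> K" "g \<otimes> d \<otimes> inv g = k \<otimes> d [^] i \<otimes> inv k" unfolding \<phi>_def by blast
    have "(inv k \<otimes> g) \<otimes> d \<otimes> inv (inv k \<otimes> g) = inv k \<otimes> (g \<otimes> d \<otimes> inv g) \<otimes> k"
      using k(1) g d(1) by (simp add: m_assoc inv_mult_group)
    also have "\<dots> = d [^] i" unfolding k(2) using k(1) d(1) by (simp add: m_assoc)
    finally have "\<exists>i::nat. (inv k \<otimes> g) \<otimes> d \<otimes> inv (inv k \<otimes> g) = d [^] i" ..
    then have "inv k \<otimes> g \<in> H" unfolding H_def using k(1) g by simp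
    then show ?thesis using k(1) by blast
  qed
  \<comment> \<open>The second kind of path: \<open>x\<close>, \<open>k\<close>, \<open>h\<close>,
    \<open>d\<close>, \<open>y\<close>, whose first edge exists because \<open>K\<close> is an Engel
    subgroup.\<close>
  have HK_cent: "h = \<one> \<or> k = \<one>" if "h \<in> H" "k \<in> K" "k \<otimes> h = h \<otimes> k" for h k
  proof (rule ccontr)
    assume ne: "\<not> (h = \<one> \<or> k = \<one>)"
    have "engel_edge x k" by (rule engel_of_fpf[OF fin sol nK d(1) dq q qK d_cent x(1) that(2)])
    moreover have "engel_edge k h" using engel_edge_commute[of k h] that by simp
    ultimately show False
      using no_path[of k h d] ne that d(1) d1 H_edge[OF that(1)] d_edge by simp
  qed
  have dH: "d \<in> H"
  proof -
    have "d \<otimes> d \<otimes> inv d = d [^] (1::nat)" using d(1) by (simp add: m_assoc)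
    then show ?thesis unfolding H_def using d(1) by blast
  qed
  have "frobenius_group G"
    unfolding frobenius_group_def
  proof (intro conjI exI[of _ H] ballI)
    show "H \<noteq> {\<one>}" using dH d1 by blast
    show "H \<noteq> carrier G" using HK[of f0] f0 AK by auto
    fix g assume g: "g \<in> carrier G - H"
    show "H \<inter> (g <# H #> inv g) = {\<one>}"
    proof
      show "{\<one>} \<subseteq> H \<inter> (g <# H #> inv g)"
      proof -
        have "\<one> = g \<otimes> \<one> \<otimes> inv g" using g by simp
        then have "\<one> \<in> g <# H #> inv g" unfolding l_coset_def r_coset_def using H.one_closed by blast
        then show ?thesis by simp
      qed
      show "H \<inter> (g <# H #> inv g) \<subseteq> {\<one>}"
      proof
        fix z assume z: "z \<in> H \<inter> (g <# H #> inv g)"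
        then obtain h where h: "h \<in> H" "z = g \<otimes> h \<otimes> inv g" unfolding l_coset_def r_coset_def by blast
        \<comment> \<open>Writing \<open>g = k \<otimes> h0\<close>, the element \<open>z\<close> is
          the conjugate by \<open>k\<close> of some \<open>h1\<close> in \<open>H\<close>. Then
          \<open>z \<otimes> inv h1\<close> lies in both \<open>H\<close> and \<open>K\<close>, so
          \<open>z = h1\<close> commutes with the nontrivial \<open>k\<close>.\<close>
        obtain k where k: "k \<in> K" "inv k \<otimes> g \<in> H" using GKH g by blast
        define h0 where "h0 = inv k \<otimes> g"
        define h1 where "h1 = h0 \<otimes> h \<otimes> inv h0"
        have h0: "h0 \<in> H" "g = k \<otimes> h0" using k g unfolding h0_def by simp_all
        have h1: "h1 \<in> H" unfolding h1_def using h0 h by simp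
        have z_eq: "z = k \<otimes> h1 \<otimes> inv k"
          unfolding h(2) h1_def h0(2) using k(1) h0(1) h(1) by (simp add: m_assoc inv_mult_group)
        have "z \<otimes> inv h1 = k \<otimes> (h1 \<otimes> inv k \<otimes> inv h1)" unfolding z_eq using k(1) h1 by (simp add: m_assoc)
        moreover have "\<dots> \<in> K" using K.inv_op_closed2[of h1 "inv k"] k(1) h1 by simp
        ultimately have "z \<otimes> inv h1 \<in> K" by (simp only:)
        moreover have "z \<otimes> inv h1 \<in> H" using z h1 by blast
        ultimately have "z \<otimes> inv h1 = \<one>" using HK by blast
        then have "z = h1" using z h1 by (metis Hc IntD1 inv_closed inv_equality inv_inv)
        then have "k \<otimes> h1 = h1 \<otimes> k"
          using z_eq conj_eq_iff_commute[of k h1] k(1) h1 by simp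
        moreover have "k \<noteq> \<one>"
        proof
          assume "k = \<one>"
          then show False using h0 g by simp
        qed
        ultimately have "h1 = \<one>" using HK_cent[OF h1 k(1)] by blast
        then show "z \<in> {\<one>}" using \<open>z = h1\<close> by simp
      qed
    qed
  qed (use subH in simp_all)
  then show False using nf by blast
qed

end

section \<open>Distances in the Engel graph\<close>

text \<open>Distances are defined by paths without repeated vertices; cutting out cycles does not
  lengthen a walk.\<close>

lemma (in wf_digraph) ex_apath_of_awalk:
  assumes "awalk u p v"
  shows "\<exists>q. apath u q v \<and> length q \<le> length p"
  using assms
proof (induct rule: awalk_to_apath_induct)
  case (path p)
  then show ?case unfolding apath_def by blast
next
  case (decomp p q r s)
  have "is_awalk_cyc_decomp p (q, r, s)" using awalk_cyc_decomp_has_prop[OF decomp(1,3)] decomp(2) by simp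
  then have "length (q @ s) \<le> length p" by auto
  then show ?case using decomp(4) le_trans by blast
qed

text \<open>The loops of the Engel graph turn paths of length at most \<open>k\<close> into walks of length \<open>k\<close>.\<close>

lemma (in group) engel_diam_le_iff:
  "digraph_diam (with_proj (engel_graph G)) \<le> enat k \<longleftrightarrow>
    (\<forall>u \<in> carrier G - hypercenter G. \<forall>v \<in> carrier G - hypercenter G. (u, v) \<in> parcs (engel_graph G) ^^ k)"
proof -
  let ?D = "with_proj (engel_graph G)"
  let ?R = "parcs (engel_graph G)"
  interpret D: wf_digraph ?D by (rule wf_engel_graph)
  have verts: "verts ?D = carrier G - hypercenter G" by (simp add: engel_graph_def)
  have loop: "(u, u) \<in> ?R" if "u \<in> carrier G - hypercenter G" for u
    using that commutator_eq_one_iff[of u u] unfolding engel_graph_def by (auto intro!: exI[of _ 1])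
  have walk: "(u, v) \<in> ?R ^^ length p" if "D.awalk u p v" for u p v
    using that
  proof (induction p arbitrary: u)
    case (Cons e p)
    then have "(u, snd e) \<in> ?R" "(snd e, v) \<in> ?R ^^ length p" by (auto simp: D.awalk_Cons_iff)
    then show ?case unfolding list.size(4) by (simp only: One_nat_def add_0_right add_Suc_right relpow_Suc_I2)
  qed (simp add: D.awalk_Nil_iff)
  have ext: "(u, v) \<in> ?R ^^ n" if "(u, v) \<in> ?R ^^ m" "v \<in> carrier G - hypercenter G" "m \<le> n" for u v m n
    using that(3)
  proof (induction n rule: dec_induct)
    case (step n)
    then show ?case using loop[OF that(2)] relpow_Suc_I by metis
  qed (use that in simp)
  have walk_ex: "\<exists>p. D.awalk u p v \<and> length p = n" if "(u, v) \<in> ?R ^^ n" "u \<in> carrier G - hypercenter G" for u v n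
    using that
  proof (induction n arbitrary: u)
    case 0
    then show ?case using verts by (auto intro!: exI[of _ "[]"] simp: D.awalk_Nil_iff)
  next
    case (Suc n)
    obtain w where w: "(u, w) \<in> ?R" "(w, v) \<in> ?R ^^ n" using relpow_Suc_D2[OF Suc.prems(1)] by blast
    then have "w \<in> carrier G - hypercenter G" unfolding engel_graph_def by auto
    then obtain p where "D.awalk w p v" "length p = n" using Suc.IH[OF w(2)] by blast
    then show ?case using w(1) by (intro exI[of _ "(u, w) # p"]) (simp add: D.awalk_Cons_iff)
  qed
  show ?thesis
    unfolding digraph_diam_le_iff verts
  proof (intro ball_cong refl iffI)
    fix u v assume uv: "u \<in> carrier G - hypercenter G" "v \<in> carrier G - hypercenter G"
    show "(u, v) \<in> ?R ^^ k" if "\<exists>p. D.apath u p v \<and> length p \<le> k"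
      using that walk ext uv(2) unfolding D.apath_def by blast
    show "\<exists>p. D.apath u p v \<and> length p \<le> k" if "(u, v) \<in> ?R ^^ k"
      using walk_ex[OF that uv(1)] D.ex_apath_of_awalk by blast
  qed
qed

section \<open>Reduction modulo the hypercenter\<close>

context group begin

lemma commutator_upper_central:
  assumes "z \<in> upper_central G (Suc n)" "g \<in> carrier G"
  shows "commutator G z g \<in> upper_central G n"
proof -
  let ?N = "upper_central G n"
  interpret N: normal ?N G by (rule normal_upper_central)
  have z: "z \<in> carrier G" and "?N #> z \<in> group_center (G Mod ?N)" using assms(1) by auto
  then have "(?N #> z) \<otimes>\<^bsub>G Mod ?N\<^esub> (?N #> g) = (?N #> g) \<otimes>\<^bsub>G Mod ?N\<^esub> (?N #> z)"
    using assms(2) unfolding group_center_def carrier_FactGroup by blast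
  then have "?N #> (z \<otimes> g) = ?N #> (g \<otimes> z)" using z assms(2) by (simp add: N.rcos_sum)
  then obtain c where c: "c \<in> ?N" "z \<otimes> g = c \<otimes> (g \<otimes> z)"
    using ex_mult_of_rcos_eq[OF N.is_subgroup, of "z \<otimes> g" "g \<otimes> z"] z assms(2) by auto
  have "commutator G z g = inv (g \<otimes> z) \<otimes> (z \<otimes> g)"
    unfolding commutator_def using z assms(2) by (simp add: inv_mult_group m_assoc)
  also have "\<dots> = inv (g \<otimes> z) \<otimes> c \<otimes> (g \<otimes> z)" unfolding c(2) using c(1) z assms(2) by (simp add: m_assoc)
  finally show ?thesis using N.inv_op_closed1[OF _ c(1), of "g \<otimes> z"] z assms(2) by simp
qed

text \<open>Each commutator with \<open>g\<close> moves down one term of the upper central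
  series.\<close>

lemma engel_commutator_hypercenter:
  assumes "z \<in> hypercenter G" "g \<in> carrier G"
  shows "\<exists>n. engel_commutator G z n g = \<one>"
proof -
  obtain n where "z \<in> upper_central G n" using assms(1) unfolding hypercenter_def by blast
  then show ?thesis
  proof (induction n arbitrary: z)
    case 0
    then show ?case by (intro exI[of _ 0]) simp
  next
    case (Suc n)
    obtain m where "engel_commutator G (commutator G z g) m g = \<one>"
      using Suc.IH[OF commutator_upper_central[OF Suc.prems assms(2)]] by blast
    then show ?case by (metis engel_commutator_Suc_left)
  qed
qed

end

lemma (in group_hom) hom_engel_commutator:
  assumes "x \<in> carrier G" "y \<in> carrier G"
  shows "h (engel_commutator G x n y) = engel_commutator H (h x) n (h y)"
  by (induction n) (simp_all add: assms commutator_def)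

theorem engel_diam_le_4:
  fixes G :: "('a, 'b) monoid_scheme" (structure)
  assumes "group G" and fin: "finite (carrier G)" and sol: "solvable G"
    and nf: "\<not> frobenius_group (G Mod hypercenter G)"
  shows "digraph_diam (with_proj (engel_graph G)) \<le> 4"
proof -
  interpret group G by fact
  define Z where "Z = hypercenter G"
  interpret Z: normal Z G unfolding Z_def by (rule normal_hypercenter[OF fin])
  define Q where "Q = G Mod Z"
  interpret Q: group Q unfolding Q_def by (rule Z.factorgroup_is_group)
  interpret h: group_hom G Q "\<lambda>x. Z #> x"
    using Z.r_coset_hom_Mod Q.is_group by (simp add: group_hom_def group_hom_axioms_def Q_def)
  have surj: "(\<lambda>x. Z #> x) ` carrier G = carrier Q" unfolding Q_def by (simp add: carrier_FactGroup)
  have one_iff: "Z #> x = \<one>\<^bsub>Q\<^esub> \<longleftrightarrow> x \<in> Z" if "x \<in> carrier G" for x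
    using coset_join2[OF that Z.is_subgroup] rcos_self[OF that Z.is_subgroup] unfolding Q_def by auto
  \<comment> \<open>An edge of the quotient brings the iterated commutator into \<open>Z\<close>;
    further commutators with the same \<open>y\<close> then reach the identity, so any
    representatives are joined.\<close>
  have edge: "(x, y) \<in> parcs (engel_graph G)"
    if xy: "x \<in> carrier G - Z" "y \<in> carrier G - Z" "Q.engel_edge (Z #> x) (Z #> y)" for x y
  proof -
    obtain n where n: "n > 0" "engel_commutator Q (Z #> x) n (Z #> y) = \<one>\<^bsub>Q\<^esub>"
      using xy(3) unfolding Q.engel_edge_def by blast
    then have "Z #> engel_commutator G x n y = \<one>\<^bsub>Q\<^esub>" using h.hom_engel_commutator xy by simp
    then have "engel_commutator G x n y \<in> Z" using one_iff xy by simp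
    then obtain m where "engel_commutator G (engel_commutator G x n y) m y = \<one>"
      using engel_commutator_hypercenter xy unfolding Z_def by blast
    then have "engel_commutator G x (n + m) y = \<one>" by (simp add: engel_commutator_add)
    moreover have "n + m > 0" using n(1) by simp
    ultimately show ?thesis using xy unfolding engel_graph_def Z_def by auto
  qed
  have "(u, v) \<in> parcs (engel_graph G) ^^ 4" if u: "u \<in> carrier G - Z" and v: "v \<in> carrier G - Z" for u v
  proof -
    have "\<exists>a \<in> carrier Q - {\<one>\<^bsub>Q\<^esub>}. \<exists>b \<in> carrier Q - {\<one>\<^bsub>Q\<^esub>}. \<exists>c \<in> carrier Q - {\<one>\<^bsub>Q\<^esub>}.
      Q.engel_edge (Z #> u) a \<and> Q.engel_edge a b \<and> Q.engel_edge b c \<and> Q.engel_edge c (Z #> v)"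
    proof (rule Q.engel_path_or_frobenius)
      show "finite (carrier Q)" using fin unfolding surj[symmetric] by simp
      show "solvable Q" using h.surj_hom_imp_solvable[OF surj sol] .
      show "\<not> frobenius_group Q" using nf unfolding Q_def Z_def .
    qed (use u v one_iff in auto)
    then obtain A B C where abc: "A \<in> carrier Q - {\<one>\<^bsub>Q\<^esub>}" "B \<in> carrier Q - {\<one>\<^bsub>Q\<^esub>}" "C \<in> carrier Q - {\<one>\<^bsub>Q\<^esub>}"
      "Q.engel_edge (Z #> u) A" "Q.engel_edge A B" "Q.engel_edge B C" "Q.engel_edge C (Z #> v)" by blast
    have rep: "\<exists>x \<in> carrier G - Z. D = Z #> x" if "D \<in> carrier Q - {\<one>\<^bsub>Q\<^esub>}" for D
      using that one_iff unfolding surj[symmetric] by blast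
    obtain a where a: "a \<in> carrier G - Z" "A = Z #> a" using rep abc(1) by blast
    obtain b where b: "b \<in> carrier G - Z" "B = Z #> b" using rep abc(2) by blast
    obtain c where c: "c \<in> carrier G - Z" "C = Z #> c" using rep abc(3) by blast
    have "(u, a) \<in> parcs (engel_graph G)" "(a, b) \<in> parcs (engel_graph G)" "(b, c) \<in> parcs (engel_graph G)"
      "(c, v) \<in> parcs (engel_graph G)"
      using edge u v a b c abc(4-7) by auto
    then show ?thesis by (auto simp: numeral_eq_Suc)
  qed
  then have "digraph_diam (with_proj (engel_graph G)) \<le> enat 4"
    unfolding engel_diam_le_iff Z_def by blast
  then show ?thesis by (simp add: numeral_eq_enat)
qed

section \<open>Groups with trivial hypercenter\<close>

lemma (in group) hypercenter_trivial:
  assumes "group_center G = {\<one>}"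
  shows "hypercenter G = {\<one>}"
proof -
  have "upper_central G n = {\<one>}" for n
  proof (induction n)
    case (Suc n)
    have "x = \<one>" if x: "x \<in> upper_central G (Suc n)" for x
    proof -
      have xc: "x \<in> carrier G" using x by simp
      have "x \<otimes> g = g \<otimes> x" if "g \<in> carrier G" for g
        using commutator_upper_central[OF x that] Suc commutator_eq_one_iff[OF xc that] by simp
      then have "x \<in> group_center G" using xc unfolding group_center_def by blast
      then show ?thesis using assms by simp
    qed
    moreover have "\<one> \<in> upper_central G (Suc n)"
      using subgroup.one_closed[OF normal_imp_subgroup[OF normal_upper_central[of "Suc n"]]] .
    ultimately show ?case by blast
  qed simp
  then show ?thesis unfolding hypercenter_def by simp
qed

lemma (in group_hom) engel_edge_hom:
  assumes "x \<in> carrier G" "y \<in> carrier G" "G.engel_edge x y"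
  shows "H.engel_edge (h x) (h y)"
  using assms hom_engel_commutator[OF assms(1,2)] unfolding G.engel_edge_def H.engel_edge_def by (metis hom_one)

lemma (in group) parcs_engel_graph:
  assumes "hypercenter G = {\<one>}"
  shows "parcs (engel_graph G) = {(x, y). x \<in> carrier G - {\<one>} \<and> y \<in> carrier G - {\<one>} \<and> engel_edge x y}"
  unfolding engel_graph_def engel_edge_def assms by simp

text \<open>This moves the example to natural numbers. One inequality suffices, as the inverse
  isomorphism gives the other; trivial centers make the vertex sets correspond.\<close>

lemma engel_diam_iso:
  assumes G: "group G" "group_center G = {\<one>\<^bsub>G\<^esub>}" and H: "group H" "group_center H = {\<one>\<^bsub>H\<^esub>}"
    and f: "f \<in> iso G H" and le: "digraph_diam (with_proj (engel_graph H)) \<le> enat k"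
  shows "digraph_diam (with_proj (engel_graph G)) \<le> enat k"
proof -
  interpret G: group G by fact
  interpret H: group H by fact
  define g where "g = inv_into (carrier G) f"
  have bij: "bij_betw f (carrier G) (carrier H)" using f unfolding iso_def by simp
  have g: "g \<in> iso H G" "\<And>x. x \<in> carrier G \<Longrightarrow> g (f x) = x"
    unfolding g_def by (rule G.iso_set_sym[OF f], rule bij_betw_inv_into_left[OF bij])
  interpret f: group_hom G H f using f by unfold_locales (simp add: iso_def)
  interpret g: group_hom H G g using g(1) by unfold_locales (simp add: iso_def)
  note hG = G.hypercenter_trivial[OF G(2)] and hH = H.hypercenter_trivial[OF H(2)]
  have g_inj: "g x \<noteq> \<one>\<^bsub>G\<^esub>" if "x \<in> carrier H" "x \<noteq> \<one>\<^bsub>H\<^esub>" for x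
  proof
    have inj: "inj_on g (carrier H)" using g(1) unfolding iso_def bij_betw_def by simp
    assume "g x = \<one>\<^bsub>G\<^esub>"
    then have "x = \<one>\<^bsub>H\<^esub>" using inj_onD[OF inj, of x "\<one>\<^bsub>H\<^esub>"] that(1) by simp
    then show False using that(2) by simp
  qed
  have step: "(g x, g y) \<in> parcs (engel_graph G)" if "(x, y) \<in> parcs (engel_graph H)" for x y
    using that g_inj g.engel_edge_hom unfolding G.parcs_engel_graph[OF hG] H.parcs_engel_graph[OF hH] by auto
  have pow: "(g x, g y) \<in> parcs (engel_graph G) ^^ n" if "(x, y) \<in> parcs (engel_graph H) ^^ n" for x y n
    using that
  proof (induction n arbitrary: y)
    case (Suc n)
    then obtain w where "(x, w) \<in> parcs (engel_graph H) ^^ n" "(w, y) \<in> parcs (engel_graph H)" by auto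
    then show ?case using Suc.IH step by auto
  qed simp
  show ?thesis
    unfolding G.engel_diam_le_iff
  proof (intro ballI)
    fix u v assume uv: "u \<in> carrier G - hypercenter G" "v \<in> carrier G - hypercenter G"
    have ne: "f x \<in> carrier H - hypercenter H" if "x \<in> carrier G - hypercenter G" for x
      using that g(2)[of x] g.hom_one unfolding hG hH by auto
    have "(f u, f v) \<in> parcs (engel_graph H) ^^ k"
      using le uv ne unfolding H.engel_diam_le_iff by blast
    then have "(g (f u), g (f v)) \<in> parcs (engel_graph G) ^^ k" by (rule pow)
    then show "(u, v) \<in> parcs (engel_graph G) ^^ k" using g(2) uv by simp
  qed
qed

text \<open>On \<open>N\<close>, forming the commutator with \<open>y\<close> yields the identity
  only from the identity. So an iteration that enters \<open>N\<close> and ends at the identity was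
  there on entry. In the example this turns edges into commuting pairs.\<close>

lemma (in group) commute_of_engel_edge:
  assumes "x \<in> carrier G" "y \<in> carrier G" "engel_edge x y"
    and N: "commutator G x y \<in> N" "N \<subseteq> carrier G" "\<And>z. z \<in> N \<Longrightarrow> commutator G z y \<in> N"
      "\<And>z. z \<in> N \<Longrightarrow> z \<otimes> y = y \<otimes> z \<Longrightarrow> z = \<one>"
  shows "x \<otimes> y = y \<otimes> x"
proof -
  obtain n where n: "n > 0" "engel_commutator G x n y = \<one>" using assms(3) unfolding engel_edge_def by blast
  then obtain k where "engel_commutator G (commutator G x y) k y = \<one>"
    by (metis Suc_pred engel_commutator_Suc_left)
  moreover have "z = \<one>" if "z \<in> N" "engel_commutator G z k y = \<one>" for z k
    using that
  proof (induction k arbitrary: z)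
    case (Suc k)
    then have "commutator G z y = \<one>" using N(3) by (simp only: engel_commutator_Suc_left)
    then show ?case using N(2,4) Suc.prems(1) commutator_eq_one_iff[of z y] assms(2) by blast
  qed simp
  ultimately have "commutator G x y = \<one>" using N(1) by blast
  then show ?thesis using commutator_eq_one_iff assms(1,2) by blast
qed

text \<open>An equation for the commutator without inverses, convenient for comparing
  coordinates.\<close>

lemma (in group) commutator_char:
  "x \<in> carrier G \<Longrightarrow> y \<in> carrier G \<Longrightarrow> (y \<otimes> x) \<otimes> commutator G x y = x \<otimes> y"
  unfolding commutator_def by (simp add: m_assoc)

lemma frobenius_group_iso:
  assumes "group G" "group H" "f \<in> iso G H" "frobenius_group H"
  shows "frobenius_group G"
proof -
  interpret G: group G by fact
  interpret H: group H by fact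
  interpret f: group_hom G H f using assms(3) by unfold_locales (simp add: iso_def)
  have bij: "bij_betw f (carrier G) (carrier H)" using assms(3) unfolding iso_def by simp
  have inj: "x = y" if "x \<in> carrier G" "y \<in> carrier G" "f x = f y" for x y
    using bij that unfolding bij_betw_def inj_on_def by blast
  have surj: "\<exists>x \<in> carrier G. z = f x" if "z \<in> carrier H" for z
    using bij that unfolding bij_betw_def by blast
  obtain C where C: "subgroup C H" "C \<noteq> {\<one>\<^bsub>H\<^esub>}" "C \<noteq> carrier H"
    and TI: "\<And>g. g \<in> carrier H - C \<Longrightarrow> C \<inter> (g <#\<^bsub>H\<^esub> C #>\<^bsub>H\<^esub> inv\<^bsub>H\<^esub> g) = {\<one>\<^bsub>H\<^esub>}"
    using assms(4) unfolding frobenius_group_def by blast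
  interpret C: subgroup C H by fact
  define P where "P = {x \<in> carrier G. f x \<in> C}"
  have subP: "subgroup P G"
    by (rule G.subgroupI) (auto simp: P_def intro!: exI[of _ "\<one>\<^bsub>G\<^esub>"])
  interpret P: subgroup P G by (rule subP)
  have "P \<noteq> {\<one>\<^bsub>G\<^esub>}"
  proof -
    obtain c where c: "c \<in> C" "c \<noteq> \<one>\<^bsub>H\<^esub>" using C(2) C.one_closed by blast
    obtain x where x: "x \<in> carrier G" "c = f x" using surj[OF C.mem_carrier[OF c(1)]] by blast
    then have "x \<in> P" "x \<noteq> \<one>\<^bsub>G\<^esub>" using c unfolding P_def by auto
    then show ?thesis by blast
  qed
  moreover have "P \<noteq> carrier G"
  proof
    assume "P = carrier G"
    then have "carrier H \<subseteq> C" using surj unfolding P_def by blast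
    then show False using C(3) C.subset by blast
  qed
  moreover have "P \<inter> (g <#\<^bsub>G\<^esub> P #>\<^bsub>G\<^esub> inv\<^bsub>G\<^esub> g) = {\<one>\<^bsub>G\<^esub>}" if g: "g \<in> carrier G - P" for g
  proof
    have "\<one>\<^bsub>G\<^esub> = g \<otimes>\<^bsub>G\<^esub> \<one>\<^bsub>G\<^esub> \<otimes>\<^bsub>G\<^esub> inv\<^bsub>G\<^esub> g" using g by simp
    then have "\<one>\<^bsub>G\<^esub> \<in> g <#\<^bsub>G\<^esub> P #>\<^bsub>G\<^esub> inv\<^bsub>G\<^esub> g" unfolding l_coset_def r_coset_def using P.one_closed by blast
    then show "{\<one>\<^bsub>G\<^esub>} \<subseteq> P \<inter> (g <#\<^bsub>G\<^esub> P #>\<^bsub>G\<^esub> inv\<^bsub>G\<^esub> g)" by simp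
    show "P \<inter> (g <#\<^bsub>G\<^esub> P #>\<^bsub>G\<^esub> inv\<^bsub>G\<^esub> g) \<subseteq> {\<one>\<^bsub>G\<^esub>}"
    proof
      fix z assume z: "z \<in> P \<inter> (g <#\<^bsub>G\<^esub> P #>\<^bsub>G\<^esub> inv\<^bsub>G\<^esub> g)"
      then obtain x where x: "x \<in> P" "z = g \<otimes>\<^bsub>G\<^esub> x \<otimes>\<^bsub>G\<^esub> inv\<^bsub>G\<^esub> g" unfolding l_coset_def r_coset_def by blast
      have "f z = f g \<otimes>\<^bsub>H\<^esub> f x \<otimes>\<^bsub>H\<^esub> inv\<^bsub>H\<^esub> (f g)" using x g by simp
      moreover have "f x \<in> C" "f z \<in> C" using x(1) z unfolding P_def by auto
      ultimately have "f z \<in> C \<inter> (f g <#\<^bsub>H\<^esub> C #>\<^bsub>H\<^esub> inv\<^bsub>H\<^esub> (f g))"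
        unfolding l_coset_def r_coset_def by blast
      moreover have "f g \<in> carrier H - C" using g unfolding P_def by auto
      ultimately have "f z = \<one>\<^bsub>H\<^esub>" using TI by blast
      then show "z \<in> {\<one>\<^bsub>G\<^esub>}" using inj[of z "\<one>\<^bsub>G\<^esub>"] z by simp
    qed
  qed
  ultimately show ?thesis unfolding frobenius_group_def using subP G.is_group by blast
qed

lemma (in group) iso_Mod_trivial: "(\<lambda>x. {\<one>} #> x) \<in> iso G (G Mod {\<one>})"
proof -
  interpret N: normal "{\<one>}" G by (rule one_is_normal)
  have coset: "{\<one>} #> x = {x}" if "x \<in> carrier G" for x using that unfolding r_coset_def by auto
  show ?thesis
    unfolding iso_def using N.r_coset_hom_Mod
    by (auto simp: bij_betw_def inj_on_def coset carrier_FactGroup)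
qed

section \<open>A group with diameter four\<close>

text \<open>The exponent is 13 - 2, the inverse of Fermat's theorem, checked on all
  residues.\<close>

lemma inverse_13: "(a::13) \<noteq> 0 \<Longrightarrow> a ^ 11 * a = 1"
proof -
  assume "a \<noteq> 0"
  obtain z :: int where z: "a = of_int z" "0 \<le> z" "z < 13"
    by (cases a rule: bit1_cases) auto
  then have "z = 0 \<or> z = 1 \<or> z = 2 \<or> z = 3 \<or> z = 4 \<or> z = 5 \<or> z = 6 \<or> z = 7 \<or> z = 8 \<or> z = 9 \<or>
    z = 10 \<or> z = 11 \<or> z = 12" by presburger
  then show ?thesis using \<open>a \<noteq> 0\<close> z(1) by (elim disjE) simp_all
qed

lemma mult_eq_0_13: "(a::13) * b = 0 \<Longrightarrow> a \<noteq> 0 \<Longrightarrow> b = 0"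
proof -
  assume "a * b = 0" "a \<noteq> 0"
  have "b = (a ^ 11 * a) * b" using inverse_13[OF \<open>a \<noteq> 0\<close>] by simp
  also have "\<dots> = a ^ 11 * (a * b)" by (rule mult.assoc)
  finally show "b = 0" using \<open>a * b = 0\<close> by simp
qed

lemma eq_uminus_13: "(a::13) = - a \<longleftrightarrow> a = 0"
proof
  assume "a = - a"
  then have "a + a = 0" by (metis add.right_inverse)
  then have "2 * a = 0" by (simp only: mult_2)
  then show "a = 0" using mult_eq_0_13[of 2 a] by simp
qed simp

lemma square_eq_one_13: "(a::13) * a = 1 \<Longrightarrow> a = 1 \<or> a = - 1"
proof -
  assume "a * a = 1"
  then have "(a - 1) * (a + 1) = 0" by (simp add: algebra_simps)
  then show ?thesis using mult_eq_0_13[of "a - 1" "a + 1"] by (auto simp: eq_neg_iff_add_eq_0)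
qed

text \<open>The elements are affine maps of \<open>F\<^sub>1\<^sub>3\<^sup>3\<close>: the linear part of \<open>(s, l, m, n, w, u, v)\<close>
  multiplies the first coordinate by \<open>l\<close>, acts on the other two by the matrix \<open>diag(m, n)\<close>, composed
  with the swap if \<open>s\<close>, and \<open>(w, u, v)\<close> is the translation. Here \<open>5\<close> is a square root of \<open>-1\<close>, and the
  linear parts form the dicyclic group of order 12.\<close>

type_synonym affine = "bool \<times> 13 \<times> 13 \<times> 13 \<times> 13 \<times> 13 \<times> 13"

fun affine_mult :: "affine \<Rightarrow> affine \<Rightarrow> affine" where
  "affine_mult (s, l, m, n, w, u, v) (s', l', m', n', w', u', v') =
    (s \<noteq> s', l * l', if s then m * n' else m * m', if s then n * m' else n * n',
     w + l * w', if s then u + m * v' else u + m * u', if s then v + n * u' else v + n * v')"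

text \<open>Without swap, \<open>l\<close> is 1 or -1 and \<open>m\<close> is one of three cube
  roots of \<open>l\<close>. With swap, \<open>l\<close> is 5 or -5, the factor 5 turns it into -1
  or 1, and \<open>m\<close> is a cube root of that. In both cases \<open>m\<close> determines
  \<open>n\<close>, giving six matrices each.\<close>

fun dicyclic :: "bool \<Rightarrow> 13 \<Rightarrow> 13 \<Rightarrow> 13 \<Rightarrow> bool" where
  "dicyclic False l m n \<longleftrightarrow> l * l = 1 \<and> m * n = 1 \<and> m * m * m = l \<and> n * n * n = l"
| "dicyclic True l m n \<longleftrightarrow> l * l = - 1 \<and> m * n = - 1 \<and> m * m * m = 5 * l \<and> n * n * n = - (5 * l)"

definition aff :: "affine monoid" where
  "aff = \<lparr>carrier = {(s, l, m, n, w, u, v). dicyclic s l m n}, monoid.mult = affine_mult,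
     one = (False, 1, 1, 1, 0, 0, 0)\<rparr>"

lemma affine_simps [simp]:
  "(s, l, m, n, w, u, v) \<in> carrier aff \<longleftrightarrow> dicyclic s l m n"
  "x \<otimes>\<^bsub>aff\<^esub> y = affine_mult x y"
  "\<one>\<^bsub>aff\<^esub> = (False, 1, 1, 1, 0, 0, 0)"
  unfolding aff_def by auto

lemma dicyclic_mult:
  assumes "dicyclic s l m n" "dicyclic s' l' m' n'"
  shows "dicyclic (s \<noteq> s') (l * l') (if s then m * n' else m * m') (if s then n * m' else n * n')"
proof -
  have 5: "5 * a * (5 * b) = - (a * b)" for a b :: 13
  proof -
    have "5 * a * (5 * b) = (5 * 5) * (a * b)" by (simp only: ac_simps)
    moreover have "(5::13) * 5 = - 1" by simp
    ultimately show ?thesis by (simp only: mult_minus1)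
  qed
  have l: "(l * l') * (l * l') = (l * l) * (l' * l')"
    and mn: "(m * m') * (n * n') = (m * n) * (m' * n')" "(m * n') * (n * m') = (m * n) * (m' * n')"
    and cube: "(a * b) * (a * b) * (a * b) = (a * a * a) * (b * b * b)" for a b :: 13
    by (simp_all only: ac_simps)
  have pull: "5 * l * l' = 5 * (l * l')" "l * (5 * l') = 5 * (l * l')" by (simp_all only: ac_simps)
  show ?thesis
    using assms by (cases s; cases s') (simp_all add: l mn cube 5 pull)
qed

lemma group_affine: "group aff"
proof (rule groupI)
  show "x \<otimes>\<^bsub>aff\<^esub> y \<in> carrier aff"
    if "x \<in> carrier aff" "y \<in> carrier aff" for x y
    using that dicyclic_mult by (cases x; cases y) auto
  show "x \<otimes>\<^bsub>aff\<^esub> y \<otimes>\<^bsub>aff\<^esub> z = x \<otimes>\<^bsub>aff\<^esub> (y \<otimes>\<^bsub>aff\<^esub> z)" for x y z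
    by (cases x; cases y; cases z) (auto simp: algebra_simps)
  show "\<one>\<^bsub>aff\<^esub> \<in> carrier aff" by simp
  show "\<one>\<^bsub>aff\<^esub> \<otimes>\<^bsub>aff\<^esub> x = x" for x by (cases x) simp
  show "\<exists>y \<in> carrier aff. y \<otimes>\<^bsub>aff\<^esub> x = \<one>\<^bsub>aff\<^esub>"
    if x: "x \<in> carrier aff" for x
  proof -
    obtain s l m n w u v where x_eq: "x = (s, l, m, n, w, u, v)" by (cases x)
    have d: "dicyclic s l m n" using x unfolding x_eq by simp
    show ?thesis
    proof (cases s)
      \<comment> \<open>A swapped linear part has square -1, so its inverse is its negative.\<close>
      case True
      then show ?thesis using d unfolding x_eq
        by (intro bexI[of _ "(True, - l, - m, - n, l * w, m * v, n * u)"]) (auto simp: mult.commute)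
    next
      case False
      then show ?thesis using d unfolding x_eq
        by (intro bexI[of _ "(False, l, n, m, - (l * w), - (n * u), - (m * v))"]) (auto simp: mult.commute)
    qed
  qed
qed

interpretation E: group aff by (rule group_affine)

lemma finite_affine: "finite (carrier aff)"
  by (rule finite_subset[of _ UNIV]) auto

lemma affine_cases:
  assumes "x \<in> carrier aff"
  obtains s l m n w u v where "x = (s, l, m, n, w, u, v)" "dicyclic s l m n"
  using assms by (cases x) auto

lemma dicyclic_False:
  assumes "dicyclic False l m n"
  shows "l = 1 \<or> l = - 1" "l * l = 1" "m * n = 1" "m * m * m = l" "n * n * n = l"
  using assms square_eq_one_13[of l] by auto

lemma cancel_13: "a * b = b \<Longrightarrow> b \<noteq> 0 \<Longrightarrow> (a::13) = 1"
proof -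
  assume "a * b = b" "b \<noteq> 0"
  then have "b * (a - 1) = 0" by (simp add: algebra_simps)
  then show "a = 1" using mult_eq_0_13[of b "a - 1"] \<open>b \<noteq> 0\<close> by simp
qed

lemma dicyclic_nonzero:
  assumes "dicyclic s l m n"
  shows "l \<noteq> 0" "m \<noteq> 0" "n \<noteq> 0"
  using assms by (cases s; auto)+

text \<open>Despite the name, the linear parts run through the subgroup of order 3 of the dicyclic
  group. \<open>unipotent\<close> and \<open>shifts\<close> are the steps of the solubility proof,
  and all three sets serve as the \<open>N\<close> in \<open>commute_of_engel_edge\<close>.\<close>

definition unipotent where "unipotent = {(s, l, m, n, w, u, v) \<in> carrier aff. \<not> s \<and> l = 1}"
definition shifts where
  "shifts = {(s, l, m, n, w, u, v) \<in> carrier aff. \<not> s \<and> l = 1 \<and> m = 1 \<and> n = 1}"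
definition plane_shifts where
  "plane_shifts = {(s, l, m, n, w, u, v) \<in> carrier aff. \<not> s \<and> l = 1 \<and> m = 1 \<and> n = 1 \<and> w = 0}"

lemma unipotent_iff [simp]: "(s, l, m, n, w, u, v) \<in> unipotent \<longleftrightarrow> \<not> s \<and> l = 1 \<and> dicyclic False 1 m n"
  unfolding unipotent_def by auto

lemma shifts_iff [simp]: "(s, l, m, n, w, u, v) \<in> shifts \<longleftrightarrow> \<not> s \<and> l = 1 \<and> m = 1 \<and> n = 1"
  unfolding shifts_def by auto

lemma plane_shifts_iff [simp]:
  "(s, l, m, n, w, u, v) \<in> plane_shifts \<longleftrightarrow> \<not> s \<and> l = 1 \<and> m = 1 \<and> n = 1 \<and> w = 0"
  unfolding plane_shifts_def by auto

lemma affine_subgroup: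
  assumes "N \<subseteq> carrier aff" "(False, 1, 1, 1, 0, 0, 0) \<in> N"
    "\<And>x y. x \<in> N \<Longrightarrow> y \<in> N \<Longrightarrow> affine_mult x y \<in> N"
    "\<And>x y. x \<in> N \<Longrightarrow> y \<in> carrier aff \<Longrightarrow> affine_mult y x = (False, 1, 1, 1, 0, 0, 0) \<Longrightarrow> y \<in> N"
  shows "subgroup N aff"
proof (rule E.subgroupI)
  show "inv\<^bsub>aff\<^esub> x \<in> N" if "x \<in> N" for x
    using assms(4)[OF that, of "inv\<^bsub>aff\<^esub> x"] E.l_inv[of x] E.inv_closed[of x] assms(1) that by auto
qed (use assms in auto)

lemma subgroup_unipotent: "subgroup unipotent aff"
proof (rule affine_subgroup)
  show "affine_mult x y \<in> unipotent" if "x \<in> unipotent" "y \<in> unipotent" for x y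
  proof -
    obtain m n w u v where x: "x = (False, 1, m, n, w, u, v)" "dicyclic False 1 m n"
      using \<open>x \<in> unipotent\<close> by (cases x) auto
    obtain m' n' w' u' v' where y: "y = (False, 1, m', n', w', u', v')" "dicyclic False 1 m' n'"
      using \<open>y \<in> unipotent\<close> by (cases y) auto
    show ?thesis using dicyclic_mult[OF x(2) y(2)] unfolding x(1) y(1) by (simp del: dicyclic.simps)
  qed
qed (auto simp: unipotent_def)

lemma subgroup_shifts: "subgroup shifts aff"
proof (rule affine_subgroup)
  show "affine_mult x y \<in> shifts" if "x \<in> shifts" "y \<in> shifts" for x y
    using that by (cases x; cases y) auto
qed (auto simp: shifts_def)

text \<open>Commutators enter only through the equation relating \<open>x \<otimes> y\<close> and
  \<open>y \<otimes> x\<close>, so coordinates can be compared without computing inverses.\<close>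

lemma derived_subset_affine:
  assumes "subgroup H aff" "subgroup N aff"
    and c: "\<And>x y c. x \<in> H \<Longrightarrow> y \<in> H \<Longrightarrow> c \<in> H \<Longrightarrow> affine_mult c (affine_mult y x) = affine_mult x y \<Longrightarrow> c \<in> N"
  shows "derived aff H \<subseteq> N"
  unfolding derived_def
proof (rule E.generate_subgroup_incl[OF _ assms(2)])
  interpret H: subgroup H aff by fact
  show "derived_set aff H \<subseteq> N"
  proof
    fix c assume "c \<in> derived_set aff H"
    then obtain x y where xy: "x \<in> H" "y \<in> H" "c = x \<otimes>\<^bsub>aff\<^esub> y \<otimes>\<^bsub>aff\<^esub> inv\<^bsub>aff\<^esub> x \<otimes>\<^bsub>aff\<^esub> inv\<^bsub>aff\<^esub> y"
      by blast
    have "c \<in> H" unfolding xy(3) using xy by (intro H.m_closed H.m_inv_closed)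
    moreover have "c \<otimes>\<^bsub>aff\<^esub> (y \<otimes>\<^bsub>aff\<^esub> x) = x \<otimes>\<^bsub>aff\<^esub> y"
      unfolding xy(3) using H.mem_carrier[OF xy(1)] H.mem_carrier[OF xy(2)]
      by (simp only: E.m_assoc E.m_closed E.inv_closed E.cancel_left E.l_inv E.r_one)
    ultimately show "c \<in> N" using c xy by simp
  qed
qed

lemma solvable_affine: "solvable aff"
proof -
  have "derived aff (carrier aff) \<subseteq> unipotent"
  proof (rule derived_subset_affine[OF E.subgroup_self subgroup_unipotent])
    fix x y c assume xyc: "x \<in> carrier aff" "y \<in> carrier aff" "c \<in> carrier aff"
      "affine_mult c (affine_mult y x) = affine_mult x y"
    obtain s l m n w u v where x: "x = (s, l, m, n, w, u, v)" "dicyclic s l m n" using affine_cases[OF xyc(1)] .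
    obtain s' l' m' n' w' u' v' where y: "y = (s', l', m', n', w', u', v')" "dicyclic s' l' m' n'"
      using affine_cases[OF xyc(2)] .
    obtain s'' l'' m'' n'' w'' u'' v'' where c: "c = (s'', l'', m'', n'', w'', u'', v'')" "dicyclic s'' l'' m'' n''"
      using affine_cases[OF xyc(3)] .
    have "l'' * (l' * l) = l * l'" "(s'' \<noteq> (s' \<noteq> s)) = (s \<noteq> s')" using xyc(4) unfolding x(1) y(1) c(1) by auto
    then have "\<not> s''" "l'' * (l' * l) = l' * l" by (auto simp: mult.commute)
    moreover have "l' * l \<noteq> 0" using mult_eq_0_13 dicyclic_nonzero(1)[OF x(2)] dicyclic_nonzero(1)[OF y(2)] by blast
    ultimately show "c \<in> unipotent" using cancel_13 c unfolding c by auto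
  qed
  moreover have "derived aff unipotent \<subseteq> shifts"
  proof (rule derived_subset_affine[OF subgroup_unipotent subgroup_shifts])
    fix x y c assume xyc: "x \<in> unipotent" "y \<in> unipotent" "c \<in> unipotent"
      "affine_mult c (affine_mult y x) = affine_mult x y"
    obtain m n w u v where x: "x = (False, 1, m, n, w, u, v)" "dicyclic False 1 m n" using xyc(1) by (cases x) auto
    obtain m' n' w' u' v' where y: "y = (False, 1, m', n', w', u', v')" "dicyclic False 1 m' n'"
      using xyc(2) by (cases y) auto
    obtain m'' n'' w'' u'' v'' where c: "c = (False, 1, m'', n'', w'', u'', v'')" "dicyclic False 1 m'' n''"
      using xyc(3) by (cases c) auto
    have "m'' * (m' * m) = m' * m" using xyc(4) unfolding x(1) y(1) c(1) by (auto simp: mult.commute)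
    moreover have "m' * m \<noteq> 0" using mult_eq_0_13 dicyclic_nonzero(2)[OF x(2)] dicyclic_nonzero(2)[OF y(2)] by blast
    ultimately have "m'' = 1" by (rule cancel_13)
    then show "c \<in> shifts" using c by simp
  qed
  moreover have "derived aff shifts \<subseteq> {\<one>\<^bsub>aff\<^esub>}"
  proof (rule derived_subset_affine[OF subgroup_shifts E.triv_subgroup])
    fix x y c assume "x \<in> shifts" "y \<in> shifts" "c \<in> shifts"
      "affine_mult c (affine_mult y x) = affine_mult x y"
    then show "c \<in> {\<one>\<^bsub>aff\<^esub>}" by (cases x; cases y; cases c) auto
  qed
  ultimately have "(derived aff ^^ 3) (carrier aff) \<subseteq> {\<one>\<^bsub>aff\<^esub>}"
  proof -
    assume 1: "derived aff (carrier aff) \<subseteq> unipotent"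
      and 2: "derived aff unipotent \<subseteq> shifts"
      and 3: "derived aff shifts \<subseteq> {\<one>\<^bsub>aff\<^esub>}"
    have "derived aff (derived aff (carrier aff)) \<subseteq> shifts"
      using E.mono_derived[OF 1] 2 by blast
    then have "derived aff (derived aff (derived aff (carrier aff)))
        \<subseteq> {\<one>\<^bsub>aff\<^esub>}"
      using E.mono_derived 3 by blast
    then show ?thesis by (simp only: numeral_3_eq_3 funpow.simps comp_apply id_apply)
  qed
  moreover have "\<one>\<^bsub>aff\<^esub> \<in> (derived aff ^^ 3) (carrier aff)"
    using subgroup.one_closed[OF E.exp_of_derived_is_subgroup[OF E.subgroup_self]] .
  ultimately show ?thesis unfolding E.solvable_iff_trivial_derived_seq by blast
qed

text \<open>\<open>y4\<close> has order 4 and square \<open>z0\<close>, which acts as -1 on all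
  three coordinates; \<open>x0\<close> is a translation in the plane. The distance from
  \<open>x0\<close> to \<open>y4\<close> will exceed 3.\<close>

abbreviation y4 :: affine where "y4 \<equiv> (True, 5, - 1, 1, 0, 0, 0)"
abbreviation z0 :: affine where "z0 \<equiv> (False, - 1, - 1, - 1, 0, 0, 0)"
abbreviation x0 :: affine where "x0 \<equiv> (False, 1, 1, 1, 0, 1, 0)"

section \<open>Centralizers and Engel edges in the example\<close>

lemma five_five: "(5::13) * 5 = - 1" "(1::13) \<noteq> - 1" "(- 1::13) \<noteq> 1" by simp_all

lemma elements_closed: "y4 \<in> carrier aff" "z0 \<in> carrier aff" "x0 \<in> carrier aff"
  by simp_all

text \<open>\<open>y4\<close> fixes no nonzero vector, so \<open>b\<close> has no translation part.
  Inside the group the last alternative consists of \<open>y4\<close> and its inverse only.\<close>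

lemma centralizer_y4:
  assumes "b \<in> carrier aff" "affine_mult b y4 = affine_mult y4 b"
  shows "b = (False, 1, 1, 1, 0, 0, 0) \<or> b = z0 \<or> (\<exists>l m. b = (True, l, m, - m, 0, 0, 0))"
proof -
  obtain s l m n w u v where b: "b = (s, l, m, n, w, u, v)" "dicyclic s l m n" using affine_cases[OF assms(1)] .
  note eqs = assms(2)[unfolded b(1) affine_mult.simps prod.inject mult_zero_right add_0_right add_0_left
    mult_minus1 mult_minus1_right mult_1_left mult_1_right if_cancel if_True]
  have uv: "u = - v" "v = u" "w = 5 * w" using eqs by blast+
  then have "v = - v" by metis
  then have "v = 0" by (simp only: eq_uminus_13)
  then have "u = 0" using uv(2) by simp
  note this \<open>v = 0\<close>
  moreover have "w = 0"
  proof (rule ccontr)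
    assume "w \<noteq> 0"
    then have "(5::13) = 1" using cancel_13[of 5 w] uv(3) by simp
    then show False by simp
  qed
  moreover have "n = - m" if s using eqs that by (metis minus_minus)
  moreover have "l = m \<and> n = m" if "\<not> s"
  proof -
    have mn: "n = m" using eqs that by metis
    have "dicyclic False l m m" using b(2) that mn by (simp del: dicyclic.simps)
    then have "l = m" by (metis dicyclic.simps(1) mult_1)
    then show ?thesis using mn by simp
  qed
  moreover have "l = 1 \<or> l = - 1" if "\<not> s" using dicyclic_False(1)[of l m n] b(2) that by (simp del: dicyclic.simps)
  ultimately show ?thesis using b(1) by (cases s) auto
qed

lemma centralizer_z0:
  assumes "a \<in> carrier aff" "affine_mult a z0 = affine_mult z0 a"
  shows "\<exists>s l m n. a = (s, l, m, n, 0, 0, 0)"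
proof -
  obtain s l m n w u v where a: "a = (s, l, m, n, w, u, v)" using affine_cases[OF assms(1)] .
  note eqs = assms(2)[unfolded a affine_mult.simps prod.inject mult_zero_right add_0_right add_0_left
    mult_minus1 mult_minus1_right if_False if_cancel]
  have "w = - w" "u = - u" "v = - v" using eqs by metis+
  then show ?thesis using a eq_uminus_13 by simp
qed

lemma center_affine: "group_center aff = {\<one>\<^bsub>aff\<^esub>}"
proof -
  have "g = \<one>\<^bsub>aff\<^esub>" if g: "g \<in> group_center aff" for g
  proof -
    have "g \<in> carrier aff" "affine_mult g y4 = affine_mult y4 g" "affine_mult g x0 = affine_mult x0 g"
      using g elements_closed unfolding group_center_def by auto
    then show ?thesis using centralizer_y4[of g] five_five by auto
  qed
  moreover have "\<one>\<^bsub>aff\<^esub> \<in> group_center aff"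
    unfolding group_center_def by (intro CollectI conjI ballI E.one_closed) (simp only: E.l_one E.r_one)
  ultimately show ?thesis by blast
qed

lemma commutator_unipotent:
  assumes "x \<in> carrier aff" "y \<in> carrier aff"
  shows "commutator aff x y \<in> unipotent"
proof -
  let ?c = "commutator aff x y"
  have cc: "?c \<in> carrier aff" using E.commutator_closed[OF assms] .
  obtain s l m n w u v where x: "x = (s, l, m, n, w, u, v)" "dicyclic s l m n" using affine_cases[OF assms(1)] .
  obtain s' l' m' n' w' u' v' where y: "y = (s', l', m', n', w', u', v')" "dicyclic s' l' m' n'"
    using affine_cases[OF assms(2)] .
  obtain s'' l'' m'' n'' w'' u'' v'' where c: "?c = (s'', l'', m'', n'', w'', u'', v'')" "dicyclic s'' l'' m'' n''"
    using affine_cases[OF cc] .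
  have "affine_mult (affine_mult y x) ?c = affine_mult x y" using E.commutator_char[OF assms] by simp
  then have "(l' * l) * l'' = l * l'" "((s' \<noteq> s) \<noteq> s'') = (s \<noteq> s')" unfolding c(1) unfolding x(1) y(1) by auto
  then have "\<not> s''" "l'' * (l' * l) = l' * l" by (auto simp: mult.commute)
  moreover have "l' * l \<noteq> 0" using mult_eq_0_13 dicyclic_nonzero(1)[OF x(2)] dicyclic_nonzero(1)[OF y(2)] by blast
  ultimately show ?thesis using cancel_13 c unfolding c by auto
qed

lemma unipotentE:
  assumes "z \<in> unipotent"
  obtains m n w u v where "z = (False, 1, m, n, w, u, v)" "m * n = 1" "m * m * m = 1" "n * n * n = 1"
  using assms by (cases z) auto

text \<open>Commuting with a swap forces \<open>m' = n'\<close>; together with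
  \<open>m' * n' = 1\<close> and the cube condition this leaves only a translation, and the swap
  fixes no nonzero vector.\<close>

lemma commute_in_unipotent:
  assumes z: "z \<in> unipotent" and b: "dicyclic True l m (- m)"
    and comm: "affine_mult z (True, l, m, - m, 0, 0, 0) = affine_mult (True, l, m, - m, 0, 0, 0) z"
  shows "z = (False, 1, 1, 1, 0, 0, 0)"
proof -
  obtain m' n' w u v where z_eq: "z = (False, 1, m', n', w, u, v)" "m' * n' = 1" "m' * m' * m' = 1"
      "n' * n' * n' = 1"
    by (rule unipotentE[OF z])
  note eqs = comm[unfolded z_eq(1) affine_mult.simps prod.inject mult_zero_right add_0_right add_0_left if_False if_True]
  have m0: "m \<noteq> 0" using dicyclic_nonzero[OF b] by blast
  have "m' * m = m * n'" using eqs by blast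
  then have "m * (m' - n') = 0" by (simp add: algebra_simps)
  then have "m' - n' = 0" by (rule mult_eq_0_13[OF _ m0])
  then have "m' = n'" by simp
  then have m': "m' = 1" using z_eq(2,3) by simp
  have mm: "m * m = 1" using b by simp
  have ll: "l * l = - 1" using b by simp
  have "w = 0"
  proof (rule ccontr)
    assume "w \<noteq> 0"
    then have "l = 1" using cancel_13[of l w] eqs by simp
    then show False using ll five_five by simp
  qed
  moreover have "u = m * v" "v = - m * u" using eqs by blast+
  then have "u = - (m * m * u)" by (metis mult.assoc mult_minus_left mult_minus_right)
  then have "u = - u" unfolding mm by simp
  then have "u = 0" by (simp only: eq_uminus_13)
  moreover have "v = 0" using \<open>v = - m * u\<close> \<open>u = 0\<close> by simp
  ultimately show ?thesis using z_eq m' \<open>m' = n'\<close> by simp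
qed

text \<open>Commutators land in \<open>unipotent\<close>, where the element of order 4 centralises
  nothing but the identity.\<close>

lemma engel_edge_commute_y4:
  assumes b: "b \<in> carrier aff" "E.engel_edge b (True, l, m, - m, 0, 0, 0)"
    and d: "dicyclic True l m (- m)"
  shows "affine_mult b (True, l, m, - m, 0, 0, 0) = affine_mult (True, l, m, - m, 0, 0, 0) b"
proof -
  have c: "(True, l, m, - m, 0, 0, 0) \<in> carrier aff" using d by (simp del: dicyclic.simps)
  have "b \<otimes>\<^bsub>aff\<^esub> (True, l, m, - m, 0, 0, 0) = (True, l, m, - m, 0, 0, 0) \<otimes>\<^bsub>aff\<^esub> b"
  proof (rule E.commute_of_engel_edge[OF b(1) c b(2), of unipotent])
    show "unipotent \<subseteq> carrier aff" by (rule subgroup.subset[OF subgroup_unipotent])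
    then show "commutator aff z (True, l, m, - m, 0, 0, 0) \<in> unipotent" if "z \<in> unipotent" for z
      using commutator_unipotent[OF _ c] that by blast
    show "z = \<one>\<^bsub>aff\<^esub>"
      if "z \<in> unipotent" "z \<otimes>\<^bsub>aff\<^esub> (True, l, m, - m, 0, 0, 0) = (True, l, m, - m, 0, 0, 0) \<otimes>\<^bsub>aff\<^esub> z" for z
      using commute_in_unipotent[OF that(1) d] that(2) by simp
  qed (rule commutator_unipotent[OF b(1) c])
  then show ?thesis by simp
qed

text \<open>The linear part of \<open>z0\<close> is the scalar -1, so commutators with it have
  trivial linear part.\<close>

lemma commutator_z0:
  assumes "a \<in> carrier aff"
  shows "commutator aff a z0 \<in> shifts"
proof -
  let ?c = "commutator aff a z0"
  obtain s l m n w u v where a: "a = (s, l, m, n, w, u, v)" "dicyclic s l m n" using affine_cases[OF assms] .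
  obtain m' n' w' u' v' where c: "?c = (False, 1, m', n', w', u', v')" "m' * n' = 1"
      "m' * m' * m' = 1" "n' * n' * n' = 1"
    by (rule unipotentE[OF commutator_unipotent[OF assms elements_closed(2)]])
  have "affine_mult (affine_mult z0 a) ?c = affine_mult a z0"
    using E.commutator_char[OF assms elements_closed(2)] by simp
  from arg_cong[OF this, of "\<lambda>(s, l, m, n, w, u, v). m"]
  have "- (m * (if s then n' else m')) = - m" unfolding c(1) unfolding a(1) by (cases s) simp_all
  then have "(if s then n' else m') * m = m" by (simp add: mult.commute)
  then have "(if s then n' else m') = 1" using cancel_13 dicyclic_nonzero(2)[OF a(2)] by blast
  then have "m' = 1" "n' = 1" using c(2) by (cases s; simp)+
  then show ?thesis unfolding c(1) by simp
qed

lemma engel_edge_commute_z0: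
  assumes a: "a \<in> carrier aff" "E.engel_edge a z0"
  shows "affine_mult a z0 = affine_mult z0 a"
proof -
  have "a \<otimes>\<^bsub>aff\<^esub> z0 = z0 \<otimes>\<^bsub>aff\<^esub> a"
  proof (rule E.commute_of_engel_edge[OF a(1) elements_closed(2) a(2), of shifts])
    show sub: "shifts \<subseteq> carrier aff" by (rule subgroup.subset[OF subgroup_shifts])
    show "commutator aff z z0 \<in> shifts" if "z \<in> shifts" for z
      using commutator_z0 sub that by blast
    fix z assume z: "z \<in> shifts" "z \<otimes>\<^bsub>aff\<^esub> z0 = z0 \<otimes>\<^bsub>aff\<^esub> z"
    then have "\<exists>s l m n. z = (s, l, m, n, 0, 0, 0)" using centralizer_z0[of z] sub by auto
    then show "z = \<one>\<^bsub>aff\<^esub>" using z(1) by auto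
  qed (rule commutator_z0[OF a(1)])
  then show ?thesis by simp
qed

lemma commutator_plane:
  assumes "z \<in> plane_shifts" "dicyclic s l m n"
  shows "commutator aff z (s, l, m, n, 0, 0, 0) \<in> plane_shifts"
proof -
  let ?a = "(s, l, m, n, 0, 0, 0)" let ?c = "commutator aff z ?a"
  obtain u v where z: "z = (False, 1, 1, 1, 0, u, v)" using assms(1) by (cases z) auto
  have zc: "z \<in> carrier aff" and ac: "?a \<in> carrier aff"
    using z assms(2) by (simp_all del: dicyclic.simps) simp
  obtain m' n' w' u' v' where c: "?c = (False, 1, m', n', w', u', v')" "m' * n' = 1"
      "m' * m' * m' = 1" "n' * n' * n' = 1"
    by (rule unipotentE[OF commutator_unipotent[OF zc ac]])
  have eq: "affine_mult (affine_mult ?a z) ?c = affine_mult z ?a"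
    using E.commutator_char[OF zc ac] by simp
  from arg_cong[OF eq, of "\<lambda>(s, l, m, n, w, u, v). w"] have "l * w' = 0" unfolding c(1) unfolding z by simp
  then have "w' = 0" using mult_eq_0_13 dicyclic_nonzero(1)[OF assms(2)] by blast
  from arg_cong[OF eq, of "\<lambda>(s, l, m, n, w, u, v). m"]
  have 1: "(if s then n' else m') * m = m" unfolding c(1) unfolding z by (cases s) (simp_all add: mult.commute)
  from 1 have "(if s then n' else m') = 1" using cancel_13 dicyclic_nonzero(2)[OF assms(2)] by blast
  then have "m' = 1" "n' = 1" using c(2) by (cases s; simp)+
  then show ?thesis unfolding c(1) using \<open>w' = 0\<close> by simp
qed

text \<open>The dicyclic group acts faithfully and without fixed points on the plane: a swap has
  square -1 there, and a diagonal part with \<open>m = 1\<close> or \<open>n = 1\<close> is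
  trivial.\<close>

lemma centralizer_in_plane:
  assumes "z \<in> plane_shifts" "dicyclic s l m n" "(s, l, m, n) \<noteq> (False, 1, 1, 1)"
    and comm: "affine_mult z (s, l, m, n, 0, 0, 0) = affine_mult (s, l, m, n, 0, 0, 0) z"
  shows "z = (False, 1, 1, 1, 0, 0, 0)"
proof -
  obtain u v where z: "z = (False, 1, 1, 1, 0, u, v)" using assms(1) by (cases z) auto
  have eqs: "u = (if s then m * v else m * u)" "v = (if s then n * u else n * v)"
    using arg_cong[OF comm, of "\<lambda>(s, l, m, n, w, u, v). u"] arg_cong[OF comm, of "\<lambda>(s, l, m, n, w, u, v). v"]
    unfolding z affine_mult.simps prod.case mult_zero_right add_0_right add_0_left if_False if_cancel by blast+
  show ?thesis
  proof (cases s)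
    case True
    then have uv: "u = m * v" "v = n * u" using eqs by metis+
    have mn: "m * n = - 1" using assms(2) True by simp
    have "u = m * n * u" unfolding mult.assoc uv(2)[symmetric] by (rule uv(1))
    then have "u = - u" unfolding mn by simp
    then have "u = 0" by (simp only: eq_uminus_13)
    moreover have "v = 0" unfolding uv(2) \<open>u = 0\<close> by simp
    ultimately show ?thesis using z by simp
  next
    case False
    then have uv: "m * u = u" "n * v = v" using eqs by metis+
    have "u = 0"
    proof (rule ccontr)
      assume "u \<noteq> 0"
      then have "m = 1" using cancel_13[OF uv(1)] by simp
      then show False using assms(2,3) False by auto
    qed
    moreover have "v = 0"
    proof (rule ccontr)
      assume "v \<noteq> 0"
      then have "n = 1" using cancel_13[OF uv(2)] by simp
      then show False using assms(2,3) False by auto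
    qed
    ultimately show ?thesis using z by simp
  qed
qed

text \<open>Edges into \<open>y4\<close> come only from the nontrivial powers of \<open>y4\<close>, and edges into these only from
  the linear maps. The nontrivial ones fix no nonzero vector in the plane of the last two coordinates.\<close>

lemma no_short_path:
  assumes a: "a \<in> carrier aff" "a \<noteq> \<one>\<^bsub>aff\<^esub>"
    and b: "b \<in> carrier aff" "b \<noteq> \<one>\<^bsub>aff\<^esub>"
    and edges: "E.engel_edge x0 a" "E.engel_edge a b" "E.engel_edge b y4"
  shows False
proof -
  have y4: "y4 = (True, 5, - 1, - (- 1), 0, 0, 0)" by simp
  have "affine_mult b y4 = affine_mult y4 b"
    using engel_edge_commute_y4[OF b(1), of 5 "- 1"] edges(3) by simp
  then consider "b = z0" | l m where "b = (True, l, m, - m, 0, 0, 0)"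
    using centralizer_y4[OF b(1)] b(2) by auto
  then have "affine_mult a z0 = affine_mult z0 a"
  proof cases
    case 1
    then show ?thesis using engel_edge_commute_z0[OF a(1)] edges(2) by simp
  next
    \<comment> \<open>Here \<open>a\<close> commutes with \<open>b\<close>, hence with its square
      \<open>z0\<close>, as in the first case.\<close>
    case (2 l m)
    have d: "dicyclic True l m (- m)" using b(1) unfolding 2 by (simp del: dicyclic.simps)
    have comm: "a \<otimes>\<^bsub>aff\<^esub> b = b \<otimes>\<^bsub>aff\<^esub> a"
      using engel_edge_commute_y4[OF a(1) _ d] edges(2) unfolding 2 by simp
    have "b \<otimes>\<^bsub>aff\<^esub> b = z0" using d unfolding 2 by simp
    moreover have "(b \<otimes>\<^bsub>aff\<^esub> b) \<otimes>\<^bsub>aff\<^esub> a = a \<otimes>\<^bsub>aff\<^esub> (b \<otimes>\<^bsub>aff\<^esub> b)"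
      using comm a(1) b(1) by (intro E.commute_mult) (simp_all only:)
    ultimately show ?thesis by simp
  qed
  then obtain s l m n where a_eq: "a = (s, l, m, n, 0, 0, 0)" using centralizer_z0[OF a(1)] by blast
  have d: "dicyclic s l m n" using a(1) unfolding a_eq by (simp del: dicyclic.simps)
  have ne: "(s, l, m, n) \<noteq> (False, 1, 1, 1)" using a(2) unfolding a_eq by simp
  have sub: "plane_shifts \<subseteq> carrier aff" unfolding plane_shifts_def by auto
  have "x0 \<otimes>\<^bsub>aff\<^esub> a = a \<otimes>\<^bsub>aff\<^esub> x0"
  proof (rule E.commute_of_engel_edge[OF elements_closed(3) a(1) edges(1), of plane_shifts])
    show "commutator aff x0 a \<in> plane_shifts" unfolding a_eq by (rule commutator_plane[OF _ d]) simp
    show "commutator aff z a \<in> plane_shifts" if "z \<in> plane_shifts" for z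
      unfolding a_eq by (rule commutator_plane[OF that d])
    show "z = \<one>\<^bsub>aff\<^esub>" if "z \<in> plane_shifts" "z \<otimes>\<^bsub>aff\<^esub> a = a \<otimes>\<^bsub>aff\<^esub> z" for z
      using centralizer_in_plane[OF that(1) d ne] that(2) unfolding a_eq by simp
  qed (rule sub)
  then have "x0 = (False, 1, 1, 1, 0, 0, 0)"
    using centralizer_in_plane[OF _ d ne, of x0] unfolding a_eq by simp
  then show False by simp
qed

text \<open>A Frobenius complement contains the centralizers of its nontrivial elements. From any
  such element one reaches, through squares and centralizers, one with \<open>l = 1\<close>; this
  commutes with the translation \<open>t1\<close>. Then \<open>H\<close> contains the normal line of
  translations in the first coordinate, and so is the whole group.\<close>

lemma affine_not_frobenius: "\<not> frobenius_group aff"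
proof
  assume "frobenius_group aff"
  then obtain H where H: "subgroup H aff" "H \<noteq> {\<one>\<^bsub>aff\<^esub>}" "H \<noteq> carrier aff"
    and TI: "\<And>g. g \<in> carrier aff - H \<Longrightarrow>
      H \<inter> (g <#\<^bsub>aff\<^esub> H #>\<^bsub>aff\<^esub> inv\<^bsub>aff\<^esub> g) = {\<one>\<^bsub>aff\<^esub>}"
    unfolding frobenius_group_def by blast
  interpret H: subgroup H aff by fact
  have conj: "g \<in> H" if "h \<in> H" "h \<noteq> \<one>\<^bsub>aff\<^esub>" "g \<in> carrier aff"
    "g \<otimes>\<^bsub>aff\<^esub> h \<otimes>\<^bsub>aff\<^esub> inv\<^bsub>aff\<^esub> g \<in> H" for g h
  proof (rule ccontr)
    assume "g \<notin> H"
    then have "g \<otimes>\<^bsub>aff\<^esub> h \<otimes>\<^bsub>aff\<^esub> inv\<^bsub>aff\<^esub> g = \<one>\<^bsub>aff\<^esub>"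
      using TI[of g] that unfolding l_coset_def r_coset_def by blast
    moreover have "h = inv\<^bsub>aff\<^esub> g \<otimes>\<^bsub>aff\<^esub> (g \<otimes>\<^bsub>aff\<^esub> h \<otimes>\<^bsub>aff\<^esub> inv\<^bsub>aff\<^esub> g) \<otimes>\<^bsub>aff\<^esub> g"
      using that(3) H.mem_carrier[OF that(1)]
      by (simp only: E.m_assoc E.m_closed E.inv_closed E.cancel_left E.l_inv E.r_one)
    ultimately have "h = \<one>\<^bsub>aff\<^esub>"
      using that(3) by (simp only: E.r_one E.inv_closed E.l_inv)
    then show False using that(2) by blast
  qed
  have comm: "g \<in> H" if "h \<in> H" "h \<noteq> (False, 1, 1, 1, 0, 0, 0)" "g \<in> carrier aff"
    "affine_mult g h = affine_mult h g" for g h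
  proof (rule conj[OF that(1) _ that(3)])
    have "g \<otimes>\<^bsub>aff\<^esub> h \<otimes>\<^bsub>aff\<^esub> inv\<^bsub>aff\<^esub> g = h"
      using E.conj_eq_iff_commute[OF that(3) H.mem_carrier[OF that(1)]] that(4) by simp
    then show "g \<otimes>\<^bsub>aff\<^esub> h \<otimes>\<^bsub>aff\<^esub> inv\<^bsub>aff\<^esub> g \<in> H" using that(1) by (simp only:)
  qed (use that in simp)
  define t1 :: affine where "t1 = (False, 1, 1, 1, 1, 0, 0)"
  have unip: "t1 \<in> H" if "h \<in> H" "h \<noteq> (False, 1, 1, 1, 0, 0, 0)" "h = (False, 1, m, n, w, u, v)" for h m n w u v
    by (rule comm[OF that(1,2)]) (simp_all add: t1_def that(3))
  have nonswap: "t1 \<in> H" if h: "h \<in> H" "h \<noteq> (False, 1, 1, 1, 0, 0, 0)" "h = (False, l, m, n, w, u, v)" for h l m n w u v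
  proof -
    have d: "dicyclic False l m n" using H.mem_carrier[OF h(1)] unfolding h(3) by (simp del: dicyclic.simps)
    show ?thesis
    proof (cases "l = 1")
      case True
      then show ?thesis using unip[OF h(1,2)] h(3) by blast
    next
      case False
      then have l: "l = - 1" using dicyclic_False(1)[OF d] by blast
      have hh: "affine_mult h h \<in> H" using H.m_closed[OF h(1) h(1)] by simp
      show ?thesis
      proof (cases "affine_mult h h = (False, 1, 1, 1, 0, 0, 0)")
        case False
        then show ?thesis using unip[OF hh] unfolding h(3) l by simp
      next
        case True
        then have "m * m = 1" "n * n = 1" unfolding h(3) by simp_all
        then have "m = - 1" "n = - 1" using dicyclic_False(4,5)[OF d] l by simp_all
        then have h': "h = (False, - 1, - 1, - 1, w, u, v)" using h(3) l by simp
        \<comment> \<open>Here \<open>h\<close> is a reflection in a point. The element of order 3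
          with linear part diag(1, 3, 9) fixing that same point commutes with it; 3 and 9 are the
          primitive cube roots of unity modulo 13.\<close>
        have "(False, 1, 3, 9, 0, - u, - (4 * v)) \<in> H"
          by (rule comm[OF h(1,2)]) (simp_all add: h' algebra_simps)
        then show ?thesis by (rule unip) simp_all
      qed
    qed
  qed
  obtain h where h: "h \<in> H" "h \<noteq> (False, 1, 1, 1, 0, 0, 0)" using H(2) H.one_closed unfolding affine_simps(3) by blast
  obtain s l m n w u v where h_eq: "h = (s, l, m, n, w, u, v)" "dicyclic s l m n"
    using affine_cases[OF H.mem_carrier[OF h(1)]] .
  have t1: "t1 \<in> H"
  proof (cases s)
    case False
    then show ?thesis using nonswap[OF h] h_eq(1) by simp
  next
    case True
    have hh: "affine_mult h h \<in> H" using H.m_closed[OF h(1) h(1)] by simp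
    have "l * l = - 1" using h_eq(2) True by simp
    then have "affine_mult h h \<noteq> (False, 1, 1, 1, 0, 0, 0)" using five_five unfolding h_eq(1) by auto
    then show ?thesis using nonswap[OF hh] unfolding h_eq(1) using True by simp
  qed
  have t1_ne: "t1 \<noteq> \<one>\<^bsub>aff\<^esub>" unfolding t1_def by simp
  have line: "(False, 1, 1, 1, w, 0, 0) \<in> H" for w
    by (rule comm[OF t1]) (simp_all add: t1_def add.commute)
  have "g \<in> H" if g: "g \<in> carrier aff" for g
  proof (rule conj[OF t1 t1_ne g])
    obtain s l m n w u v where g_eq: "g = (s, l, m, n, w, u, v)" using affine_cases[OF g] .
    have "g \<otimes>\<^bsub>aff\<^esub> t1 = (False, 1, 1, 1, l, 0, 0) \<otimes>\<^bsub>aff\<^esub> g"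
      unfolding g_eq t1_def by (simp add: add.commute)
    then have "g \<otimes>\<^bsub>aff\<^esub> t1 \<otimes>\<^bsub>aff\<^esub> inv\<^bsub>aff\<^esub> g = (False, 1, 1, 1, l, 0, 0)"
      using g H.mem_carrier[OF line[of l]] by (simp only: E.m_assoc E.inv_closed E.r_inv E.r_one)
    then show "g \<otimes>\<^bsub>aff\<^esub> t1 \<otimes>\<^bsub>aff\<^esub> inv\<^bsub>aff\<^esub> g \<in> H" using line by (simp only:)
  qed
  then show False using H(3) H.subset by blast
qed

section \<open>The diameter of the example\<close>

lemma affine_diam_le: "digraph_diam (with_proj (engel_graph aff)) \<le> enat 4"
proof -
  have "\<not> frobenius_group (aff Mod hypercenter aff)"
  proof
    assume frob: "frobenius_group (aff Mod hypercenter aff)"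
    interpret N: normal "{\<one>\<^bsub>aff\<^esub>}" aff by (rule E.one_is_normal)
    have "frobenius_group aff"
      using frobenius_group_iso[OF E.is_group N.factorgroup_is_group E.iso_Mod_trivial] frob
      unfolding E.hypercenter_trivial[OF center_affine] .
    then show False using affine_not_frobenius by blast
  qed
  then show ?thesis
    using engel_diam_le_4[OF E.is_group finite_affine solvable_affine] by (simp add: numeral_eq_enat)
qed

lemma affine_diam_not_le: "\<not> digraph_diam (with_proj (engel_graph aff)) \<le> enat 3"
proof
  note hyp = E.hypercenter_trivial[OF center_affine]
  assume "digraph_diam (with_proj (engel_graph aff)) \<le> enat 3"
  then have "(x0, y4) \<in> parcs (engel_graph aff) ^^ 3"
    unfolding E.engel_diam_le_iff hyp using elements_closed by auto
  then obtain a b where "(x0, a) \<in> parcs (engel_graph aff)" "(a, b) \<in> parcs (engel_graph aff)"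
    "(b, y4) \<in> parcs (engel_graph aff)"
    by (auto simp: numeral_3_eq_3 simp del: affine_simps)
  then show False using no_short_path unfolding E.parcs_engel_graph[OF hyp] by blast
qed

theorem ex_group_diam_4:
  "\<exists>G :: nat monoid. group G \<and> finite (carrier G) \<and> solvable G \<and> digraph_diam (with_proj (engel_graph G)) = 4"
proof -
  obtain f :: "affine \<Rightarrow> nat" where f: "inj f"
    using finite_imp_inj_to_nat_seg[of "UNIV :: affine set"] by auto
  define G where "G = image_group f aff"
  have inj: "inj_on f (carrier aff)" using f inj_on_subset by blast
  have iso: "f \<in> iso aff G" unfolding G_def by (rule inj_imp_image_group_iso[OF inj])
  interpret G: group G unfolding G_def by (rule E.inj_imp_image_group_is_group[OF inj])
  interpret f: group_hom aff G f using iso by unfold_locales (simp add: iso_def)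
  have bij: "f ` carrier aff = carrier G" using iso unfolding iso_def bij_betw_def by blast
  have sol: "solvable G" by (rule f.surj_hom_imp_solvable[OF bij solvable_affine])
  have fin: "finite (carrier G)" unfolding bij[symmetric] using finite_affine by simp
  have center: "group_center G = {\<one>\<^bsub>G\<^esub>}"
  proof -
    have "z = \<one>\<^bsub>G\<^esub>" if z: "z \<in> group_center G" for z
    proof -
      have zc: "z \<in> carrier G" and comm: "\<And>g. g \<in> carrier G \<Longrightarrow> z \<otimes>\<^bsub>G\<^esub> g = g \<otimes>\<^bsub>G\<^esub> z"
        using z unfolding group_center_def by auto
      obtain x where x: "x \<in> carrier aff" "z = f x" using zc unfolding bij[symmetric] by blast
      have "x \<otimes>\<^bsub>aff\<^esub> g = g \<otimes>\<^bsub>aff\<^esub> x" if g: "g \<in> carrier aff" for g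
      proof -
        have "f (x \<otimes>\<^bsub>aff\<^esub> g) = f (g \<otimes>\<^bsub>aff\<^esub> x)"
          using comm[of "f g"] x g f.hom_mult[OF x(1) g] f.hom_mult[OF g x(1)] f.hom_closed[OF g] by (simp only:)
        then show ?thesis using f by (rule injD[rotated])
      qed
      then have "x \<in> group_center aff" unfolding group_center_def using x(1) by blast
      then show ?thesis using center_affine x(2) f.hom_one by (simp del: affine_simps)
    qed
    moreover have "\<one>\<^bsub>G\<^esub> \<in> group_center G" unfolding group_center_def by simp
    ultimately show ?thesis by blast
  qed
  have "digraph_diam (with_proj (engel_graph G)) \<le> enat 4"
    by (rule engel_diam_iso[OF G.is_group center E.is_group center_affine E.iso_set_sym[OF iso] affine_diam_le])
  moreover have "\<not> digraph_diam (with_proj (engel_graph G)) \<le> enat 3"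
    using engel_diam_iso[OF E.is_group center_affine G.is_group center iso] affine_diam_not_le by blast
  then have "enat 4 \<le> digraph_diam (with_proj (engel_graph G))"
    by (cases "digraph_diam (with_proj (engel_graph G))") auto
  ultimately have "digraph_diam (with_proj (engel_graph G)) = enat 4" by (rule order_antisym)
  then show ?thesis using fin sol G.is_group by (intro exI[of _ G]) (simp add: numeral_eq_enat)
qed

theorem theorem1p3:
  shows "(\<forall>G :: ('a, 'b) monoid_scheme.
            group G \<and> finite (carrier G) \<and> solvable G \<and>
            \<not> frobenius_group (G Mod hypercenter G) \<longrightarrow>
            digraph_diam (with_proj (engel_graph G)) \<le> 4) \<and>
         (\<exists>G :: nat monoid.
            group G \<and> finite (carrier G) \<and> solvable G \<and>
            digraph_diam (with_proj (engel_graph G)) = 4)"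
  using engel_diam_le_4 ex_group_diam_4 by blast


end
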